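(* Let $(K,v)$ be a valued field, let $\overline{K}$ be an algebraic closure of $K$, let $\bar v$ be an extension of $v$ to $\overline{K}$, and let $(K^h,v^h)$ be the henselization of $(K,v)$ determined by $\bar v$. Let $\mathcal{T}_v$ be the tree whose nodes are the equivalence classes of valuations on $K[x]$ whose restriction to $K$ is equivalent to $v$, and let $\mathcal{T}_{v^h}$ be the tree whose nodes are the equivalence classes of valuations on $K^h[x]$ whose restriction to $K^h$ is equivalent to $v^h$. Then the restriction mapping $\mathcal{T}_{v^h}\to\mathcal{T}_v$, $[\eta]\mapsto[\eta_{|K[x]}]$, is an isomorphism of posets.
   Context: All ordered abelian groups are totally ordered. A valuation on a commutative ring $R$ is a map $\mu\colon R\to G\cup\{\infty\}$, with $G$ an ordered abelian group, such that $\mu(0)=\infty$, $\mu(1)=0$, $\mu(fg)=\mu(f)+\mu(g)$, $\mu(f+g)\ge\min\{\mu(f),\mu(g)\}$; the support $\mu^{-1}(\infty)$ is a prime ideal which may be nonzero, and the value group $\Gamma_\mu$ is the subgroup of $G$ generated by $\mu(R\setminus\mu^{-1}(\infty))$. Two valuations $\mu,\nu$ on the same ring are equivalent, $\mu\sim\nu$, if there is an order-preserving group isomorphism $\iota\colon\Gamma_\mu\to\Gamma_\nu$ such that $\nu=\iota\circ\mu$ (with $\iota(\infty)=\infty$); $[\mu]$ is the equivalence class of $\mu$. The restriction mapping on classes is well defined. Henselization: $K^h$ is the fixed field, in the separable closure $K^{\mathrm{sep}}$ of $K$ in $\overline K$, of $\{\sigma\in\mathrm{Gal}(K^{\mathrm{sep}}/K)\mid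 \bar v\circ\sigma=\bar v\}$, and $v^h=\bar v_{|K^h}$. Write $\Gamma=v(K^* )$. Order on $\mathcal{T}_v$ and $\mathcal{T}_{v^h}$: fix an embedding of $\Gamma$ into a divisible ordered abelian group $\Lambda$ which is universal in the sense that every valuation on $K^h[x]$ whose restriction to $K^h$ is equivalent to $v^h$ is equivalent to some valuation with values in $\Lambda\cup\{\infty\}$ whose restriction to $K^h$ is equal to $v^h$ (such $\Lambda$ exists, and it has the analogous property for $K[x]$ and $v$). As $\Lambda$ is divisible, the value group of $\bar v$ is identified with the divisible hull $\Gamma\otimes\mathbb{Q}\subset\Lambda$, so that $\bar v$ and $v^h$ take values in $\Lambda\cup\{\infty\}$. Let $\mathcal{T}(K)$ (resp. $\mathcal{T}(K^h)$) be the set of all valuations on $K[x]$ (resp. $K^h[x]$) with values in $\Lambda\cup\{\infty\}$ and restriction to $K$ (resp. $K^h$) equal to $v$ (resp. $v^h$), partially ordered by $\mu\le\nu\Leftrightarrow\mu(f)\le\nu(f)$ for all polynomials $f$. Then $\mathcal{T}_v$ and $\mathcal{T}_{v^h}$ are identified with the quotient sets $\mathcal{T}(K)/\!\sim$ and $\mathcal{T}(K^h)/\!\sim$, and they are equipped with the induced order: for distinct classes, $[\nu]<[\mu]$ if and only if $\nu<\mu$ for representatives $\nu,\mu$ in $\mathcal{T}(K)$ (resp. $\mathcal{T}(K^h)$); this does not depend on the choice of representatives. *)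

theory Defs
  imports
    "HOL-Algebra.Elementary_Groups"
    "HOL-Computational_Algebra.Polynomial"
    "HOL-Library.FuncSet"
begin

section \<open>Ordered abelian groups\<close>

text \<open>
  Groups have an explicit carrier, and are written multiplicatively as in HOL-Algebra, so that
  value groups are ordered groups in their own right and so that one can quantify over all
  ordered abelian groups (of bounded cardinality) inside a formula.
\<close>

record 'g ordered_group = "'g monoid" +
  grp_le :: "'g \<Rightarrow> 'g \<Rightarrow> bool"  (infix \<open>\<preceq>\<index>\<close> 50)

locale ordered_abelian_group = comm_group G for G (structure) +
  assumes grp_le_refl: "x \<in> carrier G \<Longrightarrow> x \<preceq> x"
    and grp_le_trans: "\<lbrakk>x \<in> carrier G; y \<in> carrier G; z \<in> carrier G; x \<preceq> y; y \<preceq> z\<rbrakk> \<Longrightarrow> x \<preceq> z"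
    and grp_le_antisym: "\<lbrakk>x \<in> carrier G; y \<in> carrier G; x \<preceq> y; y \<preceq> x\<rbrakk> \<Longrightarrow> x = y"
    and grp_le_total: "\<lbrakk>x \<in> carrier G; y \<in> carrier G\<rbrakk> \<Longrightarrow> x \<preceq> y \<or> y \<preceq> x"
    and grp_le_mult: "\<lbrakk>x \<in> carrier G; y \<in> carrier G; z \<in> carrier G; x \<preceq> y\<rbrakk>
      \<Longrightarrow> x \<otimes> z \<preceq> y \<otimes> z"

text \<open>The ordered abelian group carried by a type; its operation is addition.\<close>

definition class_group :: "'g::linordered_ab_group_add ordered_group" where
  "class_group = \<lparr>carrier = UNIV, monoid.mult = (+), one = 0, grp_le = (\<le>)\<rparr>"

lemma ordered_abelian_group_class_group:
  "ordered_abelian_group (class_group :: 'g::linordered_ab_group_add ordered_group)"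
proof -
  have "comm_group (class_group :: 'g ordered_group)"
  proof (rule comm_groupI)
    fix x :: 'g
    show "\<exists>y\<in>carrier class_group. y \<otimes>\<^bsub>class_group\<^esub> x = \<one>\<^bsub>class_group\<^esub>"
      by (rule bexI[of _ "- x"]) (auto simp: class_group_def)
  qed (auto simp: class_group_def algebra_simps)
  then show ?thesis
    by (auto simp: ordered_abelian_group_def ordered_abelian_group_axioms_def class_group_def)
qed

definition divisible_group :: "('g, 'b) monoid_scheme \<Rightarrow> bool" where
  "divisible_group G \<longleftrightarrow>
     (\<forall>x\<in>carrier G. \<forall>n>0. \<exists>y\<in>carrier G. y [^]\<^bsub>G\<^esub> (n::nat) = x)"


section \<open>Valuations on commutative rings\<close>

datatype 'g with_infty = Fin 'g | Infty

fun plus_infty :: "'g ordered_group \<Rightarrow> 'g with_infty \<Rightarrow> 'g with_infty \<Rightarrow> 'g with_infty" where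
  "plus_infty G (Fin x) (Fin y) = Fin (x \<otimes>\<^bsub>G\<^esub> y)"
| "plus_infty G _ _ = Infty"

fun le_infty :: "'g ordered_group \<Rightarrow> 'g with_infty \<Rightarrow> 'g with_infty \<Rightarrow> bool" where
  "le_infty G _ Infty \<longleftrightarrow> True"
| "le_infty G Infty (Fin y) \<longleftrightarrow> False"
| "le_infty G (Fin x) (Fin y) \<longleftrightarrow> x \<preceq>\<^bsub>G\<^esub> y"

definition min_infty :: "'g ordered_group \<Rightarrow> 'g with_infty \<Rightarrow> 'g with_infty \<Rightarrow> 'g with_infty" where
  "min_infty G a b = (if le_infty G a b then a else b)"

text \<open>\<open>R\<close> is meant to be a subring of its type; values outside \<open>R\<close> are irrelevant.\<close>

definition valuation_on ::
  "'g ordered_group \<Rightarrow> 'r::comm_ring_1 set \<Rightarrow> ('r \<Rightarrow> 'g with_infty) \<Rightarrow> bool" where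
  "valuation_on G R \<mu> \<longleftrightarrow>
     (\<forall>f\<in>R. set_with_infty (\<mu> f) \<subseteq> carrier G) \<and>
     \<mu> 0 = Infty \<and> \<mu> 1 = Fin \<one>\<^bsub>G\<^esub> \<and>
     (\<forall>f\<in>R. \<forall>g\<in>R. \<mu> (f * g) = plus_infty G (\<mu> f) (\<mu> g)) \<and>
     (\<forall>f\<in>R. \<forall>g\<in>R. le_infty G (min_infty G (\<mu> f) (\<mu> g)) (\<mu> (f + g)))"

definition value_group ::
  "'g ordered_group \<Rightarrow> 'r set \<Rightarrow> ('r \<Rightarrow> 'g with_infty) \<Rightarrow> 'g ordered_group" where
  "value_group G R \<mu> = subgroup_generated G {g. \<exists>f\<in>R. \<mu> f = Fin g}"

definition valuation_equiv ::
  "'r set \<Rightarrow> 'g ordered_group \<Rightarrow> ('r \<Rightarrow> 'g with_infty) \<Rightarrow>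
     'h ordered_group \<Rightarrow> ('r \<Rightarrow> 'h with_infty) \<Rightarrow> bool" where
  "valuation_equiv R G \<mu> H \<nu> \<longleftrightarrow>
     (\<exists>\<iota>\<in>iso (value_group G R \<mu>) (value_group H R \<nu>).
        (\<forall>x\<in>carrier (value_group G R \<mu>). \<forall>y\<in>carrier (value_group G R \<mu>).
           x \<preceq>\<^bsub>G\<^esub> y \<longrightarrow> \<iota> x \<preceq>\<^bsub>H\<^esub> \<iota> y) \<and>
        (\<forall>f\<in>R. \<nu> f = map_with_infty \<iota> (\<mu> f)))"


section \<open>Subfields, polynomials and the henselization\<close>

text \<open>Fields are subsets of one algebraically closed field, the type \<^typ>\<open>'a\<close>.\<close>

definition is_subfield :: "'a::field set \<Rightarrow> bool" where
  "is_subfield K \<longleftrightarrow> 0 \<in> K \<and> 1 \<in> K \<and>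
     (\<forall>a\<in>K. \<forall>b\<in>K. a + b \<in> K \<and> a * b \<in> K) \<and> (\<forall>a\<in>K. - a \<in> K \<and> inverse a \<in> K)"

definition polys_over :: "'a::zero set \<Rightarrow> 'a poly set" where
  "polys_over K = {p. \<forall>i. coeff p i \<in> K}"

definition is_algebraic_closure_of :: "'a::alg_closed_field itself \<Rightarrow> 'a set \<Rightarrow> bool" where
  "is_algebraic_closure_of _ K \<longleftrightarrow>
     is_subfield K \<and> (\<forall>a. \<exists>p\<in>polys_over K. p \<noteq> 0 \<and> poly p a = 0)"

definition is_minimal_poly :: "'a::field set \<Rightarrow> 'a \<Rightarrow> 'a poly \<Rightarrow> bool" where
  "is_minimal_poly K a p \<longleftrightarrow> p \<in> polys_over K \<and> lead_coeff p = 1 \<and> poly p a = 0 \<and>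
     (\<forall>q\<in>polys_over K. q \<noteq> 0 \<and> poly q a = 0 \<longrightarrow> degree p \<le> degree q)"

text \<open>
  As the ambient field is algebraically closed, \<^const>\<open>rsquarefree\<close> says that the minimal
  polynomial has no multiple root in an algebraic closure.
\<close>

definition sep_closure :: "'a::alg_closed_field set \<Rightarrow> 'a set" where
  "sep_closure K = {a. \<exists>p. is_minimal_poly K a p \<and> rsquarefree p}"

definition galois_group :: "'a::field set \<Rightarrow> 'a set \<Rightarrow> ('a \<Rightarrow> 'a) set" where
  "galois_group F K = {\<sigma> \<in> extensional F. bij_betw \<sigma> F F \<and>
     (\<forall>a\<in>F. \<forall>b\<in>F. \<sigma> (a + b) = \<sigma> a + \<sigma> b \<and> \<sigma> (a * b) = \<sigma> a * \<sigma> b) \<and>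
     (\<forall>a\<in>K. \<sigma> a = a)}"

definition decomposition_group ::
  "'a::alg_closed_field set \<Rightarrow> ('a \<Rightarrow> 'g with_infty) \<Rightarrow> ('a \<Rightarrow> 'a) set" where
  "decomposition_group K w =
     {\<sigma> \<in> galois_group (sep_closure K) K. \<forall>a\<in>sep_closure K. w (\<sigma> a) = w a}"

definition henselization ::
  "'a::alg_closed_field set \<Rightarrow> ('a \<Rightarrow> 'g with_infty) \<Rightarrow> 'a set" where
  "henselization K w = {a \<in> sep_closure K. \<forall>\<sigma>\<in>decomposition_group K w. \<sigma> a = a}"

definition hens_valuation ::
  "'a::alg_closed_field set \<Rightarrow> ('a \<Rightarrow> 'g with_infty) \<Rightarrow> 'a \<Rightarrow> 'g with_infty" where
  "hens_valuation K w = restrict w (henselization K w)"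


section \<open>The trees of valuations on polynomial rings\<close>

text \<open>
  \<open>universal_group \<Lambda> L w\<close>: every valuation on \<open>L[x]\<close> whose restriction to \<open>L\<close> is equivalent to
  \<open>w\<close> is equivalent to a \<open>\<Lambda>\<close>-valued one whose restriction to \<open>L\<close> equals \<open>w\<close>.
  The quantifier over all ordered abelian groups is rendered by those whose carrier is a
  subset of the type \<^typ>\<open>'a poly\<close>. Nothing is lost: up to equivalence a valuation takes its
  values in its value group, which is generated by the image of \<open>L[x]\<close> and hence has at most as
  many elements as the (infinite) type \<^typ>\<open>'a poly\<close>.
\<close>

definition universal_group ::
  "'g ordered_group \<Rightarrow> 'a::alg_closed_field set \<Rightarrow> ('a \<Rightarrow> 'g with_infty) \<Rightarrow> bool" where
  "universal_group \<Lambda> L w \<longleftrightarrow>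
     (\<forall>(G :: 'a poly ordered_group) \<eta>.
        ordered_abelian_group G \<and> valuation_on G (polys_over L) \<eta> \<and>
        valuation_equiv L G (\<lambda>a. \<eta> [:a:]) \<Lambda> w \<longrightarrow>
        (\<exists>\<mu>. valuation_on \<Lambda> (polys_over L) \<mu> \<and> (\<forall>a\<in>L. \<mu> [:a:] = w a) \<and>
             valuation_equiv (polys_over L) G \<eta> \<Lambda> \<mu>))"

text \<open>
  Below, \<open>\<T>(L)\<close> is \<open>valuations_extending \<Lambda> L w\<close>; its members are undefined outside \<open>L[x]\<close>,
  so that they are determined by their values on \<open>L[x]\<close>.
\<close>

definition valuations_extending ::
  "'g ordered_group \<Rightarrow> 'a::field set \<Rightarrow> ('a \<Rightarrow> 'g with_infty) \<Rightarrow> ('a poly \<Rightarrow> 'g with_infty) set"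
  where
  "valuations_extending \<Lambda> L w =
     {\<mu> \<in> extensional (polys_over L).
        valuation_on \<Lambda> (polys_over L) \<mu> \<and> (\<forall>a\<in>L. \<mu> [:a:] = w a)}"

definition valuation_le ::
  "'g ordered_group \<Rightarrow> 'a::field set \<Rightarrow>
     ('a poly \<Rightarrow> 'g with_infty) \<Rightarrow> ('a poly \<Rightarrow> 'g with_infty) \<Rightarrow> bool" where
  "valuation_le \<Lambda> L \<mu> \<nu> \<longleftrightarrow> (\<forall>f\<in>polys_over L. le_infty \<Lambda> (\<mu> f) (\<nu> f))"

definition equiv_rel ::
  "'g ordered_group \<Rightarrow> 'a::field set \<Rightarrow> ('a \<Rightarrow> 'g with_infty) \<Rightarrow>
     (('a poly \<Rightarrow> 'g with_infty) \<times> ('a poly \<Rightarrow> 'g with_infty)) set" where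
  "equiv_rel \<Lambda> L w =
     {(\<mu>, \<nu>). \<mu> \<in> valuations_extending \<Lambda> L w \<and> \<nu> \<in> valuations_extending \<Lambda> L w \<and>
        valuation_equiv (polys_over L) \<Lambda> \<mu> \<Lambda> \<nu>}"

definition val_tree ::
  "'g ordered_group \<Rightarrow> 'a::field set \<Rightarrow> ('a \<Rightarrow> 'g with_infty) \<Rightarrow>
     ('a poly \<Rightarrow> 'g with_infty) set set" where
  "val_tree \<Lambda> L w = valuations_extending \<Lambda> L w // equiv_rel \<Lambda> L w"

text \<open>
  For distinct classes \<open>\<nu> \<le> \<mu>\<close> is the same as \<open>\<nu> < \<mu>\<close>; comparable representatives of one and
  the same class do exist, hence the condition \<open>C \<noteq> D\<close>.
\<close>

definition tree_less ::
  "'g ordered_group \<Rightarrow> 'a::field set \<Rightarrow>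
     ('a poly \<Rightarrow> 'g with_infty) set \<Rightarrow> ('a poly \<Rightarrow> 'g with_infty) set \<Rightarrow> bool" where
  "tree_less \<Lambda> L C D \<longleftrightarrow> C \<noteq> D \<and> (\<exists>\<nu>\<in>C. \<exists>\<mu>\<in>D. valuation_le \<Lambda> L \<nu> \<mu>)"

definition tree_le ::
  "'g ordered_group \<Rightarrow> 'a::field set \<Rightarrow>
     ('a poly \<Rightarrow> 'g with_infty) set \<Rightarrow> ('a poly \<Rightarrow> 'g with_infty) set \<Rightarrow> bool" where
  "tree_le \<Lambda> L C D \<longleftrightarrow> C = D \<or> tree_less \<Lambda> L C D"

text \<open>The map induced on classes by \<open>\<eta> \<mapsto> \<eta>|\<^bsub>K[x]\<^esub>\<close>, as a union of equal classes.\<close>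

definition class_restriction ::
  "'g ordered_group \<Rightarrow> 'a::field set \<Rightarrow> ('a \<Rightarrow> 'g with_infty) \<Rightarrow>
     ('a poly \<Rightarrow> 'g with_infty) set \<Rightarrow> ('a poly \<Rightarrow> 'g with_infty) set" where
  "class_restriction \<Lambda> K v C =
     (\<Union>\<eta>\<in>C. equiv_rel \<Lambda> K v `` {restrict \<eta> (polys_over K)})"

definition poset_isomorphism ::
  "'p set \<Rightarrow> ('p \<Rightarrow> 'p \<Rightarrow> bool) \<Rightarrow> 'q set \<Rightarrow> ('q \<Rightarrow> 'q \<Rightarrow> bool) \<Rightarrow> ('p \<Rightarrow> 'q) \<Rightarrow> bool" where
  "poset_isomorphism P leP Q leQ f \<longleftrightarrow>
     bij_betw f P Q \<and> (\<forall>x\<in>P. \<forall>y\<in>P. leP x y \<longleftrightarrow> leQ (f x) (f y))"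

end

theory Submission
  imports
    Defs
    "HOL-Computational_Algebra.Primes"
    "HOL-Computational_Algebra.Polynomial_Factorial"
begin

text \<open>
  Extend every valuation in question to \<open>K'[x]\<close>, where \<open>K'\<close> is the algebraic closure, so that it
  restricts to \<open>vbar\<close> on constants. Two such extensions that agree up to equivalence on \<open>K[x]\<close> are
  conjugate under some \<open>\<sigma>\<close> in \<open>Aut(K'/K)\<close>; since both restrict to \<open>vbar\<close>, \<open>\<sigma>\<close> preserves \<open>vbar\<close> and
  hence fixes the henselization, so the two are already equivalent on \<open>K\<^sup>h[x]\<close>. This gives injectivity,
  and the existence of extensions gives surjectivity. For the order, let \<open>\<mu> < \<rho>\<close> on \<open>K[x]\<close> with \<open>\<rho>\<close> defined
  on \<open>K'[x]\<close>, and choose \<open>g\<close> in \<open>K[x]\<close> with \<open>\<mu>(g) < \<rho>(g)\<close>. If \<open>a\<close> is the root of \<open>g\<close> closest to \<open>x\<close> for \<open>\<rho>\<close>, some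
  disc valuation \<open>\<omega>\<close> centred at \<open>a\<close> satisfies \<open>\<omega> \<le> \<rho>\<close> and \<open>\<omega>(g) = \<mu>(g)\<close>; as valuations below a fixed
  one form a chain on which the value at \<open>g\<close> is decisive, \<open>\<omega>\<close> restricts to \<open>\<mu>\<close>. So \<open>\<mu> < \<rho>\<close> lifts.
\<close>

section \<open>Subrings, minimal polynomials and adjunction\<close>

text \<open>The conjugacy statement carries the weight. \<sigma> has to be found in the automorphism
  group of an extension that may be infinite and inseparable. It is built by Zorn's lemma from
  partial embeddings compatible with the two valuations, so that only the adjunction of one element
  remains. That element has finitely many conjugates, and a norm moves the comparison down to a ring
  on which the valuations already agree. Norm coefficients are fixed by all automorphisms, which
  puts only some power of them, with exponent a power of the characteristic exponent, into the
  subfield. Applied to Gauss valuations, the same result gives conjugacy for valuations of fields.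
  This settles valuations with nonzero support, and it lets an extension be twisted until it induces
  \<open>vbar\<close> itself on constants. Equivalence of valuations is treated as agreement of the
  order on values; since ordered groups have no torsion, order agreement on the closure together
  with equal values on \<open>K\<close> forces equality, which is why \<sigma> preserves
  \<open>vbar\<close> and not merely its class.\<close>

definition is_subring :: "'r::comm_ring_1 set \<Rightarrow> bool" where
  "is_subring S \<longleftrightarrow> 0 \<in> S \<and> 1 \<in> S \<and>
     (\<forall>a\<in>S. \<forall>b\<in>S. a + b \<in> S \<and> a * b \<in> S) \<and> (\<forall>a\<in>S. - a \<in> S)"

lemma is_subringD:
  assumes "is_subring S"
  shows "0 \<in> S" "1 \<in> S" "\<And>a b. a \<in> S \<Longrightarrow> b \<in> S \<Longrightarrow> a + b \<in> S"
    "\<And>a b. a \<in> S \<Longrightarrow> b \<in> S \<Longrightarrow> a * b \<in> S" "\<And>a. a \<in> S \<Longrightarrow> - a \<in> S"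
    "\<And>a b. a \<in> S \<Longrightarrow> b \<in> S \<Longrightarrow> a - b \<in> S"
  using assms unfolding is_subring_def
  by (blast, blast, blast, blast, blast, metis diff_conv_add_uminus)

lemma subring_power: "is_subring S \<Longrightarrow> a \<in> S \<Longrightarrow> a ^ n \<in> S"
  by (induction n) (auto intro: is_subringD)

lemma subring_sum: "is_subring S \<Longrightarrow> (\<And>i. i \<in> I \<Longrightarrow> f i \<in> S) \<Longrightarrow> sum f I \<in> S"
  by (induction I rule: infinite_finite_induct) (auto intro: is_subringD)

lemma subring_prod: "is_subring S \<Longrightarrow> (\<And>i. i \<in> I \<Longrightarrow> f i \<in> S) \<Longrightarrow> prod f I \<in> S"
  by (induction I rule: infinite_finite_induct) (auto intro: is_subringD)

lemma is_subring_UNIV: "is_subring UNIV"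
  by (simp add: is_subring_def)

lemma is_subfield_subring: "is_subfield K \<Longrightarrow> is_subring K"
  by (auto simp: is_subfield_def is_subring_def)

lemma is_subfield_inverse: "is_subfield K \<Longrightarrow> a \<in> K \<Longrightarrow> inverse a \<in> K"
  by (auto simp: is_subfield_def)

lemma is_subfield_divide: "is_subfield K \<Longrightarrow> a \<in> K \<Longrightarrow> b \<in> K \<Longrightarrow> a / b \<in> K"
  by (auto simp: is_subfield_def divide_inverse)

lemma polys_over_coeff: "p \<in> polys_over S \<Longrightarrow> coeff p i \<in> S"
  by (simp add: polys_over_def)

lemma polys_overI: "(\<And>i. coeff p i \<in> S) \<Longrightarrow> p \<in> polys_over S"
  by (simp add: polys_over_def)

lemma polys_over_mono: "S \<subseteq> T \<Longrightarrow> polys_over S \<subseteq> polys_over T"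
  by (auto simp: polys_over_def)

lemma polys_over_const: "is_subring S \<Longrightarrow> a \<in> S \<Longrightarrow> [:a:] \<in> polys_over S"
  by (auto simp: polys_over_def coeff_pCons is_subringD split: nat.splits)

lemma polys_over_monom: "is_subring S \<Longrightarrow> a \<in> S \<Longrightarrow> monom a n \<in> polys_over S"
  by (auto simp: polys_over_def is_subringD)

lemma polys_over_X: "is_subring S \<Longrightarrow> [:0, 1:] \<in> polys_over S"
  by (auto simp: polys_over_def coeff_pCons is_subringD split: nat.splits)

lemma is_subring_polys_over: 
  assumes "is_subring S"
  shows "is_subring (polys_over S)"
proof -
  note S = is_subringD[OF assms]
  show ?thesis unfolding is_subring_def
  proof (intro conjI ballI)
    show "0 \<in> polys_over S" "1 \<in> polys_over S"
      using S by (auto simp: polys_over_def coeff_1)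
  next
    fix p q assume p: "p \<in> polys_over S" and q: "q \<in> polys_over S"
    then show "p + q \<in> polys_over S"
      using S by (auto simp: polys_over_def)
    show "p * q \<in> polys_over S"
      using p q by (auto simp: polys_over_def coeff_mult intro!: subring_sum[OF assms] S)
  next
    fix p assume p: "p \<in> polys_over S"
    then show "- p \<in> polys_over S"
      using S by (auto simp: polys_over_def)
  qed
qed

lemma poly_in_subring:
  assumes "is_subring S" "p \<in> polys_over S" "a \<in> S"
  shows "poly p a \<in> S"
  using assms by (auto simp: poly_altdef polys_over_def intro!: subring_sum is_subringD(4) subring_power)

text \<open>Cancelling leading terms only divides by the leading coefficient of \<open>g\<close>,
  and this happens inside \<open>M\<close>; so quotient and remainder stay over
  \<open>M\<close>.\<close>

lemma polys_over_division:
  assumes M: "is_subfield M" and g: "g \<in> polys_over M" "g \<noteq> 0"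
  shows "f \<in> polys_over M \<Longrightarrow>
    \<exists>q\<in>polys_over M. \<exists>r\<in>polys_over M. f = q * g + r \<and> (r = 0 \<or> degree r < degree g)"
proof (induction "degree f" arbitrary: f rule: less_induct)
  case less
  note Mr = is_subfield_subring[OF M]
  note P = is_subringD[OF is_subring_polys_over[OF Mr]]
  show ?case
  proof (cases "f = 0 \<or> degree f < degree g")
    case True
    then show ?thesis using less.prems P(1) by (intro bexI[of _ 0] bexI[of _ f]) auto
  next
    case False
    define q0 where "q0 = monom (lead_coeff f / lead_coeff g) (degree f - degree g)"
    have q0: "q0 \<in> polys_over M"
      unfolding q0_def
      by (intro polys_over_monom Mr is_subfield_divide[OF M] polys_over_coeff g less.prems)
    let ?f = "f - q0 * g"
    have f: "?f \<in> polys_over M" using q0 g less.prems by (intro P)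
    have "lead_coeff f / lead_coeff g \<noteq> 0" using False g by auto
    then have dq: "degree (q0 * g) = degree f" and "q0 \<noteq> 0"
      using False g by (auto simp: q0_def degree_mult_eq degree_monom_eq monom_eq_0_iff)
    have lc: "lead_coeff (q0 * g) = lead_coeff f"
      using False g by (auto simp: lead_coeff_mult q0_def degree_monom_eq)
    \<comment> \<open>A difference of constants cannot drop in degree, so at degree 0 it has to
      vanish outright.\<close>
    have "?f = 0 \<or> degree ?f < degree f"
    proof (cases "degree f = 0")
      case True
      then have "degree ?f = 0" using dq by (metis degree_diff_le le_zero_eq order_refl)
      moreover have "coeff ?f 0 = 0" using True dq lc by simp
      ultimately show ?thesis by (metis leading_coeff_0_iff)
    next
      case F: False
      have "degree ?f \<le> degree f" using dq by (simp add: degree_diff_le)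
      moreover have "coeff ?f (degree f) = 0" using dq lc by simp
      ultimately show ?thesis
        by (metis le_neq_implies_less leading_coeff_0_iff)
    qed
    then obtain q r where "q \<in> polys_over M" "r \<in> polys_over M"
      "?f = q * g + r" "r = 0 \<or> degree r < degree g"
    proof
      assume "?f = 0" then show ?thesis using that[of 0 0] P(1) by simp
    next
      assume "degree ?f < degree f" 
      from less.hyps[OF this f] show ?thesis using that by blast
    qed
    then show ?thesis using q0 P
      by (intro bexI[of _ "q0 + q"] bexI[of _ r]) (auto simp: algebra_simps)
  qed
qed

lemma minimal_poly_exists:
  fixes M :: "'a::field set"
  assumes M: "is_subfield M" and a: "p \<in> polys_over M" "p \<noteq> 0" "poly p a = 0"
  shows "\<exists>m. is_minimal_poly M a m"
proof -
  note Mr = is_subfield_subring[OF M]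
  note P = is_subringD[OF is_subring_polys_over[OF Mr]]
  let ?S = "\<lambda>q. q \<in> polys_over M \<and> q \<noteq> 0 \<and> poly q a = 0"
  define m where "m = (ARG_MIN degree q. ?S q)"
  have m: "?S m" and min: "\<And>q. ?S q \<Longrightarrow> degree m \<le> degree q"
    using arg_min_nat_lemma[of ?S p degree] a by (auto simp: m_def)
  let ?m = "[:inverse (lead_coeff m):] * m"
  have "?m \<in> polys_over M"
    by (intro P(4) polys_over_const[OF Mr] is_subfield_inverse[OF M] polys_over_coeff) (use m in auto)
  moreover have "lead_coeff ?m = 1" "poly ?m a = 0" "degree ?m = degree m" using m by auto
  ultimately show ?thesis using min unfolding is_minimal_poly_def by metis
qed

lemma minimal_poly_dvd:
  fixes M :: "'a::field set"
  assumes M: "is_subfield M" and m: "is_minimal_poly M a m"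
    and q: "q \<in> polys_over M" "poly q a = 0"
  shows "\<exists>s\<in>polys_over M. q = s * m"
proof -
  note P = is_subringD[OF is_subring_polys_over[OF is_subfield_subring[OF M]]]
  have "m \<noteq> 0" using m by (auto simp: is_minimal_poly_def)
  then obtain s r where sr: "s \<in> polys_over M" "r \<in> polys_over M" "q = s * m + r" 
     "r = 0 \<or> degree r < degree m"
    using polys_over_division[OF M _ _ q(1), of m] m by (auto simp: is_minimal_poly_def)
  have "poly r a = 0" using sr(3) q(2) m by (auto simp: is_minimal_poly_def)
  then have "r = 0" using sr m unfolding is_minimal_poly_def by (meson not_less)
  then show ?thesis using sr by auto
qed

lemma minimal_poly_degree_pos:
  assumes "is_minimal_poly M a m"
  shows "degree m > 0"
proof (rule ccontr)
  assume "\<not> ?thesis"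
  then obtain c where "m = [:c:]" by (auto elim: degree_eq_zeroE)
  then show False using assms by (auto simp: is_minimal_poly_def)
qed

lemma minimal_poly_subset:
  fixes K :: "'a::field set"
  assumes "is_subfield M" "is_subfield K" "K \<subseteq> M" "is_minimal_poly K a p" 
  shows "\<exists>m s. is_minimal_poly M a m \<and> s \<in> polys_over M \<and> p = s * m"
proof -
  have p: "p \<in> polys_over M" "p \<noteq> 0" "poly p a = 0" 
    using assms polys_over_mono by (auto simp: is_minimal_poly_def)
  from minimal_poly_exists[OF assms(1) p] obtain m where "is_minimal_poly M a m" by auto
  with minimal_poly_dvd[OF assms(1) this p(1) p(3)] show ?thesis by auto
qed

text \<open>The constant term of a minimal polynomial of a nonzero element is nonzero, since
  otherwise a factor x could be removed. Scaling it to 1 gives \<open>q\<close>, and the vanishing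
  of \<open>q\<close> at \<open>a\<close> reads \<open>a * poly r a = 1\<close>: the inverse of
  \<open>a\<close> is a polynomial in \<open>a\<close>.\<close>

lemma algebraic_reciprocal:
  fixes K :: "'a::field set"
  assumes K: "is_subfield K" and p: "p \<in> polys_over K" "p \<noteq> 0" "poly p a = 0" and a: "a \<noteq> 0"
  shows "\<exists>r\<in>polys_over K. \<exists>q\<in>polys_over K. q = 1 - [:0, 1:] * r \<and> poly q a = 0"
proof -
  note Kr = is_subfield_subring[OF K]
  note P = is_subringD[OF is_subring_polys_over[OF Kr]]
  obtain m where m: "is_minimal_poly K a m" using minimal_poly_exists[OF K p] by auto
  obtain c m1 where mm: "m = pCons c m1" by (cases m)
  have m1: "m1 \<in> polys_over K" and c: "c \<in> K"
    using m mm polys_over_coeff[of m K "Suc i" for i] polys_over_coeff[of m K 0]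
    by (auto simp: is_minimal_poly_def intro!: polys_overI)
  have "m1 \<noteq> 0" using minimal_poly_degree_pos[OF m] mm by auto
  have "c \<noteq> 0"
  proof
    assume "c = 0"
    then have "poly m1 a = 0" using m mm a by (auto simp: is_minimal_poly_def)
    then have "degree m \<le> degree m1" using m m1 \<open>m1 \<noteq> 0\<close> by (auto simp: is_minimal_poly_def)
    then show False using mm \<open>m1 \<noteq> 0\<close> by simp
  qed
  have "[:inverse c:] * m = 1 - [:0,1:] * ([:- inverse c:] * m1)"
    using mm \<open>c \<noteq> 0\<close> by (simp add: one_pCons)
  moreover have "[:- inverse c:] * m1 \<in> polys_over K"
    by (intro P(4) polys_over_const[OF Kr] is_subringD[OF Kr] is_subfield_inverse[OF K] c m1)
  moreover have "[:inverse c:] * m \<in> polys_over K"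
    by (intro P(4) polys_over_const[OF Kr] is_subfield_inverse[OF K] c) (use m in \<open>simp add: is_minimal_poly_def\<close>)
  moreover have "poly ([:inverse c:] * m) a = 0" using m by (auto simp: is_minimal_poly_def)
  ultimately show ?thesis by blast
qed

text \<open>Inverses of algebraic elements are polynomials in them over \<open>K\<close>. Hence
  intermediate fields can be produced as mere subrings above \<open>K\<close>.\<close>

lemma subring_over_is_subfield:
  fixes K :: "'a::alg_closed_field set"
  assumes K: "is_algebraic_closure_of TYPE('a) K" and S: "is_subring S" "K \<subseteq> S"
  shows "is_subfield S"
proof -
  have Kf: "is_subfield K" using K by (simp add: is_algebraic_closure_of_def)
  have "inverse a \<in> S" if a: "a \<in> S" for a
  proof (cases "a = 0")
    case False
    obtain p where p: "p \<in> polys_over K" "p \<noteq> 0" "poly p a = 0" 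
      using K by (auto simp: is_algebraic_closure_of_def)
    obtain r where r: "r \<in> polys_over K" "poly (1 - [:0, 1:] * r) a = 0"
      using algebraic_reciprocal[OF Kf p False] by auto
    then have "inverse a = poly r a" using False by (simp add: field_simps)
    then show ?thesis using poly_in_subring[OF S(1) _ a] r(1) polys_over_mono[OF S(2)] by auto
  qed (use S is_subringD in auto)
  then show ?thesis using S(1) by (auto simp: is_subring_def is_subfield_def)
qed

lemma algebraic_closure_mono:
  fixes K :: "'a::alg_closed_field set"
  assumes K: "is_algebraic_closure_of TYPE('a) K" and S: "is_subring S" "K \<subseteq> S"
  shows "is_algebraic_closure_of TYPE('a) S"
proof -
  have "\<exists>p\<in>polys_over S. p \<noteq> 0 \<and> poly p a = 0" for a
    using K polys_over_mono[OF S(2)] unfolding is_algebraic_closure_of_def by blast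
  then show ?thesis using subring_over_is_subfield[OF assms] by (auto simp: is_algebraic_closure_of_def)
qed

text \<open>For \<open>a\<close> algebraic over a field \<open>M\<close> this ring is already the
  field M(a).\<close>

definition adjoin :: "'a::field set \<Rightarrow> 'a \<Rightarrow> 'a set" where
  "adjoin M a = (\<lambda>f. poly f a) ` polys_over M"

lemma adjoin_subring:
  assumes "is_subring M"
  shows "is_subring (adjoin M a)" "M \<subseteq> adjoin M a" "a \<in> adjoin M a"
proof -
  note P = is_subringD[OF is_subring_polys_over[OF assms]]
  show "is_subring (adjoin M a)"
    unfolding is_subring_def adjoin_def
  proof (intro conjI ballI)
    show "0 \<in> (\<lambda>f. poly f a) ` polys_over M" using P(1) by force
    show "1 \<in> (\<lambda>f. poly f a) ` polys_over M" using P(2) by force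
  next
    fix x y assume "x \<in> (\<lambda>f. poly f a) ` polys_over M" "y \<in> (\<lambda>f. poly f a) ` polys_over M"
    then obtain f h where "f \<in> polys_over M" "h \<in> polys_over M" "x = poly f a" "y = poly h a" by auto
    then show "x + y \<in> (\<lambda>f. poly f a) ` polys_over M" "x * y \<in> (\<lambda>f. poly f a) ` polys_over M"
      using P(3)[of f h] P(4)[of f h] by (auto intro: rev_image_eqI)
  next
    fix x assume "x \<in> (\<lambda>f. poly f a) ` polys_over M"
    then obtain f where "f \<in> polys_over M" "x = poly f a" by auto
    then show "- x \<in> (\<lambda>f. poly f a) ` polys_over M"
      using P(5)[of f] by (auto intro: rev_image_eqI)
  qed
  show "M \<subseteq> adjoin M a"
    using polys_over_const[OF assms] by (force simp: adjoin_def)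
  show "a \<in> adjoin M a"
    using polys_over_X[OF assms] by (force simp: adjoin_def)
qed

section \<open>Extension of partial embeddings to automorphisms\<close>

text \<open>Partial embeddings are represented by their graphs, so that unions of chains need no gluing.\<close>

definition ring_graph :: "'a::field set \<Rightarrow> ('a \<times> 'a) set \<Rightarrow> bool" where
  "ring_graph K g \<longleftrightarrow> (\<forall>k\<in>K. (k, k) \<in> g) \<and> single_valued g \<and>
     (\<forall>x x' y y'. (x, x') \<in> g \<longrightarrow> (y, y') \<in> g \<longrightarrow> (x + y, x' + y') \<in> g \<and> (x * y, x' * y') \<in> g) \<and>
     (\<forall>x x'. (x, x') \<in> g \<longrightarrow> (- x, - x') \<in> g)"

text \<open>For a partial embedding \<open>g\<close> this makes \<open>f'\<close> the image of
  \<open>f\<close> under \<open>g\<close> applied to the coefficients.\<close>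

definition poly_rel :: "('a \<times> 'a) set \<Rightarrow> 'a::field poly \<Rightarrow> 'a poly \<Rightarrow> bool" where
  "poly_rel g f f' \<longleftrightarrow> (\<forall>i. (coeff f i, coeff f' i) \<in> g)"

lemma ring_graphD:
  assumes "ring_graph K g"
  shows "\<And>k. k \<in> K \<Longrightarrow> (k, k) \<in> g"
    "\<And>x y z. (x, y) \<in> g \<Longrightarrow> (x, z) \<in> g \<Longrightarrow> y = z"
    "\<And>x x' y y'. (x, x') \<in> g \<Longrightarrow> (y, y') \<in> g \<Longrightarrow> (x + y, x' + y') \<in> g"
    "\<And>x x' y y'. (x, x') \<in> g \<Longrightarrow> (y, y') \<in> g \<Longrightarrow> (x * y, x' * y') \<in> g"
    "\<And>x x'. (x, x') \<in> g \<Longrightarrow> (- x, - x') \<in> g"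
    "\<And>x x' y y'. (x, x') \<in> g \<Longrightarrow> (y, y') \<in> g \<Longrightarrow> (x - y, x' - y') \<in> g"
  using assms unfolding ring_graph_def
  by (blast, metis single_valuedD, blast, blast, blast, metis diff_conv_add_uminus)

lemma ring_graph_sum:
  assumes "ring_graph K g" "0 \<in> K" "\<And>i. i \<in> I \<Longrightarrow> (f i, f' i) \<in> g"
  shows "(sum f I, sum f' I) \<in> g"
  using assms(3) by (induction I rule: infinite_finite_induct) (auto intro: ring_graphD[OF assms(1)] assms(2))

lemma ring_graph_power:
  assumes "ring_graph K g" "1 \<in> K" "(x, x') \<in> g"
  shows "(x ^ n, x' ^ n) \<in> g"
  by (induction n) (auto intro: ring_graphD[OF assms(1)] assms)

lemma ring_graph_Domain:
  assumes "is_subfield K" "ring_graph K g"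
  shows "is_subring (Domain g)" "K \<subseteq> Domain g"
proof -
  note D = ring_graphD[OF assms(2)]
  show "K \<subseteq> Domain g" using D(1) by blast
  then show "is_subring (Domain g)"
    using assms(1) D(3-5) unfolding is_subring_def is_subfield_def by blast
qed

context
  fixes K :: "'a::alg_closed_field set" and g :: "('a \<times> 'a) set"
  assumes K: "is_subfield K" and g: "ring_graph K g"
begin

lemma poly_rel_const: "(c, c') \<in> g \<Longrightarrow> poly_rel g [:c:] [:c':]"
  using ring_graphD(1)[OF g, of 0] K
  by (auto simp: poly_rel_def coeff_pCons is_subfield_def split: nat.splits)

lemma poly_rel_add: "poly_rel g f f' \<Longrightarrow> poly_rel g h h' \<Longrightarrow> poly_rel g (f + h) (f' + h')"
  by (auto simp: poly_rel_def intro: ring_graphD[OF g])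

lemma poly_rel_diff: "poly_rel g f f' \<Longrightarrow> poly_rel g h h' \<Longrightarrow> poly_rel g (f - h) (f' - h')"
  by (auto simp: poly_rel_def intro: ring_graphD[OF g])

lemma poly_rel_minus: "poly_rel g f f' \<Longrightarrow> poly_rel g (- f) (- f')"
  by (auto simp: poly_rel_def intro: ring_graphD[OF g])

lemma poly_rel_mult: "poly_rel g f f' \<Longrightarrow> poly_rel g h h' \<Longrightarrow> poly_rel g (f * h) (f' * h')"
  using K by (auto simp: poly_rel_def coeff_mult is_subfield_def
      intro!: ring_graph_sum[OF g] ring_graphD(4)[OF g])

lemma poly_rel_unique: "poly_rel g f f' \<Longrightarrow> poly_rel g f f'' \<Longrightarrow> f' = f''"
  by (intro poly_eqI) (auto simp: poly_rel_def intro: ring_graphD[OF g])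

lemma poly_rel_same: "f \<in> polys_over K \<Longrightarrow> poly_rel g f f"
  by (auto simp: poly_rel_def polys_over_def intro: ring_graphD[OF g])

lemma poly_rel_Domain: "poly_rel g f f' \<Longrightarrow> f \<in> polys_over (Domain g)"
  by (auto simp: poly_rel_def polys_over_def)

lemma poly_rel_exists:
  assumes "f \<in> polys_over (Domain g)"
  shows "\<exists>f'. poly_rel g f f'"
proof -
  define \<tau> where "\<tau> x = (THE y. (x, y) \<in> g)" for x
  have \<tau>: "(x, \<tau> x) \<in> g" if "x \<in> Domain g" for x
    unfolding \<tau>_def by (rule theI') (use that ring_graphD(2)[OF g] in auto)
  have "(0, 0) \<in> g" using K ring_graphD[OF g] by (simp add: is_subfield_def)
  then have "\<tau> 0 = 0" using \<tau> ring_graphD(2)[OF g] by blast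
  then have "poly_rel g f (map_poly \<tau> f)"
    using assms \<tau> by (auto simp: poly_rel_def coeff_map_poly polys_over_def)
  then show ?thesis ..
qed

lemma poly_rel_eval:
  assumes "poly_rel g f f'" "ring_graph K h" "g \<subseteq> h" "(a, b) \<in> h"
  shows "(poly f a, poly f' b) \<in> h"
proof -
  \<comment> \<open>Injectivity of \<open>g\<close> is not part of \<open>ring_graph\<close>, so the
    two degrees may differ and both polynomials are summed up to a common bound.\<close>
  define n where "n = max (degree f) (degree f')"
  have e: "poly p x = (\<Sum>i\<le>n. coeff p i * x ^ i)" if "degree p \<le> n" for p :: "'a poly" and x
    unfolding poly_altdef
    by (rule sum.mono_neutral_left) (use that in \<open>auto intro: le_degree\<close>)
  have "0 \<in> K" "1 \<in> K" using K by (auto simp: is_subfield_def)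
  then show ?thesis
    using assms(1,3) unfolding e[of f, unfolded n_def, OF max.cobounded1] e[of f', unfolded n_def, OF max.cobounded2]
    by (intro ring_graph_sum[OF assms(2)] ring_graphD(4)[OF assms(2)] ring_graph_power[OF assms(2)] assms(4))
      (auto simp: poly_rel_def)
qed

text \<open>The candidate for the extension of \<open>g\<close> that sends \<open>a\<close> to
  \<open>b\<close>. It is a function only if every relation of \<open>a\<close> over the domain
  passes to \<open>b\<close>, which is the hypothesis of the lemma
  \<open>adjoin_graph\<close>.\<close>

definition adjoin_graph :: "'a \<Rightarrow> 'a \<Rightarrow> ('a \<times> 'a) set" where
  "adjoin_graph a b = {(poly f a, poly f' b) | f f'. poly_rel g f f'}"

lemma adjoin_graph:
  assumes "\<And>f f'. poly_rel g f f' \<Longrightarrow> poly f a = 0 \<Longrightarrow> poly f' b = 0"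
  shows "ring_graph K (adjoin_graph a b)" "g \<subseteq> adjoin_graph a b" "(a, b) \<in> adjoin_graph a b"
proof -
  show gg: "g \<subseteq> adjoin_graph a b"
    unfolding adjoin_graph_def using poly_rel_const by force
  have X: "poly_rel g [:0, 1:] [:0, 1:]" 
    using K is_subfield_subring polys_over_X by (intro poly_rel_same) auto
  then show "(a, b) \<in> adjoin_graph a b" 
    unfolding adjoin_graph_def by force
  have I: "(poly f a, poly f' b) \<in> adjoin_graph a b" if "poly_rel g f f'" for f f'
    using that by (auto simp: adjoin_graph_def)
  have s: "poly f' b = poly h' b" if "poly_rel g f f'" "poly_rel g h h'" "poly f a = poly h a" for f f' h h'
    using assms[OF poly_rel_diff[OF that(1,2)]] that(3) by simp
  show "ring_graph K (adjoin_graph a b)"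
    unfolding ring_graph_def
  proof (intro conjI ballI allI impI)
    fix k assume "k \<in> K" then show "(k, k) \<in> adjoin_graph a b" using gg ring_graphD(1)[OF g] by blast
  next
    show "single_valued (adjoin_graph a b)"
      unfolding single_valued_def
    proof (intro allI impI)
      fix x y z assume "(x, y) \<in> adjoin_graph a b" "(x, z) \<in> adjoin_graph a b"
      then obtain f f' h h' where "poly_rel g f f'" "poly_rel g h h'" "poly f a = poly h a"
         "y = poly f' b" "z = poly h' b"
        unfolding adjoin_graph_def by auto
      then show "y = z" using s by blast
    qed
  next
    fix x x' y y' assume "(x, x') \<in> adjoin_graph a b" "(y, y') \<in> adjoin_graph a b"
    then obtain f f' h h' where "poly_rel g f f'" "poly_rel g h h'" 
       "x = poly f a" "x' = poly f' b" "y = poly h a" "y' = poly h' b"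
      unfolding adjoin_graph_def by blast
    then show "(x + y, x' + y') \<in> adjoin_graph a b" "(x * y, x' * y') \<in> adjoin_graph a b"
      using I[OF poly_rel_add, of f f' h h'] I[OF poly_rel_mult, of f f' h h'] by auto
  next
    fix x x' assume "(x, x') \<in> adjoin_graph a b"
    then obtain f f' where "poly_rel g f f'" "x = poly f a" "x' = poly f' b"
      unfolding adjoin_graph_def by blast
    then show "(- x, - x') \<in> adjoin_graph a b"
      using I[OF poly_rel_minus, of f f'] by auto
  qed
qed

end

text \<open>Every relation satisfied by \<open>a\<close> over the domain is a multiple of
  \<open>m\<close>; its image is a multiple of \<open>m'\<close> and therefore vanishes at
  \<open>b\<close>.\<close>

lemma adjoin_graph_root:
  fixes K :: "'a::alg_closed_field set"
  assumes K: "is_algebraic_closure_of TYPE('a) K" and g: "ring_graph K g"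
    and m: "is_minimal_poly (Domain g) a m" "poly_rel g m m'" "poly m' b = 0"
  shows "\<exists>h. ring_graph K h \<and> g \<subseteq> h \<and> (a, b) \<in> h"
proof -
  have Kf: "is_subfield K" using K by (simp add: is_algebraic_closure_of_def)
  have M: "is_subfield (Domain g)"
    using subring_over_is_subfield[OF K ring_graph_Domain[OF Kf g]] .
  have "poly f' b = 0" if f: "poly_rel g f f'" "poly f a = 0" for f f'
  proof -
    obtain s where s: "s \<in> polys_over (Domain g)" "f = s * m"
      using minimal_poly_dvd[OF M m(1) poly_rel_Domain[OF Kf g f(1)] f(2)] by auto
    obtain s' where "poly_rel g s s'" using poly_rel_exists[OF Kf g s(1)] by auto
    then have "f' = s' * m'" 
      using poly_rel_mult[OF Kf g _ m(2)] poly_rel_unique[OF Kf g] f(1) s(2) by auto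
    then show ?thesis using m(3) by simp
  qed
  then have "ring_graph K (adjoin_graph g a b)" "g \<subseteq> adjoin_graph g a b" "(a, b) \<in> adjoin_graph g a b"
    using adjoin_graph[OF Kf g, of a b] by blast+
  then show ?thesis by blast
qed

text \<open>The coefficient 1 at \<open>degree m\<close> survives in the image \<open>m'\<close>, so
  \<open>m'\<close> is nonconstant and has a root, which serves as \<open>b\<close>.\<close>

lemma adjoin_graph_exists:
  fixes K :: "'a::alg_closed_field set"
  assumes K: "is_algebraic_closure_of TYPE('a) K" and g: "ring_graph K g"
  shows "\<exists>h b. ring_graph K h \<and> g \<subseteq> h \<and> (a, b) \<in> h"
proof -
  have Kf: "is_subfield K" using K by (simp add: is_algebraic_closure_of_def)
  note D = ring_graph_Domain[OF Kf g]
  have M: "is_subfield (Domain g)"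
    using subring_over_is_subfield[OF K D] .
  obtain m where m: "is_minimal_poly (Domain g) a m"
    using minimal_poly_exists[OF M] algebraic_closure_mono[OF K D] 
    unfolding is_algebraic_closure_of_def by metis
  obtain m' where m': "poly_rel g m m'" 
    using poly_rel_exists[OF Kf g, of m] m by (auto simp: is_minimal_poly_def)
  have "(1, coeff m' (degree m)) \<in> g" 
    using m' m unfolding poly_rel_def is_minimal_poly_def by metis
  moreover have "(1, 1) \<in> g" using ring_graphD(1)[OF g, of 1] Kf by (simp add: is_subfield_def)
  ultimately have "coeff m' (degree m) = 1" using ring_graphD(2)[OF g] by blast
  then have "degree m' > 0" 
    using minimal_poly_degree_pos[OF m] by (metis le_degree less_le_trans zero_neq_one)
  then obtain b where "poly m' b = 0" using alg_closed_imp_poly_has_root by blast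
  then show ?thesis using adjoin_graph_root[OF K g m m'] by blast
qed

section \<open>Automorphisms of the algebraic closure over a subfield\<close>

definition auts :: "'a::field set \<Rightarrow> ('a \<Rightarrow> 'a) set" where
  "auts K = {\<sigma>. bij \<sigma> \<and> (\<forall>x y. \<sigma> (x + y) = \<sigma> x + \<sigma> y \<and> \<sigma> (x * y) = \<sigma> x * \<sigma> y) \<and> (\<forall>k\<in>K. \<sigma> k = k)}"

lemma auts_simps:
  assumes "\<sigma> \<in> auts K"
  shows "\<sigma> (x + y) = \<sigma> x + \<sigma> y" "\<sigma> (x * y) = \<sigma> x * \<sigma> y" "k \<in> K \<Longrightarrow> \<sigma> k = k" 
    "\<sigma> 0 = 0" "\<sigma> 1 = 1" "\<sigma> (- x) = - \<sigma> x" "\<sigma> (x - y) = \<sigma> x - \<sigma> y" "\<sigma> (x ^ n) = \<sigma> x ^ n"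
    "\<sigma> x = \<sigma> y \<longleftrightarrow> x = y" "bij \<sigma>" "\<sigma> (inverse x) = inverse (\<sigma> x)"
proof -
  show add: "\<sigma> (x + y) = \<sigma> x + \<sigma> y" for x y using assms by (auto simp: auts_def)
  show mult: "\<sigma> (x * y) = \<sigma> x * \<sigma> y" for x y using assms by (auto simp: auts_def)
  show "k \<in> K \<Longrightarrow> \<sigma> k = k" using assms by (auto simp: auts_def)
  show bij: "bij \<sigma>" using assms by (auto simp: auts_def)
  show 0: "\<sigma> 0 = 0" using add[of 0 0] by (metis add_cancel_right_right)
  show i: "\<sigma> x = \<sigma> y \<longleftrightarrow> x = y" for x y using bij by (auto simp: bij_def inj_def)
  show 1: "\<sigma> 1 = 1" using mult[of 1 1] i[of 1 0] 0 by simp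
  show m: "\<sigma> (- x) = - \<sigma> x" for x using add[of x "- x"] 0 by (simp add: minus_unique)
  show "\<sigma> (x - y) = \<sigma> x - \<sigma> y" using add[of x "- y"] m by simp
  show "\<sigma> (x ^ n) = \<sigma> x ^ n" by (induction n) (auto simp: 1 mult)
  show "\<sigma> (inverse x) = inverse (\<sigma> x)"
  proof (cases "x = 0")
    case False
    then have "\<sigma> x * \<sigma> (inverse x) = 1" using mult[of x "inverse x"] 1 by simp
    then show ?thesis by (metis inverse_unique)
  qed (simp add: 0)
qed

lemma auts_mono: "K \<subseteq> M \<Longrightarrow> auts M \<subseteq> auts K"
  by (auto simp: auts_def)

lemma auts_comp: "\<sigma> \<in> auts K \<Longrightarrow> \<tau> \<in> auts K \<Longrightarrow> \<sigma> \<circ> \<tau> \<in> auts K"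
  by (auto simp: auts_def bij_comp)

lemma auts_id: "id \<in> auts K"
  by (auto simp: auts_def)

lemma auts_inv: 
  assumes "\<sigma> \<in> auts K"
  shows "inv_into UNIV \<sigma> \<in> auts K"
proof -
  note s = auts_simps[OF assms]
  have i: "inv_into UNIV \<sigma> y = x \<longleftrightarrow> y = \<sigma> x" for x y
    using s(10) by (metis bij_inv_eq_iff)
  have ii: "\<sigma> (inv_into UNIV \<sigma> y) = y" for y using i by metis
  have "inv_into UNIV \<sigma> (x + y) = inv_into UNIV \<sigma> x + inv_into UNIV \<sigma> y" "inv_into UNIV \<sigma> (x * y) = inv_into UNIV \<sigma> x * inv_into UNIV \<sigma> y" for x y
    by (simp_all add: i s ii)
  moreover have "\<forall>k\<in>K. inv_into UNIV \<sigma> k = k" by (simp add: i s)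
  ultimately show ?thesis using s(10) bij_imp_bij_inv by (auto simp: auts_def)
qed

text \<open>\<open>C\<close> constrains finitely many elements at a time, hence survives unions of chains.\<close>

lemma ring_graph_extend_aut:
  fixes K :: "'a::alg_closed_field set" and C :: "'a poly \<Rightarrow> 'a poly \<Rightarrow> 'a poly \<Rightarrow> 'a poly \<Rightarrow> bool"
  defines "Cmp \<equiv> \<lambda>g. \<forall>f f' h h'. poly_rel g f f' \<longrightarrow> poly_rel g h h' \<longrightarrow> C f f' h h'"
  assumes K: "is_algebraic_closure_of TYPE('a) K" and g0: "ring_graph K g0" "Cmp g0"
    and step: "\<And>g a. ring_graph K g \<Longrightarrow> Cmp g \<Longrightarrow> 
       \<exists>h. ring_graph K h \<and> Cmp h \<and> g \<subseteq> h \<and> a \<in> Domain h"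
  shows "\<exists>\<sigma>\<in>auts K. (\<forall>x y. (x, y) \<in> g0 \<longrightarrow> \<sigma> x = y) \<and> (\<forall>f h. C f (map_poly \<sigma> f) h (map_poly \<sigma> h))"
proof -
  have Kf: "is_subfield K" using K by (simp add: is_algebraic_closure_of_def)
  define G where "G = {g. ring_graph K g \<and> Cmp g \<and> g0 \<subseteq> g}"
  have "\<Union>c \<in> G" if c: "c \<noteq> {}" "subset.chain G c" for c
  proof -
    have cG: "\<And>g. g \<in> c \<Longrightarrow> g \<in> G" and ch: "\<And>g h. g \<in> c \<Longrightarrow> h \<in> c \<Longrightarrow> g \<subseteq> h \<or> h \<subseteq> g"
      using c(2) by (auto simp: subset_chain_def)
    have two: "\<exists>g\<in>c. p \<in> g \<and> q \<in> g" if "p \<in> \<Union>c" "q \<in> \<Union>c" for p q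
      using that ch by blast
    have fin: "\<exists>g\<in>c. F \<subseteq> g" if "finite F" "F \<subseteq> \<Union>c" for F
      using that
    proof (induction F)
      case empty then show ?case using c(1) by auto
    next
      case (insert x F)
      then obtain g h where "g \<in> c" "F \<subseteq> g" "h \<in> c" "x \<in> h" by auto
      then show ?case using ch[of g h] by blast
    qed
    have rg: "ring_graph K (\<Union>c)"
      unfolding ring_graph_def
    proof (intro conjI ballI allI impI)
      fix k assume "k \<in> K"
      obtain g where "g \<in> c" using c(1) by auto
      with \<open>k \<in> K\<close> show "(k, k) \<in> \<Union>c" using cG[of g] ring_graphD(1)[of K g k] by (auto simp: G_def)
    next
      show "single_valued (\<Union>c)"
        unfolding single_valued_def
      proof (intro allI impI)
        fix x y z assume "(x, y) \<in> \<Union>c" "(x, z) \<in> \<Union>c"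
        from two[OF this] obtain g where "g \<in> c" "(x, y) \<in> g" "(x, z) \<in> g" by auto
        then show "y = z" using cG[of g] ring_graphD(2)[of K g] by (auto simp: G_def)
      qed
    next
      fix x x' y y' assume "(x, x') \<in> \<Union>c" "(y, y') \<in> \<Union>c"
      from two[OF this] obtain g where "g \<in> c" "(x, x') \<in> g" "(y, y') \<in> g" by auto
      then show "(x + y, x' + y') \<in> \<Union>c" "(x * y, x' * y') \<in> \<Union>c"
        using cG[of g] ring_graphD(3,4)[of K g x x' y y'] by (auto simp: G_def)
    next
      fix x x' assume "(x, x') \<in> \<Union>c"
      then obtain g where "g \<in> c" "(x, x') \<in> g" by auto
      then show "(- x, - x') \<in> \<Union>c" using cG[of g] ring_graphD(5)[of K g x x'] by (auto simp: G_def)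
    qed
    moreover have "Cmp (\<Union>c)"
      unfolding Cmp_def
    proof (intro allI impI)
      fix f f' h h' assume r: "poly_rel (\<Union>c) f f'" "poly_rel (\<Union>c) h h'"
      have 00: "(0, 0) \<in> \<Union>c" using ring_graphD(1)[OF rg, of 0] Kf by (auto simp: is_subfield_def)
      define n where "n = max (max (degree f) (degree f')) (max (degree h) (degree h'))"
      \<comment> \<open>The pair of zeros is put in so that the coefficients beyond \<open>n\<close>
        are related in the chosen member of the chain as well.\<close>
      define F where "F = insert (0, 0) ((\<lambda>i. (coeff f i, coeff f' i)) ` {..n} \<union> (\<lambda>i. (coeff h i, coeff h' i)) ` {..n})"
      have "finite F" "F \<subseteq> \<Union>c" using r 00 by (auto simp: F_def poly_rel_def)
      from fin[OF this] obtain g where g: "g \<in> c" "F \<subseteq> g" by auto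
      have "(coeff f i, coeff f' i) \<in> g \<and> (coeff h i, coeff h' i) \<in> g" for i
        using g(2) by (cases "i \<le> n") (auto simp: F_def n_def coeff_eq_0)
      then have "poly_rel g f f'" "poly_rel g h h'" by (auto simp: poly_rel_def)
      then show "C f f' h h'" using cG[OF g(1)] by (auto simp: G_def Cmp_def)
    qed
    moreover have "g0 \<subseteq> \<Union>c" using c(1) cG by (auto simp: G_def)
    ultimately show ?thesis by (simp add: G_def)
  qed
  moreover have "G \<noteq> {}" using g0 by (auto simp: G_def)
  ultimately obtain g where gG: "g \<in> G" and max: "\<And>h. h \<in> G \<Longrightarrow> g \<subseteq> h \<Longrightarrow> h = g"
    using subset_Zorn_nonempty[of G] by blast
  have g: "ring_graph K g" "Cmp g" "g0 \<subseteq> g" using gG by (auto simp: G_def)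
  have total: "a \<in> Domain g" for a
    using step[OF g(1,2), of a] max g(3) by (auto simp: G_def)
  define \<sigma> where "\<sigma> x = (THE y. (x, y) \<in> g)" for x
  have \<sigma>: "(x, \<sigma> x) \<in> g" for x
    unfolding \<sigma>_def by (rule theI') (use total[of x] ring_graphD(2)[OF g(1)] in auto)
  have \<sigma>_eq: "\<sigma> x = y" if "(x, y) \<in> g" for x y using ring_graphD(2)[OF g(1) \<sigma> that] .
  have add: "\<sigma> (x + y) = \<sigma> x + \<sigma> y" and mult: "\<sigma> (x * y) = \<sigma> x * \<sigma> y" 
    and diff: "\<sigma> (x - y) = \<sigma> x - \<sigma> y" for x y
    by (auto intro!: \<sigma>_eq ring_graphD[OF g(1)] \<sigma>)
  have k: "\<sigma> k = k" if "k \<in> K" for k using ring_graphD(1)[OF g(1) that] \<sigma>_eq by auto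
  have 01: "\<sigma> 0 = 0" "\<sigma> 1 = 1" using k Kf by (auto simp: is_subfield_def)
  have "inj \<sigma>"
  proof (rule injI)
    fix x y assume "\<sigma> x = \<sigma> y"
    then have "\<sigma> (x - y) = 0" by (simp add: diff)
    \<comment> \<open>A nonzero element of the kernel would send 1 to 0.\<close>
    then have "\<sigma> ((x - y) * inverse (x - y)) = 0" by (simp only: mult) simp
    then show "x = y" using 01 by (cases "x - y = 0") auto
  qed
  \<comment> \<open>Surjectivity: \<sigma> maps the finite root set of a polynomial over
    \<open>K\<close> injectively into itself, hence onto itself, and every \<open>y\<close> is a
    root of such a polynomial.\<close>
  moreover have "\<exists>x. \<sigma> x = y" for y
  proof -
    obtain p where p: "p \<in> polys_over K" "p \<noteq> 0" "poly p y = 0" 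
      using K by (auto simp: is_algebraic_closure_of_def)
    have "\<sigma> ` {x. poly p x = 0} \<subseteq> {x. poly p x = 0}"
    proof safe
      fix x assume "poly p x = 0"
      then have "(0, poly p (\<sigma> x)) \<in> g"
        using poly_rel_eval[OF Kf g(1) poly_rel_same[OF Kf g(1) p(1)] g(1) _ \<sigma>[of x]] by auto
      then show "poly p (\<sigma> x) = 0" using \<sigma>_eq 01 by metis
    qed
    moreover have "finite {x. poly p x = 0}" using p(2) poly_roots_finite by blast
    ultimately have "\<sigma> ` {x. poly p x = 0} = {x. poly p x = 0}"
      using \<open>inj \<sigma>\<close> by (metis endo_inj_surj inj_on_subset top_greatest)
    moreover have "y \<in> {x. poly p x = 0}" using p(3) by simp
    ultimately have "y \<in> \<sigma> ` {x. poly p x = 0}" by simp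
    then show ?thesis by blast
  qed
  ultimately have "bij \<sigma>" unfolding bij_def surj_def by metis
  then have "\<sigma> \<in> auts K" using add mult k by (auto simp: auts_def)
  moreover have "C f (map_poly \<sigma> f) h (map_poly \<sigma> h)" for f h
  proof -
    have "poly_rel g q (map_poly \<sigma> q)" for q using \<sigma> 01 by (auto simp: poly_rel_def coeff_map_poly)
    then show ?thesis using g(2) unfolding Cmp_def by blast
  qed
  ultimately show ?thesis using \<sigma>_eq g(3) by blast
qed

lemma ring_graph_extends_to_aut:
  fixes K :: "'a::alg_closed_field set"
  assumes K: "is_algebraic_closure_of TYPE('a) K" and g: "ring_graph K g"
  shows "\<exists>\<sigma>\<in>auts K. \<forall>x y. (x, y) \<in> g \<longrightarrow> \<sigma> x = y"
proof -
  have "\<exists>h. ring_graph K h \<and> g' \<subseteq> h \<and> a \<in> Domain h" if "ring_graph K g'" for g' a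
    using adjoin_graph_exists[OF K that, of a] by blast
  then show ?thesis
    using ring_graph_extend_aut[OF K g, of "\<lambda>_ _ _ _. True"] by simp
qed

lemma aut_to_conjugate:
  fixes M :: "'a::alg_closed_field set"
  assumes M: "is_algebraic_closure_of TYPE('a) M" and m: "is_minimal_poly M a m" "poly m b = 0"
  shows "\<exists>\<sigma>\<in>auts M. \<sigma> a = b"
proof -
  have g: "ring_graph M (Id_on M)" 
    using is_subringD[OF is_subfield_subring, of M] M
    by (auto simp: ring_graph_def single_valued_def is_algebraic_closure_of_def)
  have "poly_rel (Id_on M) m m" using m by (auto simp: poly_rel_def is_minimal_poly_def polys_over_def)
  then obtain h where "ring_graph M h" "(a, b) \<in> h"
    using adjoin_graph_root[OF M g _ _ m(2), of a] m(1) by auto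
  then show ?thesis using ring_graph_extends_to_aut[OF M] by blast
qed

lemma poly_map_poly_aut: 
  assumes "\<sigma> \<in> auts K"
  shows "poly (map_poly \<sigma> f) (\<sigma> x) = \<sigma> (poly f x)"
proof (induction f)
  case (pCons a p)
  then show ?case using auts_simps[OF assms] by (subst map_poly_pCons) auto
qed (simp add: auts_simps[OF assms])

lemma map_poly_aut_fixed:
  "\<sigma> \<in> auts K \<Longrightarrow> f \<in> polys_over K \<Longrightarrow> map_poly \<sigma> f = f"
  by (intro poly_eqI) (auto simp: coeff_map_poly auts_simps polys_over_def)

lemma map_poly_aut:
  assumes "\<sigma> \<in> auts K"
  shows "map_poly \<sigma> (f + h) = map_poly \<sigma> f + map_poly \<sigma> h" 
    "map_poly \<sigma> (f * h) = map_poly \<sigma> f * map_poly \<sigma> h"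
    "map_poly \<sigma> (f - h) = map_poly \<sigma> f - map_poly \<sigma> h"
    "map_poly \<sigma> (- f) = - map_poly \<sigma> f"
    "map_poly \<sigma> f = map_poly \<sigma> h \<longleftrightarrow> f = h"
    "map_poly \<sigma> 0 = 0" "map_poly \<sigma> 1 = 1" "map_poly \<sigma> [:c:] = [:\<sigma> c:]"
    "map_poly \<sigma> f = 0 \<longleftrightarrow> f = 0"
proof -
  note s = auts_simps[OF assms]
  have sum: "\<sigma> (sum u I) = (\<Sum>i\<in>I. \<sigma> (u i))" for u and I :: "nat set"
    by (induction I rule: infinite_finite_induct) (auto simp: s)
  show "map_poly \<sigma> (f + h) = map_poly \<sigma> f + map_poly \<sigma> h" 
    "map_poly \<sigma> (f * h) = map_poly \<sigma> f * map_poly \<sigma> h"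
    "map_poly \<sigma> (f - h) = map_poly \<sigma> f - map_poly \<sigma> h"
    "map_poly \<sigma> (- f) = - map_poly \<sigma> f"
    by (auto intro!: poly_eqI simp: coeff_map_poly s coeff_mult sum)
  show inj: "map_poly \<sigma> f = map_poly \<sigma> h \<longleftrightarrow> f = h" for f h
    by (auto simp: poly_eq_iff coeff_map_poly s)
  show "map_poly \<sigma> 0 = 0" "map_poly \<sigma> 1 = 1" "map_poly \<sigma> [:c:] = [:\<sigma> c:]"
    by (auto simp: s map_poly_pCons)
  show "map_poly \<sigma> f = 0 \<longleftrightarrow> f = 0" using inj[of f 0] by simp
qed

lemma map_poly_aut_comp:
  "\<sigma> \<in> auts K \<Longrightarrow> map_poly (\<sigma> \<circ> \<tau>) f = map_poly \<sigma> (map_poly \<tau> f)" if "\<tau> \<in> auts K"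
  by (intro poly_eqI) (simp add: coeff_map_poly auts_simps(4)[OF that] auts_simps(4)[of \<sigma>])

lemma finite_orbit:
  fixes M :: "'a::alg_closed_field set"
  assumes "is_algebraic_closure_of TYPE('a) M"
  shows "finite ((\<lambda>\<sigma>. \<sigma> a) ` auts M)"
proof -
  obtain p where p: "p \<in> polys_over M" "p \<noteq> 0" "poly p a = 0" 
    using assms by (auto simp: is_algebraic_closure_of_def)
  have "(\<lambda>\<sigma>. \<sigma> a) ` auts M \<subseteq> {x. poly p x = 0}"
    using poly_map_poly_aut[of _ M p a] map_poly_aut_fixed[OF _ p(1)] p(3) auts_simps(4) by fastforce
  then show ?thesis using p(2) poly_roots_finite finite_subset by blast
qed


section \<open>Inseparability, norms and the separable closure\<close>

lemma subring_of_nat: "is_subring S \<Longrightarrow> of_nat n \<in> S"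
  by (induction n) (auto intro: is_subringD)

lemma pcompose_power: "pcompose (f ^ n) h = pcompose f h ^ n" for f h :: "'a::comm_ring_1 poly"
  by (induction n) (auto simp: pcompose_mult pcompose_1)

lemma coeff_pcompose_monom:
  fixes f :: "'a::comm_ring_1 poly"
  assumes "p > 0"
  shows "coeff (pcompose f (monom 1 p)) j = (if p dvd j then coeff f (j div p) else 0)"
proof (induction f arbitrary: j)
  case (pCons a f)
  show ?case
  proof (cases "p \<le> j")
    case True
    then obtain k where j: "j = p + k" by (auto simp: le_iff_add)
    have "coeff (pcompose (pCons a f) (monom 1 p)) j = coeff (monom 1 p * pcompose f (monom 1 p)) (p + k)"
      using j assms by (simp add: pcompose_pCons coeff_pCons split: nat.splits)
    also have "\<dots> = coeff (pcompose f (monom 1 p)) k"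
      by (simp add: coeff_monom_mult)
    finally show ?thesis using j assms pCons.IH by (simp add: div_add_self1)
  next
    case False
    then have "p dvd j \<longleftrightarrow> j = 0" using assms by (auto dest: dvd_imp_le)
    then show ?thesis using False
      by (auto simp: pcompose_pCons coeff_monom_mult coeff_pCons split: nat.splits)
  qed
qed simp

text \<open>In characteristic p the map f to f^q is additive, so it acts on each monomial
  separately. The coefficient ring is kept general because the norm has polynomials as
  coefficients.\<close>

lemma coeff_frobenius:
  fixes f :: "'r::comm_ring_1 poly"
  assumes p: "prime CHAR('r)" and q: "q = CHAR('r) ^ k"
  shows "coeff (f ^ q) j = (if q dvd j then coeff f (j div q) ^ q else 0)"
proof (induction f arbitrary: j)
  case 0
  have "q > 0" using p q by (simp add: prime_gt_0_nat)
  then show ?case by (simp add: power_0_left)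
next
  case (pCons a f)
  have q0: "q > 0" using p q by (simp add: prime_gt_0_nat)
  have "pCons a f = [:a:] + monom 1 1 * f"
    by (simp add: monom_Suc monom_0)
  then have eq: "pCons a f ^ q = [:a ^ q:] + monom 1 q * f ^ q"
    using freshmans_dream'[of q k "[:a:]" "monom 1 1 * f"] p q
    by (simp add: poly_const_pow power_mult_distrib monom_power)
  show ?case
  proof (cases "q \<le> j")
    case True
    then obtain k where j: "j = q + k" by (auto simp: le_iff_add)
    have "coeff (pCons a f ^ q) j = coeff (f ^ q) k"
      unfolding eq using j q0 by (simp add: coeff_monom_mult coeff_pCons split: nat.splits)
    then show ?thesis using j q0 pCons.IH by (simp add: div_add_self1)
  next
    case False
    then have "q dvd j \<longleftrightarrow> j = 0" using q0 by (auto dest: dvd_imp_le)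
    then show ?thesis unfolding eq using False q0
      by (auto simp: coeff_monom_mult coeff_pCons split: nat.splits)
  qed
qed

text \<open>The characteristic exponent. With the value 1 in characteristic 0, an assertion that
  some power with exponent \<open>char_exp TYPE('a) ^ k\<close> lies in a subfield says there that
  the element itself does.\<close>

definition char_exp :: "'a::field itself \<Rightarrow> nat" where
  "char_exp _ = (if CHAR('a) = 0 then 1 else CHAR('a))"

lemma char_exp_pos: "char_exp TYPE('a::field) > 0"
  by (simp add: char_exp_def)

text \<open>If n is nonzero in the field, the coefficient -n c in degree n - 1 yields
  \<open>c\<close>. Otherwise n = p m, and the power is (x - c^p)^m with x^p substituted for x;
  reading off every p-th coefficient leaves the same problem for \<open>c ^ p\<close> with the
  smaller exponent m.\<close>

lemma linear_power_over_subfield: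
  fixes M :: "'a::field set"
  assumes M: "is_subfield M"
  shows "n > 0 \<Longrightarrow> [:-c, 1:] ^ n \<in> polys_over M \<Longrightarrow> \<exists>k. c ^ (char_exp TYPE('a) ^ k) \<in> M"
proof (induction n arbitrary: c rule: less_induct)
  case (less n)
  note S = is_subringD[OF is_subfield_subring[OF M]]
  show ?case
  proof (cases "of_nat n = (0::'a)")
    case False
    have "n choose (n - 1) = n" 
      using binomial_symmetric[of 1 n] less.prems(1) by simp
    then have "coeff ([:-c, 1:] ^ n) (n - 1) = of_nat n * (- c)"
      using less.prems(1) by (simp add: coeff_linear_poly_power)
    then have "c = - (coeff ([:-c, 1:] ^ n) (n - 1) / of_nat n)"
      using False by simp
    also have "\<dots> \<in> M"
      by (intro S is_subfield_divide[OF M] polys_over_coeff less.prems subring_of_nat is_subfield_subring[OF M])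
    finally show ?thesis by (intro exI[of _ 0]) simp
  next
    case True
    define p where "p = CHAR('a)"
    have "p dvd n" using True of_nat_eq_0_iff_char_dvd p_def by blast
    then obtain m where n: "n = p * m" by auto
    then have pm: "p > 0" "m > 0" using less.prems(1) by auto
    then have p: "prime p" using prime_CHAR_semidom p_def by auto
    have ce: "char_exp TYPE('a) = p" using pm by (simp add: char_exp_def p_def)
    \<comment> \<open>Deriving the sign from additivity of the Frobenius map covers p = 2 without a
      case distinction.\<close>
    have "c ^ p + (- c) ^ p = 0"
      using freshmans_dream[of p c "- c"] p pm by (simp add: p_def power_0_left)
    then have mc: "(- c) ^ p = - (c ^ p)" by (simp add: eq_neg_iff_add_eq_0 add.commute)
    have "[:-c, 1:] = [:-c:] + monom 1 1" by (simp add: monom_Suc monom_0 one_pCons)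
    moreover have "([:-c:] + monom 1 1) ^ p = [:-c:] ^ p + monom 1 1 ^ p"
      by (rule freshmans_dream) (use p in \<open>simp_all add: p_def\<close>)
    ultimately have "[:-c, 1:] ^ p = [:- (c ^ p):] + monom 1 p"
      unfolding poly_const_pow monom_power mc by simp
    also have "\<dots> = pcompose [:- (c ^ p), 1:] (monom 1 p)"
      by (simp add: pcompose_pCons)
    finally have "[:-c, 1:] ^ n = pcompose ([:- (c ^ p), 1:] ^ m) (monom 1 p)"
      by (simp add: n power_mult pcompose_power)
    then have "coeff ([:- (c ^ p), 1:] ^ m) i = coeff ([:-c, 1:] ^ n) (p * i)" for i
      using coeff_pcompose_monom[OF pm(1), of "[:- (c ^ p), 1:] ^ m" "p * i"] pm(1)
      by (simp only: dvd_triv_left if_True nonzero_mult_div_cancel_left not_gr_zero)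
    then have "[:- (c ^ p), 1:] ^ m \<in> polys_over M"
      using polys_over_coeff[OF less.prems(2)] by (intro polys_overI) simp
    moreover have "m < n" using n p pm prime_gt_1_nat by simp
    ultimately obtain k where "(c ^ p) ^ (char_exp TYPE('a) ^ k) \<in> M" using less.IH pm by blast
    then show ?thesis by (intro exI[of _ "Suc k"]) (simp add: ce power_mult)
  qed
qed

text \<open>Automorphisms over \<open>M\<close> carry \<open>c\<close> to all roots of its minimal
  polynomial, so a fixed \<open>c\<close> is the only root and that polynomial is a power of x -
  c.\<close>

lemma fixed_purely_inseparable:
  fixes M :: "'a::alg_closed_field set"
  assumes M: "is_algebraic_closure_of TYPE('a) M" and c: "\<And>\<sigma>. \<sigma> \<in> auts M \<Longrightarrow> \<sigma> c = c"
  shows "\<exists>k. c ^ (char_exp TYPE('a) ^ k) \<in> M"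
proof -
  have Mf: "is_subfield M" using M by (simp add: is_algebraic_closure_of_def)
  obtain m where m: "is_minimal_poly M c m"
    using minimal_poly_exists[OF Mf] M unfolding is_algebraic_closure_of_def by metis
  have roots: "b = c" if "poly m b = 0" for b
    using aut_to_conjugate[OF M m that] c by auto
  have "m \<noteq> 0" using m by (auto simp: is_minimal_poly_def)
  then obtain A where A: "size A = degree m" "m = smult (lead_coeff m) (\<Prod>x\<in>#A. [:-x, 1:])"
    using alg_closed_imp_factorization by blast
  have "x = c" if x: "x \<in># A" for x
  proof (rule roots)
    have "[:-x, 1:] dvd (\<Prod>x\<in>#A. [:-x, 1:])" using x by (auto intro: dvd_prod_mset)
    then have "[:-x, 1:] dvd m" by (subst A(2)) (rule dvd_smult)
    then show "poly m x = 0" by (simp add: poly_eq_0_iff_dvd)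
  qed
  then have "A = replicate_mset (degree m) c" 
    using A(1) by (metis set_mset_subset_singletonD subsetI singletonI)
  then have "m = [:-c, 1:] ^ degree m"
    using A(2) m by (simp add: is_minimal_poly_def)
  then show ?thesis 
    using linear_power_over_subfield[OF Mf minimal_poly_degree_pos[OF m], of c] m
    by (simp add: is_minimal_poly_def)
qed

section \<open>Norms of polynomials down to a subfield\<close>

lemma common_exponent:
  assumes S: "is_subring S" and "finite C" "\<And>c. c \<in> C \<Longrightarrow> \<exists>k. c ^ (p ^ k) \<in> S"
  shows "\<exists>k. \<forall>c\<in>C. c ^ ((p::nat) ^ k) \<in> S"
  using assms(2,3)
proof (induction C)
  case (insert x F)
  obtain k where k: "\<forall>c\<in>F. c ^ (p ^ k) \<in> S" using insert by auto
  obtain l where l: "x ^ (p ^ l) \<in> S" using insert.prems[of x] by auto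
  then show ?case
    using k l subring_power[OF S] 
    by (intro exI[of _ "k + l"]) (metis insertE mult.commute power_add power_mult)
qed auto

lemma map_poly_hom_prod:
  fixes \<phi> :: "'r::comm_ring_1 \<Rightarrow> 'r"
  assumes "\<And>x y. \<phi> (x + y) = \<phi> x + \<phi> y" "\<And>x y. \<phi> (x * y) = \<phi> x * \<phi> y" "\<phi> 0 = 0" "\<phi> 1 = 1"
  shows "map_poly \<phi> (prod f I) = (\<Prod>i\<in>I. map_poly \<phi> (f i))"
proof -
  have sum: "\<phi> (sum u J) = (\<Sum>i\<in>J. \<phi> (u i))" for u and J :: "nat set"
    by (induction J rule: infinite_finite_induct) (auto simp: assms)
  have mult: "map_poly \<phi> (f * h) = map_poly \<phi> f * map_poly \<phi> h" for f h
    by (auto intro!: poly_eqI simp: coeff_map_poly assms coeff_mult sum)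
  show ?thesis
    by (induction I rule: infinite_finite_induct) (auto simp: mult assms)
qed

text \<open>The image of the pair depends only on \<sigma> restricted to the finitely many
  coefficients, each of which has a finite orbit.\<close>

lemma finite_pair_orbit:
  fixes M :: "'a::alg_closed_field set"
  assumes M: "is_algebraic_closure_of TYPE('a) M"
  shows "finite ((\<lambda>\<sigma>. (map_poly \<sigma> P, map_poly \<sigma> Q)) ` auts M)"
proof -
  define C where "C = insert 0 (set (coeffs P) \<union> set (coeffs Q))"
  have cong: "(map_poly \<sigma> P, map_poly \<sigma> Q) = (map_poly (restrict \<sigma> C) P, map_poly (restrict \<sigma> C) Q)" 
    if "\<sigma> \<in> auts M" for \<sigma>
    using that by (auto simp: C_def intro!: map_poly_cong)
  have "(\<lambda>\<sigma>. restrict \<sigma> C) ` auts M \<subseteq> (\<Pi>\<^sub>E c\<in>C. (\<lambda>\<sigma>. \<sigma> c) ` auts M)" by auto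
  moreover have "finite (\<Pi>\<^sub>E c\<in>C. (\<lambda>\<sigma>. \<sigma> c) ` auts M)"
    by (intro finite_PiE finite_orbit[OF M]) (simp add: C_def)
  ultimately have "finite ((\<lambda>\<sigma>. restrict \<sigma> C) ` auts M)" by (rule finite_subset)
  then have "finite ((\<lambda>\<tau>. (map_poly \<tau> P, map_poly \<tau> Q)) ` (\<lambda>\<sigma>. restrict \<sigma> C) ` auts M)"
    by (rule finite_imageI)
  then show ?thesis by (rule back_subst[of finite]) (auto simp: image_image cong intro!: image_cong)
qed

text \<open>The product of the factors P' Y - Q' over the orbit of (P, Q), with Y a second variable,
  is invariant under \<open>auts M\<close>. Its coefficients are thus purely inseparable over
  \<open>M\<close>, and one power \<open>q\<close> of the product has all its coefficients over
  \<open>M\<close>. The quotient Q/P is a formal root.\<close>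

lemma norm_over_subfield:
  fixes M :: "'a::alg_closed_field set" and P Q :: "'a poly"
  assumes M: "is_algebraic_closure_of TYPE('a) M"
  shows "\<exists>X q. finite X \<and> q > 0 \<and> (P, Q) \<in> X \<and> X \<subseteq> (\<lambda>\<sigma>. (map_poly \<sigma> P, map_poly \<sigma> Q)) ` auts M \<and>
     (\<forall>j. coeff ((\<Prod>x\<in>X. [:- snd x, fst x:]) ^ q) j \<in> polys_over M)"
proof -
  have Mr: "is_subring M" using M is_subfield_subring by (auto simp: is_algebraic_closure_of_def)
  define O' where "O' = (\<lambda>\<sigma>. (map_poly \<sigma> P, map_poly \<sigma> Q)) ` auts M"
  have fin: "finite O'" unfolding O'_def by (rule finite_pair_orbit[OF M])
  have PQ: "(P, Q) \<in> O'" unfolding O'_def by (rule image_eqI[OF _ auts_id]) simp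
  define Z where "Z = (\<Prod>x\<in>O'. [:- snd x, fst x:])"
  have inv: "map_poly (map_poly \<sigma>) Z = Z" if s: "\<sigma> \<in> auts M" for \<sigma>
  proof -
    define t where "t x = (map_poly \<sigma> (fst x), map_poly \<sigma> (snd x))" for x :: "'a poly \<times> 'a poly"
    note h = map_poly_aut[OF s]
    have "inj_on t O'" by (auto simp: inj_on_def t_def h(5) prod_eq_iff)
    moreover have "t ` O' \<subseteq> O'" 
    proof
      fix x assume "x \<in> t ` O'"
      then obtain \<tau> where tau: "\<tau> \<in> auts M" "x = t (map_poly \<tau> P, map_poly \<tau> Q)" by (auto simp: O'_def)
      then have "x = (map_poly (\<sigma> \<circ> \<tau>) P, map_poly (\<sigma> \<circ> \<tau>) Q)" 
        by (simp add: t_def map_poly_aut_comp[OF tau(1) s])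
      then show "x \<in> O'" unfolding O'_def using auts_comp[OF s tau(1)] by blast
    qed
    ultimately have tO: "inj_on t O'" "t ` O' = O'" using endo_inj_surj[OF fin] by auto
    have "map_poly (map_poly \<sigma>) Z = (\<Prod>x\<in>O'. map_poly (map_poly \<sigma>) [:- snd x, fst x:])"
      unfolding Z_def by (rule map_poly_hom_prod) (simp_all add: h)
    also have "\<dots> = (\<Prod>x\<in>O'. [:- snd (t x), fst (t x):])"
      by (simp add: t_def h map_poly_pCons)
    also have "\<dots> = (\<Prod>x\<in>t ` O'. [:- snd x, fst x:])"
      using tO(1) by (simp add: prod.reindex)
    finally show ?thesis by (simp add: tO(2) Z_def)
  qed
  have fixed: "\<sigma> (coeff (coeff Z j) i) = coeff (coeff Z j) i" if s: "\<sigma> \<in> auts M" for \<sigma> i j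
    using arg_cong[OF inv[OF s], of "\<lambda>p. coeff (coeff p j) i"] 
    by (simp add: coeff_map_poly auts_simps(4)[OF s])
  define C where "C = (\<Union>j\<le>degree Z. (\<lambda>i. coeff (coeff Z j) i) ` {..degree (coeff Z j)})"
  have "finite C" by (simp add: C_def)
  moreover have "\<exists>k. c ^ (char_exp TYPE('a) ^ k) \<in> M" if "c \<in> C" for c
    using that fixed by (intro fixed_purely_inseparable[OF M]) (auto simp: C_def)
  ultimately obtain k where k: "\<forall>c\<in>C. c ^ (char_exp TYPE('a) ^ k) \<in> M"
    using common_exponent[OF Mr] by blast
  define q where "q = char_exp TYPE('a) ^ k"
  have q: "q > 0" by (simp add: q_def char_exp_pos)
  have cq: "coeff (coeff Z j) i ^ q \<in> M" for i j
  proof (cases "j \<le> degree Z \<and> i \<le> degree (coeff Z j)")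
    case True
    then show ?thesis using k by (auto simp: C_def q_def)
  next
    case False
    then have "coeff (coeff Z j) i = 0" by (auto simp: coeff_eq_0)
    then show ?thesis using q is_subringD(1)[OF Mr] by (simp add: power_0_left)
  qed
  \<comment> \<open>Frobenius is applied twice, once for the outer variable and once for the inner
    one.\<close>
  have "coeff (coeff (Z ^ q) j) i \<in> M" for i j
  proof (cases "CHAR('a) = 0")
    case True
    then have "q = 1" by (simp add: q_def char_exp_def)
    then show ?thesis using cq[of j i] by simp
  next
    case False
    then have p: "prime CHAR('a)" using prime_CHAR_semidom by auto
    have q': "q = CHAR('a) ^ k" using False by (simp add: q_def char_exp_def)
    show ?thesis
      using coeff_frobenius[where 'r = "'a poly", of q k Z j] 
        coeff_frobenius[where 'r = 'a, of q k "coeff Z (j div q)" i] p q' cq is_subringD(1)[OF Mr]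
      by auto
  qed
  then show ?thesis
    using fin PQ q unfolding Z_def
    by (intro exI[of _ O'] exI[of _ q]) (auto simp: O'_def polys_over_def)
qed

section \<open>Separable elements and the separable closure\<close>

lemma rsquarefree_dvd:
  assumes "rsquarefree (p :: 'a::idom poly)" "m dvd p"
  shows "rsquarefree m"
proof -
  have "p \<noteq> 0" "m \<noteq> 0" using assms by (auto simp: rsquarefree_def)
  then show ?thesis
    using assms dvd_imp_order_le[OF \<open>p \<noteq> 0\<close> assms(2)]
    unfolding rsquarefree_def by (metis le_0_eq le_Suc_eq One_nat_def)
qed

lemma card_roots_rsquarefree:
  fixes m :: "'a::alg_closed_field poly"
  assumes "rsquarefree m"
  shows "card {x. poly m x = 0} = degree m"
proof -
  have m0: "m \<noteq> 0" using assms by (simp add: rsquarefree_def)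
  then obtain A where A: "size A = degree m" "m = smult (lead_coeff m) (\<Prod>x\<in>#A. [:-x, 1:])"
    using alg_closed_imp_factorization by blast
  have count: "count A x \<le> 1" for x
  proof (rule ccontr)
    assume "\<not> count A x \<le> 1"
    then have "replicate_mset 2 x \<subseteq># A" 
      by (metis Suc_1 count_le_replicate_mset_subset_eq not_less_eq_eq One_nat_def)
    then have "(\<Prod>x\<in>#replicate_mset 2 x. [:-x, 1:]) dvd (\<Prod>x\<in>#A. [:-x, 1:])"
      by (intro prod_mset_subset_imp_dvd image_mset_subseteq_mono)
    then have "[:-x, 1:] ^ 2 dvd m" by (subst A(2)) (simp add: dvd_smult)
    then have "order x m \<ge> 2" using m0 order_divides[of x 2 m] by simp
    then show False using assms unfolding rsquarefree_def by (metis not_less_eq_eq numeral_2_eq_2 One_nat_def le0 order_refl zero_le)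
  qed
  have "poly m x = 0 \<longleftrightarrow> x \<in># A" for x
    using m0 by (subst A(2)) (auto simp: poly_prod_mset image_iff)
  then have "{x. poly m x = 0} = set_mset A" by auto
  moreover have "count A x = 1" if "x \<in># A" for x
    using count[of x] that by (simp add: le_antisym Suc_leI)
  then have "card (set_mset A) = size A"
    by (simp add: size_multiset_overloaded_eq)
  ultimately show ?thesis using A(1) by simp
qed

text \<open>Write c = r(a) with r of smaller degree than m. Conjugation keeps c, so r - c vanishes
  at every root of m. By separability there are \<open>degree m\<close> roots, too many for r - c
  unless it is zero; so c is the constant coefficient of r.\<close>

lemma separable_fixed:
  fixes M :: "'a::alg_closed_field set"
  assumes M: "is_algebraic_closure_of TYPE('a) M" and m: "is_minimal_poly M a m" "rsquarefree m"
    and c: "c \<in> adjoin M a" "\<And>\<sigma>. \<sigma> \<in> auts M \<Longrightarrow> \<sigma> c = c"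
  shows "c \<in> M"
proof -
  have Mf: "is_subfield M" using M by (simp add: is_algebraic_closure_of_def)
  obtain h where h: "h \<in> polys_over M" "c = poly h a" using c(1) by (auto simp: adjoin_def)
  have "m \<in> polys_over M" "m \<noteq> 0" using m by (auto simp: is_minimal_poly_def)
  from polys_over_division[OF Mf this h(1)] obtain q r where 
    qr: "r \<in> polys_over M" "h = q * m + r" "r = 0 \<or> degree r < degree m" by auto
  have ca: "c = poly r a" using h(2) qr(2) m by (simp add: is_minimal_poly_def)
  have "poly (r - [:c:]) b = 0" if "poly m b = 0" for b
  proof -
    obtain \<sigma> where s: "\<sigma> \<in> auts M" "\<sigma> a = b" using aut_to_conjugate[OF M m(1) \<open>poly m b = 0\<close>] by auto
    have "poly r b = \<sigma> (poly r a)"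
      using poly_map_poly_aut[OF s(1), of r a] map_poly_aut_fixed[OF s(1) qr(1)] s(2) by simp
    then show ?thesis using c(2)[OF s(1)] ca by simp
  qed
  then have sub: "{x. poly m x = 0} \<subseteq> {x. poly (r - [:c:]) x = 0}" by blast
  have "degree (r - [:c:]) < degree m"
    using qr(3) minimal_poly_degree_pos[OF m(1)] by (metis degree_0 degree_diff_less degree_pCons_0)
  have "r = [:c:]"
  proof (rule ccontr)
    assume "r \<noteq> [:c:]"
    then have n0: "r - [:c:] \<noteq> 0" by simp
    have "degree m \<le> card {x. poly (r - [:c:]) x = 0}"
      using card_mono[OF poly_roots_finite[OF n0] sub] card_roots_rsquarefree[OF m(2)] by simp
    also have "\<dots> \<le> degree (r - [:c:])" by (rule card_poly_roots_bound[OF n0])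
    finally show False using \<open>degree (r - [:c:]) < degree m\<close> by simp
  qed
  then show ?thesis using polys_over_coeff[OF qr(1), of 0] by simp
qed

lemma frobenius_inj:
  fixes x y :: "'a::field"
  assumes "x ^ CHAR('a) = y ^ CHAR('a)" "CHAR('a) > 0"
  shows "x = y"
proof -
  have p: "prime CHAR('a)" using assms prime_CHAR_semidom by blast
  have "(x - y) ^ CHAR('a) + y ^ CHAR('a) = x ^ CHAR('a)"
    using freshmans_dream[OF p refl, of "x - y" y] by simp
  then have "(x - y) ^ CHAR('a) = 0" using assms(1) by simp
  then show ?thesis by simp
qed

lemma degree_pderiv_less:
  fixes p :: "'a::{comm_semiring_1,semiring_no_zero_divisors} poly"
  assumes "degree p > 0"
  shows "degree (pderiv p) < degree p"
proof -
  have "degree (pderiv p) \<le> degree p - 1"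
    by (rule degree_le) (auto simp: coeff_pderiv coeff_eq_0)
  then show ?thesis using assms by linarith
qed

text \<open>A multiple root of \<open>m\<close> is a root of \<open>pderiv m\<close>. Conjugating it
  to \<open>c\<close> makes the derivative annihilate \<open>c\<close> in smaller degree, which
  minimality allows only for the zero polynomial.\<close>

lemma inseparable_pderiv:
  fixes K :: "'a::alg_closed_field set"
  assumes K: "is_algebraic_closure_of TYPE('a) K" and m: "is_minimal_poly K c m" "\<not> rsquarefree m"
  shows "pderiv m = 0"
proof (rule ccontr)
  assume d: "pderiv m \<noteq> 0"
  have Kr: "is_subring K" using K is_subfield_subring by (auto simp: is_algebraic_closure_of_def)
  have "m \<noteq> 0" using m by (auto simp: is_minimal_poly_def)
  then obtain b where "order b m \<noteq> 0" "order b m \<noteq> 1" using m(2) by (auto simp: rsquarefree_def)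
  then have "2 \<le> order b m" by simp
  then have "[:-b, 1:] ^ 2 dvd m" using order_1 power_le_dvd by blast
  then obtain s where s: "m = [:-b, 1:] ^ 2 * s" by auto
  define u where "u = [:-b, 1:]"
  have "m = u * (u * s)" "poly u b = 0" by (simp_all only: s u_def power2_eq_square mult.assoc) simp
  then have b: "poly m b = 0" "poly (pderiv m) b = 0"
    by (simp_all only: pderiv_mult poly_mult poly_add) simp_all
  obtain \<sigma> where \<sigma>: "\<sigma> \<in> auts K" "\<sigma> c = b" using aut_to_conjugate[OF K m(1) b(1)] by auto
  have dK: "pderiv m \<in> polys_over K"
    using m(1) by (auto simp: is_minimal_poly_def polys_over_def coeff_pderiv 
        intro!: is_subringD(4)[OF Kr] subring_of_nat[OF Kr] simp del: of_nat_Suc)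
  have "\<sigma> (poly (pderiv m) c) = 0"
    using poly_map_poly_aut[OF \<sigma>(1), of "pderiv m" c] map_poly_aut_fixed[OF \<sigma>(1) dK] \<sigma>(2) b(2) by simp
  then have "poly (pderiv m) c = 0" using auts_simps(4,9)[OF \<sigma>(1)] by metis
  then have "degree m \<le> degree (pderiv m)" using m(1) dK d by (auto simp: is_minimal_poly_def)
  also have "\<dots> < degree m" using minimal_poly_degree_pos[OF m(1)] degree_pderiv_less by blast
  finally show False by simp
qed

text \<open>If \<open>c\<close> is inseparable, then \<open>M = K(c^p)\<close> violates the right-hand side.\<close>

lemma sep_closure_iff:
  fixes K :: "'a::alg_closed_field set"
  assumes K: "is_algebraic_closure_of TYPE('a) K"
  shows "c \<in> sep_closure K \<longleftrightarrow> 
    (\<forall>M. is_subring M \<longrightarrow> K \<subseteq> M \<longrightarrow> (\<forall>\<sigma>\<in>auts M. \<sigma> c = c) \<longrightarrow> c \<in> M)" (is "?L \<longleftrightarrow> ?R")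
proof
  have Kf: "is_subfield K" using K by (simp add: is_algebraic_closure_of_def)
  assume ?L
  then obtain p where p: "is_minimal_poly K c p" "rsquarefree p" by (auto simp: sep_closure_def)
  show ?R
  proof (intro allI impI)
    fix M :: "'a set" assume M: "is_subring M" "K \<subseteq> M" and fixd: "\<forall>\<sigma>\<in>auts M. \<sigma> c = c"
    obtain m s where m: "is_minimal_poly M c m" "p = s * m"
      using minimal_poly_subset[OF subring_over_is_subfield[OF K M] Kf M(2) p(1)] by auto
    have "rsquarefree m" using rsquarefree_dvd[OF p(2)] m(2) by simp
    then show "c \<in> M" 
      using separable_fixed[OF algebraic_closure_mono[OF K M] m(1)] adjoin_subring(3)[OF M(1)] fixd by blast
  qed
next
  have Kf: "is_subfield K" using K by (simp add: is_algebraic_closure_of_def)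
  note Kr = is_subfield_subring[OF Kf]
  assume R: ?R
  obtain m where m: "is_minimal_poly K c m"
    using minimal_poly_exists[OF Kf] K unfolding is_algebraic_closure_of_def by metis
  have "rsquarefree m"
  proof (rule ccontr)
    assume "\<not> rsquarefree m"
    then have d: "pderiv m = 0" using inseparable_pderiv[OF K m] by blast
    have dm: "degree m > 0" using minimal_poly_degree_pos[OF m] .
    have mult: "coeff m (Suc n) * of_nat (Suc n) = 0" for n
      using arg_cong[OF d, of "\<lambda>p. coeff p n"] by (simp add: coeff_pderiv mult.commute)
    have dv: "CHAR('a) dvd n" if "coeff m n \<noteq> 0" for n
      using mult[of "n - 1"] that of_nat_eq_0_iff_char_dvd[of n, where 'a='a] by (cases n) auto
    then have "CHAR('a) dvd degree m" using m by (auto simp: is_minimal_poly_def)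
    \<comment> \<open>Characteristic 0 would make the degree of \<open>m\<close> divisible by 0,
      hence 0.\<close>
    then have p0: "CHAR('a) > 0" using dm by (auto intro: Nat.gr0I)
    define p where "p = CHAR('a)"
    have p: "prime p" using p0 prime_CHAR_semidom p_def by blast
    then have p1: "p > 1" by (rule prime_gt_1_nat)
    define M where "M = adjoin K (c ^ p)"
    have M: "is_subring M" "K \<subseteq> M" "c ^ p \<in> M" unfolding M_def using adjoin_subring[OF Kr] by auto
    \<comment> \<open>An automorphism over \<open>M\<close> fixes \<open>c ^ p\<close>, and p-th
      roots are unique.\<close>
    have "\<sigma> c = c" if s: "\<sigma> \<in> auts M" for \<sigma>
      using auts_simps(3)[OF s M(3)] auts_simps(8)[OF s] frobenius_inj p0 unfolding p_def by metis
    then have "c \<in> M" using R M by blast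
    then obtain h where h: "h \<in> polys_over K" "c = poly h (c ^ p)" by (auto simp: M_def adjoin_def)
    \<comment> \<open>\<open>m\<close> is a polynomial in x^p, and \<open>H\<close> is that
      polynomial: m(x) = H(x^p).\<close>
    define H where "H = (\<Sum>i\<le>degree m. monom (coeff m (p * i)) i)"
    have cH: "coeff H i = coeff m (p * i)" for i
    proof -
      have "coeff m (p * i) = 0" if "\<not> i \<le> degree m"
        using that p1 by (intro coeff_eq_0) (metis less_le_trans mult_1 mult_le_mono1 nat_less_le not_le)
      then show ?thesis by (auto simp: H_def coeff_sum sum.delta)
    qed
    have Hm: "pcompose H (monom 1 p) = m"
      using p1 dv by (intro poly_eqI) (auto simp: coeff_pcompose_monom cH p_def)
    have HK: "H \<in> polys_over K" using m by (auto simp: is_minimal_poly_def polys_over_def cH)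
    have dH: "degree m = degree H * p"
      using Hm degree_pcompose[of H "monom 1 p"] by (simp add: degree_monom_eq)
    then have H0: "H \<noteq> 0" "degree H > 0" using dm by (auto intro: Nat.gr0I)
    have "poly H (c ^ p) = 0"
      using Hm m by (metis (no_types) is_minimal_poly_def poly_monom poly_pcompose mult_1)
    obtain s r where r: "r \<in> polys_over K" "h = s * H + r" "r = 0 \<or> degree r < degree H"
      using polys_over_division[OF Kf HK H0(1) h(1)] by auto
    have cr: "c = poly r (c ^ p)" using h(2) r(2) \<open>poly H (c ^ p) = 0\<close> by simp
    \<comment> \<open>Since c = r(c^p) with \<open>degree r < degree H\<close>, the polynomial
      r(x^p) - x annihilates \<open>c\<close> in smaller degree than \<open>m\<close>. It is
      nonzero: as p > 1, its linear coefficient is -1.\<close>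
    define t where "t = pcompose r (monom 1 p) - [:0, 1:]"
    have "coeff t i \<in> K" for i
      using r(1) p1 polys_over_coeff[OF polys_over_X[OF Kr], of i] is_subringD[OF Kr] 
      unfolding t_def coeff_diff
      by (intro is_subringD(6)[OF Kr]) (auto simp: coeff_pcompose_monom polys_over_def)
    then have "t \<in> polys_over K" by (rule polys_overI)
    moreover have "coeff t 1 = -1" using p1 by (simp add: t_def coeff_pcompose_monom)
    then have "t \<noteq> 0" by auto
    moreover have "poly t c = 0" using cr by (simp add: t_def poly_pcompose poly_monom)
    ultimately have "degree m \<le> degree t" using m by (auto simp: is_minimal_poly_def)
    moreover have "degree t \<le> max (degree r * p) 1"
      unfolding t_def by (rule order_trans[OF degree_diff_le_max]) (simp add: degree_pcompose degree_monom_eq)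
    moreover have "degree r < degree H" using r(3) H0(2) by auto
    then have "degree r * p < degree m" "1 < degree m" using dH p1 H0(2)
      by (auto simp: dH) (metis One_nat_def Suc_lessI less_trans_Suc mult_eq_1_iff nat_less_le nat_0_less_mult_iff neq0_conv)
    ultimately show False by linarith
  qed
  then show ?L using m by (auto simp: sep_closure_def)
qed

lemma sep_closure_fixed_in:
  fixes K :: "'a::alg_closed_field set"
  assumes K: "is_algebraic_closure_of TYPE('a) K" and M: "is_subring M" "K \<subseteq> M" 
    and b: "b \<in> sep_closure K" and c: "c \<in> adjoin M b" "\<And>\<sigma>. \<sigma> \<in> auts M \<Longrightarrow> \<sigma> c = c"
  shows "c \<in> M"
proof -
  have Kf: "is_subfield K" using K by (simp add: is_algebraic_closure_of_def)
  obtain p where p: "is_minimal_poly K b p" "rsquarefree p" using b by (auto simp: sep_closure_def)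
  obtain m s where m: "is_minimal_poly M b m" "p = s * m"
    using minimal_poly_subset[OF subring_over_is_subfield[OF K M] Kf M(2) p(1)] by auto
  have "rsquarefree m" using rsquarefree_dvd[OF p(2)] m(2) by simp
  then show ?thesis using separable_fixed[OF algebraic_closure_mono[OF K M] m(1)] c by blast
qed

text \<open>The criterion \<open>sep_closure_iff\<close> is checked by adjoining \<open>a\<close>
  and then \<open>b\<close> to \<open>M\<close>; a fixed \<open>c\<close> descends from M(a, b) to
  M(a) and from there to \<open>M\<close>.\<close>

lemma sep_closure_closed:
  fixes K :: "'a::alg_closed_field set"
  assumes K: "is_algebraic_closure_of TYPE('a) K" and ab: "a \<in> sep_closure K" "b \<in> sep_closure K"
    and c: "\<And>M. is_subring M \<Longrightarrow> K \<subseteq> M \<Longrightarrow> a \<in> M \<Longrightarrow> b \<in> M \<Longrightarrow> c \<in> M"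
  shows "c \<in> sep_closure K"
  unfolding sep_closure_iff[OF K]
proof (intro allI impI)
  fix M :: "'a set" assume M: "is_subring M" "K \<subseteq> M" and fixd: "\<forall>\<sigma>\<in>auts M. \<sigma> c = c"
  let ?L = "adjoin M a"
  note L = adjoin_subring[OF M(1), of a]
  note LL = adjoin_subring[OF L(1), of b]
  have "c \<in> adjoin ?L b" using L LL M by (intro c) auto
  moreover have "\<sigma> c = c" if "\<sigma> \<in> auts ?L" for \<sigma> using auts_mono[OF L(2)] that fixd by blast
  ultimately have "c \<in> ?L"
    using sep_closure_fixed_in[OF K L(1) _ ab(2)] L(2) M(2) by blast
  then show "c \<in> M" using sep_closure_fixed_in[OF K M ab(1)] fixd by blast
qed

lemma sep_closure_subring:
  fixes K :: "'a::alg_closed_field set"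
  assumes K: "is_algebraic_closure_of TYPE('a) K"
  shows "is_subring (sep_closure K)" "K \<subseteq> sep_closure K"
proof -
  show KS: "K \<subseteq> sep_closure K"
    by (auto simp: sep_closure_iff[OF K])
  have "0 \<in> K" "1 \<in> K" using K by (auto simp: is_algebraic_closure_of_def is_subfield_def)
  then show "is_subring (sep_closure K)"
    unfolding is_subring_def
  proof (intro conjI ballI)
    fix a b assume a: "a \<in> sep_closure K" and b: "b \<in> sep_closure K"
    show "a + b \<in> sep_closure K" "a * b \<in> sep_closure K"
      by (auto intro!: sep_closure_closed[OF K a b] is_subringD(3,4))
    show "- a \<in> sep_closure K"
      by (auto intro!: sep_closure_closed[OF K a a] is_subringD(5))
  qed (use KS in auto)
qed

lemma aut_maps_sep_closure:
  fixes K :: "'a::alg_closed_field set"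
  assumes s: "\<sigma> \<in> auts K" and a: "a \<in> sep_closure K"
  shows "\<sigma> a \<in> sep_closure K"
proof -
  obtain p where p: "is_minimal_poly K a p" "rsquarefree p" using a by (auto simp: sep_closure_def)
  have e: "poly q (\<sigma> a) = \<sigma> (poly q a)" if "q \<in> polys_over K" for q
    using poly_map_poly_aut[OF s, of q a] map_poly_aut_fixed[OF s that] by simp
  then have "poly q (\<sigma> a) = 0 \<longleftrightarrow> poly q a = 0" if "q \<in> polys_over K" for q
    using that auts_simps(4,9)[OF s] by metis
  then have "is_minimal_poly K (\<sigma> a) p" using p(1) unfolding is_minimal_poly_def by blast
  then show ?thesis using p(2) by (auto simp: sep_closure_def)
qed

section \<open>Decomposition group and henselization\<close>

lemma decomposition_group_aut:
  fixes K :: "'a::alg_closed_field set"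
  assumes K: "is_algebraic_closure_of TYPE('a) K"
    and s: "\<sigma> \<in> auts K" and w: "\<And>a. w (\<sigma> a) = w a"
  shows "restrict \<sigma> (sep_closure K) \<in> decomposition_group K w"
proof -
  note r = sep_closure_subring[OF K]
  have i: "inv_into UNIV \<sigma> \<in> auts K" using auts_inv[OF s] .
  have "\<sigma> ` sep_closure K = sep_closure K"
  proof (intro equalityI subsetI)
    fix y assume y: "y \<in> sep_closure K"
    have "inv_into UNIV \<sigma> y \<in> sep_closure K" by (rule aut_maps_sep_closure[OF i y])
    moreover have "y = \<sigma> (inv_into UNIV \<sigma> y)" 
      using auts_simps(10)[OF s] by (simp add: bij_is_surj surj_f_inv_f)
    ultimately show "y \<in> \<sigma> ` sep_closure K" by blast
  qed (use aut_maps_sep_closure[OF s] in auto)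
  moreover have "inj_on \<sigma> (sep_closure K)" by (auto simp: inj_on_def auts_simps(9)[OF s])
  ultimately have "bij_betw (restrict \<sigma> (sep_closure K)) (sep_closure K) (sep_closure K)"
    by (simp add: bij_betw_def)
  then show ?thesis
    using r(2) is_subringD(3,4)[OF r(1)] w
    by (auto simp: decomposition_group_def galois_group_def auts_simps[OF s] subset_iff)
qed

text \<open>An automorphism of the whole closure that preserves \<open>w\<close> restricts to a
  member of the decomposition group. This is how a conjugation over \<open>K\<close> becomes the
  identity on polynomials over the henselization.\<close>

lemma henselization_fixed:
  fixes K :: "'a::alg_closed_field set"
  assumes K: "is_algebraic_closure_of TYPE('a) K"
    and "\<sigma> \<in> auts K" "\<And>a. w (\<sigma> a) = w a" "a \<in> henselization K w"
  shows "\<sigma> a = a"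
  using decomposition_group_aut[of K \<sigma> w] assms by (fastforce simp: henselization_def)

lemma henselization_subring:
  fixes K :: "'a::alg_closed_field set"
  assumes K: "is_algebraic_closure_of TYPE('a) K"
  shows "is_subring (henselization K w)" "K \<subseteq> henselization K w"
proof -
  note r = sep_closure_subring[OF K]
  show KH: "K \<subseteq> henselization K w"
    using r(2) by (auto simp: henselization_def decomposition_group_def galois_group_def)
  have 01: "0 \<in> K" "1 \<in> K" using K by (auto simp: is_algebraic_closure_of_def is_subfield_def)
  have g: "\<sigma> (a + b) = \<sigma> a + \<sigma> b \<and> \<sigma> (a * b) = \<sigma> a * \<sigma> b" 
    if "\<sigma> \<in> decomposition_group K w" "a \<in> sep_closure K" "b \<in> sep_closure K" for \<sigma> a b
    using that by (auto simp: decomposition_group_def galois_group_def)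
  have g0: "\<sigma> 0 = 0" if "\<sigma> \<in> decomposition_group K w" for \<sigma>
    using that 01 by (auto simp: decomposition_group_def galois_group_def)
  show "is_subring (henselization K w)"
    unfolding is_subring_def
  proof (intro conjI ballI)
    show "0 \<in> henselization K w" "1 \<in> henselization K w" using 01 KH by auto
  next
    fix a b assume "a \<in> henselization K w" "b \<in> henselization K w"
    then have ab: "a \<in> sep_closure K" "b \<in> sep_closure K"
      and f: "\<And>\<sigma>. \<sigma> \<in> decomposition_group K w \<Longrightarrow> \<sigma> a = a \<and> \<sigma> b = b"
      by (auto simp: henselization_def)
    have "\<sigma> (a + b) = a + b \<and> \<sigma> (a * b) = a * b" if s: "\<sigma> \<in> decomposition_group K w" for \<sigma>
      using g[OF s ab] f[OF s] by simp
    then show "a + b \<in> henselization K w" "a * b \<in> henselization K w"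
      using is_subringD(3,4)[OF r(1) ab] by (auto simp: henselization_def)
  next
    fix a assume a: "a \<in> henselization K w"
    have "\<sigma> (- a) = - a" if s: "\<sigma> \<in> decomposition_group K w" for \<sigma>
    proof -
      have "\<sigma> (a + - a) = \<sigma> a + \<sigma> (- a)"
        using g[OF s, of a "- a"] a is_subringD(5)[OF r(1)] by (auto simp: henselization_def)
      moreover have "\<sigma> a = a" using a s by (auto simp: henselization_def)
      ultimately show ?thesis using g0[OF s] by (simp add: henselization_def eq_neg_iff_add_eq_0 add.commute)
    qed
    then show "- a \<in> henselization K w" using a is_subringD(5)[OF r(1)] by (auto simp: henselization_def)
  qed
qed


section \<open>Valuations with values in an ordered group type\<close>

text \<open>With type-class instances, values form a linear order and an ordered commutative monoid,
  so that minima, sums and monotonicity come with the class.\<close>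

instantiation with_infty :: (linordered_ab_group_add) "{linorder, ordered_comm_monoid_add}"
begin

definition less_eq_with_infty :: "'a with_infty \<Rightarrow> 'a with_infty \<Rightarrow> bool" where
  "less_eq_with_infty = le_infty class_group"

definition less_with_infty :: "'a with_infty \<Rightarrow> 'a with_infty \<Rightarrow> bool" where
  "less_with_infty x y \<longleftrightarrow> \<not> y \<le> x"

definition zero_with_infty :: "'a with_infty" where
  "zero_with_infty = Fin 0"

definition plus_with_infty :: "'a with_infty \<Rightarrow> 'a with_infty \<Rightarrow> 'a with_infty" where
  "plus_with_infty = plus_infty class_group"

lemma with_infty_le [simp]:
  "x \<le> (Infty :: 'a with_infty)" "Infty \<le> (x :: 'a with_infty) \<longleftrightarrow> x = Infty" 
  "Fin a \<le> (Fin b :: 'a with_infty) \<longleftrightarrow> a \<le> b"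
  by (simp add: less_eq_with_infty_def, cases x, simp_all add: less_eq_with_infty_def class_group_def)

lemma with_infty_plus [simp]:
  "x + (Infty :: 'a with_infty) = Infty" "Infty + x = (Infty :: 'a with_infty)"
  "Fin a + (Fin b :: 'a with_infty) = Fin (a + b)"
  by (cases x, simp_all add: plus_with_infty_def class_group_def)+

instance
proof
  fix x y z :: "'a with_infty"
  show "(x < y) = (x \<le> y \<and> \<not> y \<le> x)" 
    by (cases x; cases y) (auto simp: less_with_infty_def)
  show "x \<le> x" by (cases x) auto
  show "x \<le> y \<Longrightarrow> y \<le> z \<Longrightarrow> x \<le> z" by (cases x; cases y; cases z) auto
  show "x \<le> y \<Longrightarrow> y \<le> x \<Longrightarrow> x = y" by (cases x; cases y) auto
  show "x \<le> y \<or> y \<le> x" by (cases x; cases y) auto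
  show "x + y + z = x + (y + z)" by (cases x; cases y; cases z) (auto simp: add.assoc)
  show "x + y = y + x" by (cases x; cases y) (auto simp: add.commute)
  show "0 + x = x" by (cases x) (auto simp: zero_with_infty_def)
  show "x \<le> y \<Longrightarrow> z + x \<le> z + y" by (cases x; cases y; cases z) (auto simp: add_left_mono)
qed

end

lemma with_infty_less [simp]:
  "(Infty :: 'g::linordered_ab_group_add with_infty) < x \<longleftrightarrow> False" 
  "(x :: 'g with_infty) < Infty \<longleftrightarrow> x \<noteq> Infty"
  "(Fin a :: 'g with_infty) < Fin b \<longleftrightarrow> a < b"
  by (cases x; auto simp: less_with_infty_def)+

lemma with_infty_zero: "(0 :: 'g::linordered_ab_group_add with_infty) = Fin 0"
  by (simp add: zero_with_infty_def)

lemma with_infty_zero_not_Infty [simp]: "(0 :: 'g::linordered_ab_group_add with_infty) \<noteq> Infty" 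
  "Infty \<noteq> (0 :: 'g::linordered_ab_group_add with_infty)"
  by (simp_all add: with_infty_zero)

lemma with_infty_plus_eq_Infty [simp]: 
  "(x :: 'g::linordered_ab_group_add with_infty) + y = Infty \<longleftrightarrow> x = Infty \<or> y = Infty"
  by (cases x; cases y) auto

lemma with_infty_add_cancel:
  fixes x y z :: "'g::linordered_ab_group_add with_infty"
  assumes "z \<noteq> Infty"
  shows "x + z \<le> y + z \<longleftrightarrow> x \<le> y" "z + x \<le> z + y \<longleftrightarrow> x \<le> y"
    "x + z < y + z \<longleftrightarrow> x < y" "z + x < z + y \<longleftrightarrow> x < y"
    "x + z = y + z \<longleftrightarrow> x = y" "z + x = z + y \<longleftrightarrow> x = y"
  using assms by (cases x; cases y; cases z; simp)+

lemma with_infty_add_less_le: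
  fixes x y z t :: "'g::linordered_ab_group_add with_infty"
  assumes "x < y" "z \<le> t" "z \<noteq> Infty"
  shows "x + z < y + t" "z + x < t + y"
  using assms by (cases x; cases y; cases z; cases t; auto simp: add_less_le_mono add_le_less_mono)+

text \<open>Multiples in any commutative monoid: one operation then serves both the value group and
  \<open>with_infty\<close>, which has no subtraction.\<close>

fun nmul :: "nat \<Rightarrow> 'b::comm_monoid_add \<Rightarrow> 'b" where
  "nmul 0 x = 0"
| "nmul (Suc n) x = x + nmul n x"

lemma nmul_add: "nmul n (x + y) = nmul n x + nmul n y"
  by (induction n) (auto simp: algebra_simps)

lemma nmul_plus: "nmul (m + n) x = nmul m x + nmul n x"
  by (induction m) (auto simp: algebra_simps)

lemma nmul_mult: "nmul (m * n) x = nmul m (nmul n x)"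
  by (induction m) (auto simp: algebra_simps nmul_plus)

lemma nmul_zero [simp]: "nmul n 0 = 0"
  by (induction n) auto

lemma nmul_1 [simp]: "nmul 1 x = x" "nmul (Suc 0) x = x"
  by simp_all

lemma nmul_diff: "nmul n (x - y) = nmul n x - nmul n (y :: 'b::ab_group_add)"
  by (induction n) (auto simp: algebra_simps)

lemma nmul_Fin: "nmul n (Fin x) = Fin (nmul n x)" for x :: "'g::linordered_ab_group_add"
  by (induction n) (auto simp: with_infty_zero)

lemma nmul_Infty: "nmul n (x :: 'g::linordered_ab_group_add with_infty) = Infty \<longleftrightarrow> n > 0 \<and> x = Infty"
  by (induction n) auto

lemma nmul_mono: "x \<le> y \<Longrightarrow> nmul n x \<le> nmul n y" for x y :: "'b::ordered_comm_monoid_add"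
  by (induction n) (auto intro: add_mono)

lemma nmul_strict_mono_group: "x < y \<Longrightarrow> n > 0 \<Longrightarrow> nmul n x < nmul n y" for x y :: "'g::linordered_ab_group_add"
proof (induction n)
  case (Suc n)
  then show ?case by (cases "n = 0") (auto intro: add_strict_mono)
qed simp

lemma nmul_strict_mono:
  fixes x y :: "'g::linordered_ab_group_add with_infty"
  assumes "x < y" "n > 0"
  shows "nmul n x < nmul n y"
proof (cases y)
  case (Fin b)
  then obtain a where "x = Fin a" using assms by (cases x) auto
  then show ?thesis using Fin assms nmul_strict_mono_group by (simp add: nmul_Fin)
next
  case Infty
  then have "nmul n y = Infty" "nmul n x \<noteq> Infty" using assms by (auto simp: nmul_Infty)
  then show ?thesis by simp
qed

lemma nmul_le_iff:
  fixes x y :: "'b::{linorder,ordered_comm_monoid_add}"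
  assumes "\<And>x y :: 'b. x < y \<Longrightarrow> nmul n x < nmul n y"
  shows "nmul n x \<le> nmul n y \<longleftrightarrow> x \<le> y" "nmul n x = nmul n y \<longleftrightarrow> x = y" "nmul n x < nmul n y \<longleftrightarrow> x < y"
proof -
  have *: "nmul n x \<le> nmul n y \<longleftrightarrow> x \<le> y" for x y :: 'b
    using assms[of y x] nmul_mono[of x y n] by (meson not_le)
  show "nmul n x \<le> nmul n y \<longleftrightarrow> x \<le> y" by (rule *)
  show "nmul n x = nmul n y \<longleftrightarrow> x = y" using *[of x y] *[of y x] by (metis order_antisym order_refl)
  show "nmul n x < nmul n y \<longleftrightarrow> x < y" using *[of y x] by (simp add: not_le[symmetric])
qed

lemma nmul_cancel:
  fixes x y :: "'g::linordered_ab_group_add with_infty"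
  assumes "n > 0"
  shows "nmul n x \<le> nmul n y \<longleftrightarrow> x \<le> y" "nmul n x = nmul n y \<longleftrightarrow> x = y" "nmul n x < nmul n y \<longleftrightarrow> x < y"
  using nmul_le_iff[of n x y] nmul_strict_mono assms by blast+

lemma nmul_cancel_group:
  fixes x y :: "'g::linordered_ab_group_add"
  assumes "n > 0"
  shows "nmul n x \<le> nmul n y \<longleftrightarrow> x \<le> y" "nmul n x = nmul n y \<longleftrightarrow> x = y" "nmul n x < nmul n y \<longleftrightarrow> x < y"
  using nmul_cancel[OF assms, of "Fin x" "Fin y"] by (simp_all add: nmul_Fin)

lemma divisible_class_group:
  assumes "divisible_group (class_group :: 'g::linordered_ab_group_add ordered_group)" "n > 0"
  shows "\<exists>y. nmul n y = (x :: 'g)"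
proof -
  have "y [^]\<^bsub>class_group\<^esub> k = nmul k y" for y :: 'g and k :: nat
    by (induction k) (simp_all add: nat_pow_def class_group_def add.commute)
  then show ?thesis using assms by (auto simp: divisible_group_def class_group_def)
qed

section \<open>Valuations on subrings and their basic estimates\<close>

definition val_on :: "'r::comm_ring_1 set \<Rightarrow> ('r \<Rightarrow> 'g::linordered_ab_group_add with_infty) \<Rightarrow> bool" where
  "val_on R \<mu> \<longleftrightarrow> \<mu> 0 = Infty \<and> \<mu> 1 = 0 \<and>
     (\<forall>f\<in>R. \<forall>g\<in>R. \<mu> (f * g) = \<mu> f + \<mu> g \<and> min (\<mu> f) (\<mu> g) \<le> \<mu> (f + g))"

lemma valuation_on_class_group: 
  fixes \<mu> :: "'r::comm_ring_1 \<Rightarrow> 'g::linordered_ab_group_add with_infty"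
  shows "valuation_on class_group R \<mu> \<longleftrightarrow> val_on R \<mu>"
proof -
  have "set_with_infty x \<subseteq> carrier class_group" for x :: "'g with_infty"
    by (simp add: class_group_def)
  moreover have "min_infty class_group x y = min x y" for x y :: "'g with_infty"
    by (simp add: min_infty_def min_def less_eq_with_infty_def)
  moreover have "Fin \<one>\<^bsub>class_group\<^esub> = (0 :: 'g with_infty)" by (simp add: zero_with_infty_def class_group_def)
  ultimately show ?thesis
    unfolding valuation_on_def val_on_def less_eq_with_infty_def plus_with_infty_def by auto
qed

lemma val_onD:
  assumes "val_on R \<mu>"
  shows "\<mu> 0 = Infty" "\<mu> 1 = 0" "\<And>f g. f \<in> R \<Longrightarrow> g \<in> R \<Longrightarrow> \<mu> (f * g) = \<mu> f + \<mu> g"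
    "\<And>f g. f \<in> R \<Longrightarrow> g \<in> R \<Longrightarrow> min (\<mu> f) (\<mu> g) \<le> \<mu> (f + g)"
  using assms by (auto simp: val_on_def)

lemma val_on_subset: "val_on R \<mu> \<Longrightarrow> S \<subseteq> R \<Longrightarrow> val_on S \<mu>"
  unfolding val_on_def by blast

lemma val_on_cong: 
  assumes "is_subring R" "\<And>f. f \<in> R \<Longrightarrow> \<mu> f = \<nu> f"
  shows "val_on R \<mu> \<longleftrightarrow> val_on R \<nu>"
  unfolding val_on_def using assms(2) is_subringD[OF assms(1)] by simp

context
  fixes R :: "'r::comm_ring_1 set" and \<mu> :: "'r \<Rightarrow> 'g::linordered_ab_group_add with_infty"
  assumes R: "is_subring R" and val: "val_on R \<mu>"
begin

text \<open>The square of -1 is 1, so twice its value is zero, and an ordered group has no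
  torsion.\<close>

lemma val_minus: "f \<in> R \<Longrightarrow> \<mu> (- f) = \<mu> f"
proof -
  assume f: "f \<in> R"
  have 1: "-1 \<in> R" using is_subringD[OF R] by blast
  have "nmul 2 (\<mu> (-1)) = nmul 2 0"
    using val_onD(3)[OF val 1 1] val_onD(2)[OF val] by (simp add: numeral_2_eq_2)
  then have "\<mu> (-1) = 0" using nmul_cancel(2)[of 2 "\<mu> (-1)" 0] by simp
  then show ?thesis using val_onD(3)[OF val 1 f] by simp
qed

lemma val_diff: "f \<in> R \<Longrightarrow> g \<in> R \<Longrightarrow> min (\<mu> f) (\<mu> g) \<le> \<mu> (f - g)"
  using val_onD(4)[OF val, of f "- g"] val_minus[of g] is_subringD(5)[OF R, of g] by simp

lemma val_power: "f \<in> R \<Longrightarrow> \<mu> (f ^ n) = nmul n (\<mu> f)"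
  by (induction n) (auto simp: val_onD[OF val] subring_power[OF R])

lemma val_add_eq:
  assumes "f \<in> R" "g \<in> R" "\<mu> f < \<mu> g"
  shows "\<mu> (f + g) = \<mu> f" "\<mu> (g + f) = \<mu> f"
proof -
  have "min (\<mu> f) (\<mu> g) \<le> \<mu> (f + g)" using val_onD(4)[OF val assms(1,2)] .
  then have 1: "\<mu> f \<le> \<mu> (f + g)" using assms(3) by (simp add: min.absorb1)
  have "min (\<mu> (f + g)) (\<mu> g) \<le> \<mu> f"
    using val_diff[of "f + g" g] assms is_subringD(3)[OF R] by simp
  then show 2: "\<mu> (f + g) = \<mu> f" using 1 assms(3) by (auto simp: min_def split: if_splits)
  then show "\<mu> (g + f) = \<mu> f" by (simp add: add.commute)
qed

lemma val_sum_ge: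
  assumes "\<And>i. i \<in> I \<Longrightarrow> f i \<in> R" "\<And>i. i \<in> I \<Longrightarrow> t \<le> \<mu> (f i)"
  shows "t \<le> \<mu> (sum f I)"
  using assms
proof (induction I rule: infinite_finite_induct)
  case (insert x F)
  have "sum f F \<in> R" using insert.prems by (intro subring_sum[OF R]) auto
  then show ?case
    using insert val_onD(4)[OF val, of "f x" "sum f F"] by (auto simp: min_def split: if_splits intro: order_trans)
qed (auto simp: val_onD[OF val])

lemma val_sum_gt:
  assumes "\<And>i. i \<in> I \<Longrightarrow> f i \<in> R" "\<And>i. i \<in> I \<Longrightarrow> t < \<mu> (f i)" "t \<noteq> Infty"
  shows "t < \<mu> (sum f I)"
  using assms
proof (induction I rule: infinite_finite_induct)
  case (insert x F)
  have "sum f F \<in> R" using insert.prems by (intro subring_sum[OF R]) auto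
  then show ?case
    using insert val_onD(4)[OF val, of "f x" "sum f F"] by (auto simp: min_def split: if_splits intro: less_le_trans)
qed (auto simp: val_onD[OF val])

text \<open>If the minimum were attained only once, the sum would have that finite value.\<close>

lemma val_sum_zero:
  assumes I: "finite I" "\<And>i. i \<in> I \<Longrightarrow> f i \<in> R" and sum: "\<mu> (sum f I) = Infty" 
    and k: "k \<in> I" "\<mu> (f k) \<noteq> Infty"
  shows "\<exists>i\<in>I. \<exists>j\<in>I. i \<noteq> j \<and> \<mu> (f i) = \<mu> (f j) \<and> \<mu> (f i) \<noteq> Infty"
proof (rule ccontr)
  assume n: "\<not> ?thesis"
  obtain m where m: "m \<in> I" "\<And>i. i \<in> I \<Longrightarrow> \<mu> (f m) \<le> \<mu> (f i)"
    using arg_min_if_finite[of I "\<lambda>i. \<mu> (f i)"] I(1) k(1) by (metis empty_iff linorder_not_less)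
  have fin: "\<mu> (f m) \<noteq> Infty" using m(2)[OF k(1)] k(2) by auto
  then have lt: "\<mu> (f m) < \<mu> (f i)" if "i \<in> I - {m}" for i
    using n m(2)[of i] m(1) that by (metis DiffE insertI1 le_neq_trans)
  have "\<mu> (f m) < \<mu> (sum f (I - {m}))"
    by (rule val_sum_gt) (use I lt fin in auto)
  moreover have "sum f (I - {m}) \<in> R" using I by (intro subring_sum[OF R]) auto
  ultimately have "\<mu> (f m + sum f (I - {m})) = \<mu> (f m)" using val_add_eq(1) I(2)[OF m(1)] by blast
  then show False using sum fin sum.remove[OF I(1) m(1), of f] by simp
qed

end

lemma val_field_nonzero:
  fixes K :: "'a::field set"
  assumes "is_subfield K" "val_on K w" "c \<in> K" "c \<noteq> 0"
  shows "w c \<noteq> Infty" "w (inverse c) + w c = 0"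
proof -
  show "w (inverse c) + w c = 0" 
    using val_onD(3)[OF assms(2) is_subfield_inverse[OF assms(1,3)] assms(3)] assms(4) val_onD(2)[OF assms(2)] by simp
  then show "w c \<noteq> Infty" by auto
qed

text \<open>Two terms of the equation p(c) = 0 must tie at a finite value, and their quotient
  isolates a power of \<open>c\<close>. So the value of \<open>c\<close> is torsion modulo the
  values of \<open>K\<close>.\<close>

lemma val_algebraic:
  fixes K :: "'a::field set" and w :: "'a \<Rightarrow> 'g::linordered_ab_group_add with_infty"
  assumes K: "is_subfield K" and R: "is_subring R" "K \<subseteq> R" and w: "val_on R w" 
    and c: "c \<in> R" "w c \<noteq> Infty" and p: "p \<in> polys_over K" "p \<noteq> 0" "poly p c = 0"
  shows "\<exists>n>0. \<exists>k\<in>K. k \<noteq> 0 \<and> w (c ^ n) = w k"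
proof -
  let ?f = "\<lambda>i. coeff p i * c ^ i"
  have cK: "coeff p i \<in> K" for i using p by (simp add: polys_over_def)
  have fR: "?f i \<in> R" for i
    using cK R by (intro is_subringD(4)[OF R(1)] subring_power c) auto
  have v: "w (?f i) = w (coeff p i) + nmul i (w c)" for i
    using val_onD(3)[OF w, of "coeff p i" "c ^ i"] subring_power[OF R(1) c(1)] cK R(2)
      val_power[OF R(1) w c(1)] by auto
  have wK: "val_on K w" using val_on_subset[OF w R(2)] .
  have "w (?f (degree p)) \<noteq> Infty"
    unfolding v using p(2) val_field_nonzero(1)[OF K wK cK, of "degree p"] c(2) by (auto simp: nmul_Infty)
  moreover have "w (\<Sum>i\<le>degree p. ?f i) = Infty"
    using p(3) val_onD(1)[OF w] by (simp add: poly_altdef)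
  ultimately obtain i j where ij: "i < j" "w (?f i) = w (?f j)" "w (?f i) \<noteq> Infty"
    using val_sum_zero[OF R(1) w, of "{..degree p}" ?f "degree p"] fR
    by (metis atMost_iff finite_atMost linorder_neqE_nat order_refl)
  have nz: "coeff p i \<noteq> 0" "coeff p j \<noteq> 0" using ij val_onD(1)[OF w] by auto
  obtain n where j: "j = i + n" "n > 0" using ij(1) by (metis less_imp_add_positive)
  have i: "nmul i (w c) \<noteq> Infty" using c(2) by (auto simp: nmul_Infty)
  let ?k = "coeff p i * inverse (coeff p j)"
  have kK: "?k \<in> K" "?k \<noteq> 0"
    using cK nz is_subfield_inverse[OF K] is_subringD(4)[OF is_subfield_subring[OF K]] by auto
  have "w (coeff p i) = w (coeff p j) + nmul n (w c)"
  proof -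
    have "w (coeff p i) + nmul i (w c) = (w (coeff p j) + nmul n (w c)) + nmul i (w c)"
      using ij(2) unfolding v j nmul_plus by (simp only: ac_simps)
    then show ?thesis using with_infty_add_cancel(5)[OF i] by blast
  qed
  then have "w ?k = (w (coeff p j) + nmul n (w c)) + w (inverse (coeff p j))"
    using val_onD(3)[OF wK cK is_subfield_inverse[OF K cK]] by simp
  also have "\<dots> = nmul n (w c) + (w (inverse (coeff p j)) + w (coeff p j))"
    by (simp only: ac_simps)
  also have "\<dots> = nmul n (w c)" using val_field_nonzero(2)[OF K wK cK nz(2)] by simp
  finally have "w ?k = nmul n (w c)" .
  also have "\<dots> = w (c ^ n)" using val_power[OF R(1) w c(1)] by simp
  finally show ?thesis using j(2) kK by metis
qed


section \<open>Conjugacy of valuations with trivial support\<close>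

text \<open>For valuations this is the same as equivalence, by
  \<open>valuation_equiv_iff_order_equiv\<close>, but it passes to subrings and along automorphisms
  without an isomorphism of value groups to carry.\<close>

definition order_equiv :: "'r set \<Rightarrow> ('r \<Rightarrow> 'g::linordered_ab_group_add with_infty) \<Rightarrow> ('r \<Rightarrow> 'h::linordered_ab_group_add with_infty) \<Rightarrow> bool" where
  "order_equiv R \<mu> \<nu> \<longleftrightarrow> (\<forall>f\<in>R. \<forall>g\<in>R. \<mu> f \<le> \<mu> g \<longleftrightarrow> \<nu> f \<le> \<nu> g)"

lemma order_equivD: 
  "order_equiv R \<mu> \<nu> \<Longrightarrow> f \<in> R \<Longrightarrow> g \<in> R \<Longrightarrow> \<mu> f \<le> \<mu> g \<longleftrightarrow> \<nu> f \<le> \<nu> g"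
  "order_equiv R \<mu> \<nu> \<Longrightarrow> f \<in> R \<Longrightarrow> g \<in> R \<Longrightarrow> \<mu> f < \<mu> g \<longleftrightarrow> \<nu> f < \<nu> g"
  "order_equiv R \<mu> \<nu> \<Longrightarrow> f \<in> R \<Longrightarrow> g \<in> R \<Longrightarrow> \<mu> f = \<mu> g \<longleftrightarrow> \<nu> f = \<nu> g"
proof -
  assume a: "order_equiv R \<mu> \<nu>" "f \<in> R" "g \<in> R"
  then show 1: "\<mu> f \<le> \<mu> g \<longleftrightarrow> \<nu> f \<le> \<nu> g" unfolding order_equiv_def by blast
  have 2: "\<mu> g \<le> \<mu> f \<longleftrightarrow> \<nu> g \<le> \<nu> f" using a unfolding order_equiv_def by blast
  show "\<mu> f < \<mu> g \<longleftrightarrow> \<nu> f < \<nu> g" using 2 by (simp add: not_le[symmetric])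
  show "\<mu> f = \<mu> g \<longleftrightarrow> \<nu> f = \<nu> g" using 1 2 by (metis order_antisym order_refl)
qed

lemma order_equiv_sym: "order_equiv R \<mu> \<nu> \<Longrightarrow> order_equiv R \<nu> \<mu>"
  unfolding order_equiv_def by blast

lemma order_equiv_trans: "order_equiv R \<mu> \<nu> \<Longrightarrow> order_equiv R \<nu> \<xi> \<Longrightarrow> order_equiv R \<mu> \<xi>"
  unfolding order_equiv_def by blast

lemma order_equiv_subset: "order_equiv R \<mu> \<nu> \<Longrightarrow> S \<subseteq> R \<Longrightarrow> order_equiv S \<mu> \<nu>"
  unfolding order_equiv_def by blast

lemma val_comp_aut:
  assumes "val_on UNIV \<rho>" "\<sigma> \<in> auts K"
  shows "val_on UNIV (\<lambda>f. \<rho> (map_poly \<sigma> f))"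
  using assms(1) by (auto simp: val_on_def map_poly_aut[OF assms(2)])

definition trivial_support :: "('r::zero \<Rightarrow> 'g with_infty) \<Rightarrow> bool" where
  "trivial_support \<rho> \<longleftrightarrow> (\<forall>f. \<rho> f = Infty \<longleftrightarrow> f = 0)"

lemma trivial_support_zero: "trivial_support \<rho> \<Longrightarrow> \<rho> 0 = Infty"
  by (simp add: trivial_support_def)

lemma trivial_support_comp_aut:
  "trivial_support \<rho> \<Longrightarrow> \<sigma> \<in> auts K \<Longrightarrow> trivial_support (\<lambda>f. \<rho> (map_poly \<sigma> f))"
  by (auto simp: trivial_support_def map_poly_aut)

section \<open>Products of linear factors and integrality\<close>

abbreviation linear_factors :: "('r::comm_ring_1 \<times> 'r) list \<Rightarrow> 'r poly" where
  "linear_factors xs \<equiv> prod_list (map (\<lambda>x. [:- snd x, fst x:]) xs)"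

text \<open>If \<open>degree Z\<close> is at most \<open>n\<close>, this is t^n Z(s/t), the
  homogenisation of \<open>Z\<close> in degree \<open>n\<close>, written without division.\<close>

definition hom_eval :: "nat \<Rightarrow> 'r::comm_ring_1 poly \<Rightarrow> 'r \<Rightarrow> 'r \<Rightarrow> 'r" where
  "hom_eval n Z s t = (\<Sum>j\<le>n. coeff Z j * s ^ j * t ^ (n - j))"

lemma hom_eval_linear:
  assumes "degree Z \<le> n"
  shows "hom_eval (Suc n) ([:b, a:] * Z) s t = (a * s + b * t) * hom_eval n Z s t"
proof -
  have 1: "hom_eval (Suc n) (pCons 0 Z) s t = s * hom_eval n Z s t" for Z
    unfolding hom_eval_def sum.atMost_Suc_shift by (simp add: sum_distrib_left algebra_simps)
  have "hom_eval (Suc n) Z s t = (\<Sum>j\<le>n. coeff Z j * s ^ j * t ^ (Suc n - j))"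
    unfolding hom_eval_def using assms by (simp add: coeff_eq_0)
  also have "\<dots> = (\<Sum>j\<le>n. t * (coeff Z j * s ^ j * t ^ (n - j)))"
    by (rule sum.cong) (simp_all add: Suc_diff_le algebra_simps)
  also have "\<dots> = t * hom_eval n Z s t" by (simp add: hom_eval_def sum_distrib_left)
  finally have 2: "hom_eval (Suc n) Z s t = t * hom_eval n Z s t" .
  have 3: "hom_eval n (smult c Z) s t = c * hom_eval n Z s t" for c n Z
    by (simp add: hom_eval_def sum_distrib_left algebra_simps)
  have 4: "hom_eval n (Y + Z) s t = hom_eval n Y s t + hom_eval n Z s t" for n Y Z
    by (simp add: hom_eval_def sum.distrib algebra_simps)
  have "[:b, a:] * Z = smult b Z + pCons 0 (smult a Z)" by simp
  then show ?thesis by (simp only: 1 2 3 4) (simp add: algebra_simps)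
qed

text \<open>A pair (P, Q) stands for the factor P Y - Q, with formal root Q/P. The length only
  bounds the degree, because a first component may be zero.\<close>

lemma linear_factors:
  "degree (linear_factors xs) \<le> length xs"
  "coeff (linear_factors xs) (length xs) = prod_list (map fst xs)"
  "hom_eval (length xs) (linear_factors xs) s t = prod_list (map (\<lambda>x. fst x * s - snd x * t) xs)"
proof (induction xs)
  case Nil
  { case 1 show ?case by simp next case 2 show ?case by simp next case 3 show ?case by (simp add: hom_eval_def) }
next
  case (Cons x xs)
  { case 1
    have "degree [:- snd x, fst x:] \<le> 1" by (simp add: degree_pCons_eq_if)
    then show ?case using degree_mult_le[of "[:- snd x, fst x:]" "linear_factors xs"] Cons.IH(1)
      by (simp only: list.map prod_list.Cons length_Cons)
  next
    case 2
    show ?case using Cons.IH(1,2) by (simp add: coeff_eq_0)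
  next
    case 3
    show ?case
      by (simp only: list.map prod_list.Cons length_Cons hom_eval_linear[OF Cons.IH(1)] Cons.IH(3)
          diff_conv_add_uminus mult_minus_left) }
qed

text \<open>A new factor contributes to each coefficient through its first and its second component,
  and both have at least the value of the first. So the product of the first components stays a
  lower bound.\<close>

lemma linear_factors_coeff_val:
  fixes \<rho> :: "'r::comm_ring_1 \<Rightarrow> 'g::linordered_ab_group_add with_infty"
  assumes "val_on UNIV \<rho>" "\<And>x. x \<in> set xs \<Longrightarrow> \<rho> (fst x) \<le> \<rho> (snd x)"
  shows "\<rho> (prod_list (map fst xs)) \<le> \<rho> (coeff (linear_factors xs) j)"
  using assms(2)
proof (induction xs arbitrary: j)
  case Nil
  show ?case using val_onD[OF assms(1)] by (auto simp: coeff_1)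
next
  case (Cons x xs)
  note v = val_onD[OF assms(1)]
  let ?Z = "linear_factors xs"
  have IH: "\<rho> (prod_list (map fst xs)) \<le> \<rho> (coeff ?Z j)" for j using Cons by auto
  have a: "\<rho> (prod_list (map fst (x # xs))) \<le> \<rho> (- snd x * coeff ?Z j)" for j
    using Cons.prems[of x] IH v(3) val_minus[OF is_subring_UNIV assms(1)] by (auto intro: add_mono)
  have b: "\<rho> (prod_list (map fst (x # xs))) \<le> \<rho> (fst x * coeff ?Z j)" for j
    using IH v(3) by (auto intro: add_mono)
  define A where "A = - snd x * coeff ?Z j"
  define B where "B = (case j of 0 \<Rightarrow> 0 | Suc k \<Rightarrow> fst x * coeff ?Z k)"
  have eq: "coeff (linear_factors (x # xs)) j = A + B"
    by (simp add: coeff_pCons A_def B_def split: nat.splits)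
  have "\<rho> (prod_list (map fst (x # xs))) \<le> \<rho> B"
    using b v(1) by (auto simp: B_def split: nat.splits)
  moreover have "\<rho> (prod_list (map fst (x # xs))) \<le> \<rho> A" using a[of j] by (simp add: A_def)
  ultimately have "\<rho> (prod_list (map fst (x # xs))) \<le> min (\<rho> A) (\<rho> B)" by simp
  also have "\<dots> \<le> \<rho> (A + B)" by (rule v(4)) auto
  finally show ?case by (simp only: eq)
qed

text \<open>With a list in place of a set, the q-th power of the norm is again a product of linear
  factors, each orbit element being repeated.\<close>

lemma norm_list:
  fixes M :: "'a::alg_closed_field set"
  assumes M: "is_algebraic_closure_of TYPE('a) M"
  shows "\<exists>xs. (P, Q) \<in> set xs \<and> set xs \<subseteq> (\<lambda>\<sigma>. (map_poly \<sigma> P, map_poly \<sigma> Q)) ` auts M \<and>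
     (\<forall>j. coeff (linear_factors xs) j \<in> polys_over M)"
proof -
  obtain X q where X: "finite X" "q > 0" "(P, Q) \<in> X" "X \<subseteq> (\<lambda>\<sigma>. (map_poly \<sigma> P, map_poly \<sigma> Q)) ` auts M"
     "\<forall>j. coeff ((\<Prod>x\<in>X. [:- snd x, fst x:]) ^ q) j \<in> polys_over M"
    using norm_over_subfield[OF M, of P Q] by (elim exE conjE) blast
  obtain ys where ys: "set ys = X" "distinct ys" using finite_distinct_list[OF X(1)] by auto
  define xs where "xs = concat (replicate q ys)"
  have "linear_factors (concat (replicate n ys)) = linear_factors ys ^ n" for n
    by (induction n) auto
  moreover have "linear_factors ys = (\<Prod>x\<in>X. [:- snd x, fst x:])"
    unfolding ys(1)[symmetric] by (rule prod.distinct_set_conv_list[OF ys(2), symmetric])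
  moreover have "set xs = X" using ys X(2) by (auto simp: xs_def)
  ultimately show ?thesis using X by (intro exI[of _ xs]) (auto simp: xs_def)
qed

text \<open>The norm of Y - b is monic, since automorphisms keep the first component 1; so every
  polynomial is integral over \<open>polys_over M\<close>.\<close>

lemma poly_integral:
  fixes M :: "'a::alg_closed_field set"
  assumes M: "is_algebraic_closure_of TYPE('a) M"
  shows "\<exists>Z. lead_coeff Z = 1 \<and> (\<forall>j. coeff Z j \<in> polys_over M) \<and> poly Z b = 0"
proof -
  obtain xs where xs: "(1, b) \<in> set xs" "set xs \<subseteq> (\<lambda>\<sigma>. (map_poly \<sigma> 1, map_poly \<sigma> b)) ` auts M"
     "\<forall>j. coeff (linear_factors xs) j \<in> polys_over M"
    using norm_list[OF M, of 1 b] by (elim exE conjE) blast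
  have "fst x = 1" if x: "x \<in> set xs" for x
  proof -
    have "\<exists>\<sigma>\<in>auts M. x = (map_poly \<sigma> 1, map_poly \<sigma> b)" 
      using subsetD[OF xs(2) x] by (simp only: image_iff) 
    then show ?thesis using map_poly_aut(7)[of _ M] by force
  qed
  then have "prod_list (map fst xs) = 1" by (induction xs) auto
  then have 1: "coeff (linear_factors xs) (length xs) = 1" by (simp add: linear_factors(2))
  then have "degree (linear_factors xs) = length xs"
    using linear_factors(1)[of xs] le_degree[of "linear_factors xs" "length xs"] by simp
  then have "lead_coeff (linear_factors xs) = 1" using 1 by simp
  moreover have "poly (linear_factors xs) b = 0"
    using split_list[OF xs(1)] by auto
  ultimately show ?thesis using xs(3) by blast
qed

text \<open>Again two terms of an equation tie, here of an integral one. The ring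
  \<open>polys_over M\<close> has no division, so the coefficient of the higher term stays on the
  left as \<open>c\<close>.\<close>

lemma val_poly_algebraic:
  fixes M :: "'a::alg_closed_field set" and \<rho> :: "'a poly \<Rightarrow> 'g::linordered_ab_group_add with_infty"
  assumes M: "is_algebraic_closure_of TYPE('a) M" and \<rho>: "val_on UNIV \<rho>" "trivial_support \<rho>" and b: "b \<noteq> 0"
  shows "\<exists>n>0. \<exists>c\<in>polys_over M. \<exists>d\<in>polys_over M. c \<noteq> 0 \<and> d \<noteq> 0 \<and> \<rho> (c * b ^ n) = \<rho> d"
proof -
  note v = val_onD[OF \<rho>(1)]
  note t = \<rho>(2)[unfolded trivial_support_def, rule_format]
  obtain Z where Z: "lead_coeff Z = 1" "\<And>j. coeff Z j \<in> polys_over M" "poly Z b = 0"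
    using poly_integral[OF M] by blast
  let ?f = "\<lambda>i. coeff Z i * b ^ i"
  have "\<exists>i\<in>{..degree Z}. \<exists>j\<in>{..degree Z}. i \<noteq> j \<and> \<rho> (?f i) = \<rho> (?f j) \<and> \<rho> (?f i) \<noteq> Infty"
    using Z b by (intro val_sum_zero[OF is_subring_UNIV \<rho>(1), of _ _ "degree Z"]) 
       (auto simp: v(1) t simp flip: poly_altdef)
  then obtain i0 j0 where "i0 \<noteq> j0" "\<rho> (?f i0) = \<rho> (?f j0)" "\<rho> (?f i0) \<noteq> Infty" by blast
  then obtain i j where ij: "i < j" "\<rho> (?f i) = \<rho> (?f j)" "\<rho> (?f i) \<noteq> Infty"
    by (cases i0 j0 rule: linorder_cases) auto
  then obtain n where n: "j = i + n" "n > 0" using less_imp_add_positive[OF ij(1)] by auto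
  have nz: "coeff Z i \<noteq> 0" "coeff Z j \<noteq> 0" using ij t[of 0] by (metis mult_zero_left)+
  have "\<rho> (coeff Z i) + \<rho> (b ^ i) = \<rho> (coeff Z j * b ^ n) + \<rho> (b ^ i)"
    using ij(2) unfolding n(1) by (simp add: v(3)[symmetric] power_add mult_ac)
  moreover have "\<rho> (b ^ i) \<noteq> Infty" using b t by simp
  ultimately have "\<rho> (coeff Z j * b ^ n) = \<rho> (coeff Z i)"
    using with_infty_add_cancel(5) by metis
  then show ?thesis using n nz Z(2) by blast
qed

text \<open>Both sides of the comparison are raised to the power k l, and the factors
  \<open>c\<close> and \<open>c'\<close> are cleared. If \<open>c\<close>, \<open>c'\<close>,
  \<open>d\<close>, \<open>d'\<close> come from a base ring, the comparison of \<open>f\<close> with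
  \<open>g\<close> has become one inside that ring.\<close>

lemma val_le_iff_algebraic:
  fixes \<nu> :: "'r::comm_ring_1 \<Rightarrow> 'g::linordered_ab_group_add with_infty"
  assumes \<nu>: "val_on UNIV \<nu>" and k: "k > 0" "l > 0" and c: "\<nu> c \<noteq> Infty" "\<nu> c' \<noteq> Infty"
    and "\<nu> (c * f ^ k) = \<nu> d" "\<nu> (c' * g ^ l) = \<nu> d'"
  shows "\<nu> f \<le> \<nu> g \<longleftrightarrow> \<nu> (d ^ l * c' ^ k) \<le> \<nu> (c ^ l * d' ^ k)"
proof -
  note v = val_onD(3)[OF \<nu> UNIV_I UNIV_I]
  note p = val_power[OF is_subring_UNIV \<nu> UNIV_I]
  define e where "e = nmul l (\<nu> c) + nmul k (\<nu> c')"
  have e: "e \<noteq> Infty" using c by (simp add: e_def nmul_Infty)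
  have "\<nu> (d ^ l * c' ^ k) = nmul l (\<nu> c + nmul k (\<nu> f)) + nmul k (\<nu> c')"
    using assms(6) by (simp add: v p)
  also have "\<dots> = e + nmul (l * k) (\<nu> f)" by (simp add: e_def nmul_add ac_simps flip: nmul_mult)
  finally have 1: "\<nu> (d ^ l * c' ^ k) = e + nmul (l * k) (\<nu> f)" .
  have "\<nu> (c ^ l * d' ^ k) = nmul l (\<nu> c) + nmul k (\<nu> c' + nmul l (\<nu> g))"
    using assms(7) by (simp add: v p)
  also have "\<dots> = e + nmul (l * k) (\<nu> g)"
    by (simp add: e_def nmul_add ac_simps flip: nmul_mult)
  finally have 2: "\<nu> (c ^ l * d' ^ k) = e + nmul (l * k) (\<nu> g)" .
  show ?thesis unfolding 1 2 with_infty_add_cancel(2)[OF e] using k by (simp add: nmul_cancel)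
qed

text \<open>Over a common base, valuation rings of an algebraic extension are incomparable.\<close>

lemma order_equiv_of_inclusion:
  fixes M :: "'a::alg_closed_field set" and \<rho> \<rho>' :: "'a poly \<Rightarrow> 'g::linordered_ab_group_add with_infty"
  assumes M: "is_algebraic_closure_of TYPE('a) M" 
    and \<rho>: "val_on UNIV \<rho>" "trivial_support \<rho>" and \<rho>': "val_on UNIV \<rho>'" "trivial_support \<rho>'"
    and oe: "order_equiv (polys_over M) \<rho> \<rho>'" and R: "is_subring R" "polys_over M \<subseteq> R"
    and incl: "\<And>f g. f \<in> R \<Longrightarrow> g \<in> R \<Longrightarrow> \<rho> f \<le> \<rho> g \<Longrightarrow> \<rho>' f \<le> \<rho>' g"
  shows "order_equiv R \<rho> \<rho>'"
  unfolding order_equiv_def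
proof (intro ballI iffI)
  fix f g assume f: "f \<in> R" and g: "g \<in> R" and le: "\<rho>' f \<le> \<rho>' g"
  note t = \<rho>(2)[unfolded trivial_support_def, rule_format]
  note t' = \<rho>'(2)[unfolded trivial_support_def, rule_format]
  note Mp = is_subring_polys_over[OF is_subfield_subring, of M]
  show "\<rho> f \<le> \<rho> g"
  proof (cases "g = 0")
    case True then show ?thesis using trivial_support_zero[OF \<rho>(2)] by simp
  next
    case False
    then have "\<rho>' g \<noteq> Infty" using t' by simp
    then have "f \<noteq> 0" using le trivial_support_zero[OF \<rho>'(2)] by auto
    obtain k c d where 1: "k > 0" "c \<in> polys_over M" "d \<in> polys_over M" "c \<noteq> 0" "d \<noteq> 0" "\<rho> (c * f ^ k) = \<rho> d"
      using val_poly_algebraic[OF M \<rho> \<open>f \<noteq> 0\<close>] by (elim exE bexE conjE) (rule that)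
    obtain l c' d' where 2: "l > 0" "c' \<in> polys_over M" "d' \<in> polys_over M" "c' \<noteq> 0" "d' \<noteq> 0" "\<rho> (c' * g ^ l) = \<rho> d'"
      using val_poly_algebraic[OF M \<rho> False] by (elim exE bexE conjE) (rule that)
    have in1: "c * f ^ k \<in> R" "d \<in> R" "c' * g ^ l \<in> R" "d' \<in> R"
      using 1 2 R f g by (auto intro!: is_subringD(4)[OF R(1)] subring_power[OF R(1)])
    \<comment> \<open>Equality is two inequalities, so the one-sided hypothesis transfers
      it.\<close>
    have 3: "\<rho>' (c * f ^ k) = \<rho>' d" "\<rho>' (c' * g ^ l) = \<rho>' d'"
      using incl[OF in1(1,2)] incl[OF in1(2,1)] incl[OF in1(3,4)] incl[OF in1(4,3)] 1(6) 2(6) by auto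
    have Mr: "is_subring (polys_over M)" using Mp M by (simp add: is_algebraic_closure_of_def)
    have "d ^ l * c' ^ k \<in> polys_over M" "c ^ l * d' ^ k \<in> polys_over M"
      using 1 2 by (auto intro: is_subringD(4)[OF Mr] subring_power[OF Mr])
    then show ?thesis
      using val_le_iff_algebraic[OF \<rho>(1) 1(1) 2(1) _ _ 1(6) 2(6)] le
        val_le_iff_algebraic[OF \<rho>'(1) 1(1) 2(1) _ _ 3] t t' 1(4) 2(4) order_equivD(1)[OF oe] by auto
  qed
qed (use incl in blast)

section \<open>Separation by a fraction, and conjugacy over one adjoined element\<close>

lemma finite_at_most_one:
  assumes "\<And>k k' :: nat. P k \<Longrightarrow> P k' \<Longrightarrow> k < k' \<Longrightarrow> False"
  shows "finite {k. P k}"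
proof (cases "\<exists>k. P k")
  case True
  then obtain k where "P k" by auto
  then have "{k. P k} \<subseteq> {k}" using assms by (metis (no_types) linorder_neqE_nat mem_Collect_eq singletonI subsetI)
  then show ?thesis using finite_subset by blast
qed simp

text \<open>
  Prime avoidance for valuations, stated for fractions \<open>P/Q\<close> so that one can stay inside a ring: a further
  \<open>P2/Q2\<close> is absorbed by passing to \<open>(P/Q)^k + P2/Q2\<close>, where \<open>k\<close> avoids the finitely many cancellations.
\<close>

lemma separating_fraction:
  fixes R :: "'r::comm_ring_1 set" and \<rho>' :: "'r \<Rightarrow> 'g::linordered_ab_group_add with_infty"
    and W :: "('r \<Rightarrow> 'g with_infty) set"
  assumes R: "is_subring R" and "finite W"
    and W: "\<And>u. u \<in> W \<Longrightarrow> val_on R u" "\<And>u. u \<in> W \<Longrightarrow> trivial_support u"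
    and \<rho>': "val_on R \<rho>'" "trivial_support \<rho>'"
    and sep: "\<And>u. u \<in> W \<Longrightarrow> \<exists>P\<in>R. \<exists>Q\<in>R. \<rho>' Q < \<rho>' P \<and> u P < u Q"
  shows "\<exists>P\<in>R. \<exists>Q\<in>R. \<rho>' Q < \<rho>' P \<and> (\<forall>u\<in>W. u P < u Q)"
  using assms(2) W sep
proof (induction W)
  case empty
  show ?case using is_subringD(1,2)[OF R] val_onD(1,2)[OF \<rho>'(1)] by (intro bexI[of _ 0] bexI[of _ 1]) auto
next
  case (insert u2 W)
  obtain P Q where PQ: "P \<in> R" "Q \<in> R" "\<rho>' Q < \<rho>' P" "\<And>u. u \<in> W \<Longrightarrow> u P < u Q"
    using insert.IH insert.prems by (metis insertI2)
  obtain P2 Q2 where PQ2: "P2 \<in> R" "Q2 \<in> R" "\<rho>' Q2 < \<rho>' P2" "u2 P2 < u2 Q2"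
    using insert.prems(3)[of u2] by auto
  have vR: "val_on R u" "u Q \<noteq> Infty" "u Q2 \<noteq> Infty" "\<rho>' Q \<noteq> Infty" "\<rho>' Q2 \<noteq> Infty" if "u \<in> insert u2 W" for u
  proof -
    have "Q \<noteq> 0" "Q2 \<noteq> 0" using PQ(3) PQ2(3) trivial_support_zero[OF \<rho>'(2)] by auto
    then show "val_on R u" "u Q \<noteq> Infty" "u Q2 \<noteq> Infty" "\<rho>' Q \<noteq> Infty" "\<rho>' Q2 \<noteq> Infty"
      using insert.prems(1,2)[OF that] \<rho>'(2) by (auto simp: trivial_support_def)
  qed
  show ?case
  proof (cases "u2 P < u2 Q")
    case True
    then show ?thesis using PQ by blast
  next
    case False
    \<comment> \<open>A bad k makes the two summands of the new numerator tie for \<open>u\<close>.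
      As u(P) < u(Q), the two sides drift apart strictly when k grows, so each \<open>u\<close> in
      \<open>W\<close> has at most one bad k. The exponent 0 is avoided too, to keep (P/Q)^k
      strictly negative.\<close>
    define bad where "bad u k \<longleftrightarrow> nmul k (u P) + u Q2 = u P2 + nmul k (u Q)" for u :: "'r \<Rightarrow> 'g with_infty" and k
    have "finite {k. bad u k}" if u: "u \<in> W" for u
    proof (rule finite_at_most_one)
      fix k k' assume b: "bad u k" "bad u k'" "k < k'"
      then obtain m where m: "k' = m + k" "m > 0" by (metis less_imp_add_positive add.commute)
      have "u P \<noteq> Infty" using PQ(4)[OF u] by auto
      then have fin: "nmul k (u P) + u Q2 \<noteq> Infty" using vR[of u] u by (auto simp: nmul_Infty)
      have "nmul m (u P) + (nmul k (u P) + u Q2) = nmul m (u Q) + (u P2 + nmul k (u Q))"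
        using b(2) unfolding bad_def m nmul_plus by (simp add: ac_simps)
      then have "nmul m (u P) = nmul m (u Q)"
        using b(1) with_infty_add_cancel(5)[OF fin] by (simp add: bad_def)
      then show False using nmul_cancel(2)[OF m(2), of "u P" "u Q"] PQ(4)[OF u] by simp
    qed
    then have "finite (insert 0 (\<Union>u\<in>W. {k. bad u k}))" using insert.hyps(1) by blast
    then obtain k where k: "k \<notin> insert 0 (\<Union>u\<in>W. {k. bad u k})" using ex_new_if_finite infinite_UNIV_nat by blast
    define P3 where "P3 = P ^ k * Q2 + P2 * Q ^ k"
    define Q3 where "Q3 = Q ^ k * Q2"
    note S = is_subringD[OF R] subring_power[OF R]
    have mem: "P ^ k * Q2 \<in> R" "P2 * Q ^ k \<in> R" "P3 \<in> R" "Q3 \<in> R"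
      unfolding P3_def Q3_def by (auto intro!: S PQ PQ2)
    have ev: "u (P ^ k * Q2) = nmul k (u P) + u Q2" "u (P2 * Q ^ k) = u P2 + nmul k (u Q)" 
       "u Q3 = nmul k (u Q) + u Q2" if "val_on R u" for u :: "'r \<Rightarrow> 'g with_infty"
      unfolding Q3_def using val_onD(3)[OF that] val_power[OF R that] PQ PQ2 S by auto
    have k0: "k > 0" using k by simp
    have "\<rho>' Q3 < \<rho>' P3"
    proof -
      have "\<rho>' Q3 < \<rho>' (P ^ k * Q2)" 
        unfolding ev[OF \<rho>'(1)] using nmul_strict_mono[OF PQ(3) k0] vR(5)[of u2] by (simp add: with_infty_add_cancel)
      moreover have "\<rho>' Q3 < \<rho>' (P2 * Q ^ k)"
        unfolding ev[OF \<rho>'(1)] using PQ2(3) vR(4)[of u2] by (simp add: add.commute[of "\<rho>' P2"] with_infty_add_cancel nmul_Infty)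
      ultimately show ?thesis
        unfolding P3_def using val_onD(4)[OF \<rho>'(1) mem(1,2)] by (meson less_le_trans min_less_iff_conj)
    qed
    moreover have "u P3 < u Q3" if u: "u \<in> W" for u
    proof -
      have v: "val_on R u" using vR u by auto
      have "u (P ^ k * Q2) \<noteq> u (P2 * Q ^ k)" using k u unfolding ev[OF v] by (auto simp: bad_def)
      then have "u P3 \<le> u (P ^ k * Q2)"
        unfolding P3_def using val_add_eq[OF R v mem(1,2)] val_add_eq[OF R v mem(2,1)] 
        by (metis less_imp_le linorder_neqE order_refl)
      also have "\<dots> < u Q3"
        unfolding ev[OF v] using nmul_strict_mono[OF PQ(4)[OF u] k0] vR(3)[of u] u by (simp add: with_infty_add_cancel)
      finally show ?thesis .
    qed
    \<comment> \<open>No tie can occur here: for \<open>u2\<close> the fraction (P/Q)^k has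
      nonnegative value, while P2/Q2 has negative value.\<close>
    moreover have "u2 P3 < u2 Q3"
    proof -
      have v: "val_on R u2" using vR by auto
      have f: "nmul k (u2 Q) \<noteq> Infty" using vR(2)[of u2] by (simp add: nmul_Infty)
      have 1: "u2 (P2 * Q ^ k) < u2 Q3" 
        unfolding ev[OF v] add.commute[of "u2 P2"] using PQ2(4) f by (simp add: with_infty_add_cancel)
      also have "\<dots> \<le> u2 (P ^ k * Q2)" unfolding ev[OF v]
        using nmul_mono[of "u2 Q" "u2 P" k] False by (intro add_mono) auto
      finally show ?thesis unfolding P3_def using val_add_eq(2)[OF R v mem(2,1)] 1 by simp
    qed
    ultimately show ?thesis using mem by blast
  qed
qed

text \<open>
  Otherwise some \<open>P/Q\<close> has positive value for \<open>\<rho>'\<close> and negative value for all conjugates of \<open>\<rho>\<close>. The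
  homogeneous equation of \<open>Q/P\<close> obtained from its norm has coefficients over \<open>M\<close>, where \<open>\<rho>\<close> and \<open>\<rho>'\<close> agree,
  and its leading term dominates strictly for \<open>\<rho>'\<close>.
\<close>

lemma conjugate_on_adjoin:
  fixes M :: "'a::alg_closed_field set" and \<rho> \<rho>' :: "'a poly \<Rightarrow> 'g::linordered_ab_group_add with_infty"
  assumes M: "is_algebraic_closure_of TYPE('a) M" 
    and \<rho>: "val_on UNIV \<rho>" "trivial_support \<rho>" and \<rho>': "val_on UNIV \<rho>'" "trivial_support \<rho>'"
    and oe: "order_equiv (polys_over M) \<rho> \<rho>'"
  shows "\<exists>\<sigma>\<in>auts M. order_equiv (polys_over (adjoin M a)) (\<lambda>f. \<rho> (map_poly \<sigma> f)) \<rho>'"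
proof (rule ccontr)
  assume neg: "\<not> ?thesis"
  have Mr: "is_subring M" using M is_subfield_subring by (auto simp: is_algebraic_closure_of_def)
  define R where "R = polys_over (adjoin M a)"
  have R: "is_subring R" "polys_over M \<subseteq> R"
    unfolding R_def using is_subring_polys_over[OF adjoin_subring(1)[OF Mr]] 
      polys_over_mono[OF adjoin_subring(2)[OF Mr]] by blast+
  define F where "F = (\<lambda>\<sigma>. \<sigma> a) ` auts M"
  have F: "finite F" unfolding F_def by (rule finite_orbit[OF M])
  \<comment> \<open>On M(a) an automorphism is determined by the image of \<open>a\<close>, so one
    representative per conjugate of \<open>a\<close> accounts for all conjugates of \<rho> on
    \<open>R\<close>.\<close>
  define s where "s b = (SOME \<sigma>. \<sigma> \<in> auts M \<and> \<sigma> a = b)" for b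
  have s: "s b \<in> auts M" "s b a = b" if "b \<in> F" for b
    using someI_ex[of "\<lambda>\<sigma>. \<sigma> \<in> auts M \<and> \<sigma> a = b"] that by (auto simp: s_def F_def)
  have same: "map_poly \<sigma> f = map_poly (s (\<sigma> a)) f" if \<sigma>: "\<sigma> \<in> auts M" and f: "f \<in> R" for \<sigma> f
  proof -
    have sF: "s (\<sigma> a) \<in> auts M" "s (\<sigma> a) a = \<sigma> a" using s[of "\<sigma> a"] \<sigma> by (auto simp: F_def)
    have "\<sigma> y = s (\<sigma> a) y" if y: "y \<in> adjoin M a" for y
    proof -
      obtain h where h: "h \<in> polys_over M" "y = poly h a" using y by (auto simp: adjoin_def)
      have "\<tau> y = poly h (\<tau> a)" if "\<tau> \<in> auts M" for \<tau>
        using poly_map_poly_aut[OF that, of h a] map_poly_aut_fixed[OF that h(1)] h(2) by simp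
      then show ?thesis using sF \<sigma> by metis
    qed
    then show ?thesis using f \<sigma> sF 
      by (intro poly_eqI) (auto simp: R_def polys_over_def coeff_map_poly auts_simps(4)[OF \<sigma>] auts_simps(4)[OF sF(1)])
  qed
  define W where "W = (\<lambda>b f. \<rho> (map_poly (s b) f)) ` F"
  have W: "val_on UNIV u" "trivial_support u" if u: "u \<in> W" for u
  proof -
    obtain b where b: "b \<in> F" "u = (\<lambda>f. \<rho> (map_poly (s b) f))" using u by (auto simp: W_def)
    show "val_on UNIV u" unfolding b(2) by (rule val_comp_aut[OF \<rho>(1) s(1)[OF b(1)]])
    show "trivial_support u" unfolding b(2) by (rule trivial_support_comp_aut[OF \<rho>(2) s(1)[OF b(1)]])
  qed
  have "\<exists>P\<in>R. \<exists>Q\<in>R. \<rho>' Q < \<rho>' P \<and> u P < u Q" if u: "u \<in> W" for u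
  proof -
    obtain b where b: "b \<in> F" "u = (\<lambda>f. \<rho> (map_poly (s b) f))" using u by (auto simp: W_def)
    have no: "\<not> order_equiv R u \<rho>'" using neg s(1)[OF b(1)] b(2) by (auto simp: R_def)
    have oeM: "order_equiv (polys_over M) u \<rho>'"
      using oe b(2) map_poly_aut_fixed[OF s(1)[OF b(1)]] by (simp add: order_equiv_def)
    \<comment> \<open>One inclusion of the orderings would already give order equivalence, so each
      direction has a counterexample.\<close>
    obtain f g where fg: "f \<in> R" "g \<in> R" "u f \<le> u g" "\<not> \<rho>' f \<le> \<rho>' g"
      using order_equiv_of_inclusion[OF M W[OF u] \<rho>' oeM R] no by blast
    obtain f' g' where fg': "f' \<in> R" "g' \<in> R" "\<rho>' f' \<le> \<rho>' g'" "\<not> u f' \<le> u g'"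
      using order_equiv_of_inclusion[OF M \<rho>' W[OF u] order_equiv_sym[OF oeM] R] no order_equiv_sym by blast
    note v = val_onD(3)[OF W(1)[OF u] UNIV_I UNIV_I] val_onD(3)[OF \<rho>'(1) UNIV_I UNIV_I]
    note t = W(2)[OF u, unfolded trivial_support_def, rule_format] \<rho>'(2)[unfolded trivial_support_def, rule_format]
    note z = trivial_support_zero[OF W(2)[OF u]] trivial_support_zero[OF \<rho>'(2)]
    have g': "g' \<noteq> 0" using fg'(4) z by auto
    have f'0: "f' \<noteq> 0" using fg'(3) g' t(2)[of g'] z by auto
    have g0: "g \<noteq> 0" using fg(4) z by auto
    have f0: "f \<noteq> 0" using fg(3) g0 t(1)[of g] z by auto
    \<comment> \<open>The fraction is (f/g) (g'/f'). The first factor is positive for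
      \<open>\<rho>'\<close> and at most 0 for \<open>u\<close>; the second is at least 0 for
      \<open>\<rho>'\<close> and negative for \<open>u\<close>.\<close>
    have "\<rho>' (g * f') < \<rho>' (f * g')"
      unfolding v using fg(4) fg'(3) t f'0 by (intro with_infty_add_less_le(1)) (auto simp: not_le)
    moreover have "u (f * g') < u (g * f')"
      unfolding v using fg(3) fg'(4) t f0 by (intro with_infty_add_less_le(2)) (auto simp: not_le)
    ultimately show ?thesis using fg fg' is_subringD(4)[OF R(1)] by blast
  qed
  then obtain P Q where PQ: "P \<in> R" "Q \<in> R" "\<rho>' Q < \<rho>' P" "\<And>u. u \<in> W \<Longrightarrow> u P < u Q"
    using separating_fraction[OF R(1), of W \<rho>'] W F \<rho>' val_on_subset[OF _ subset_UNIV] 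
    unfolding W_def by (smt (verit) finite_imageI)
  have lt: "\<rho> (map_poly \<sigma> P) < \<rho> (map_poly \<sigma> Q)" if "\<sigma> \<in> auts M" for \<sigma>
    using PQ(4)[of "\<lambda>f. \<rho> (map_poly (s (\<sigma> a)) f)"] same[OF that PQ(1)] same[OF that PQ(2)] that
    by (simp add: W_def F_def)
  obtain xs where xs: "(P, Q) \<in> set xs" "set xs \<subseteq> (\<lambda>\<sigma>. (map_poly \<sigma> P, map_poly \<sigma> Q)) ` auts M"
     "\<And>j. coeff (linear_factors xs) j \<in> polys_over M"
    using norm_list[OF M, of P Q] by (elim exE conjE) blast
  define n where "n = length xs"
  define c where "c j = coeff (linear_factors xs) j" for j
  have lt': "\<rho> (fst x) < \<rho> (snd x)" if "x \<in> set xs" for x using lt xs(2) that by auto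
  have cn: "c n = prod_list (map fst xs)" by (simp add: c_def n_def linear_factors(2))
  \<comment> \<open>For \<rho> every conjugate of P has smaller value than that of Q, so the top
    coefficient has least value. All coefficients lie over \<open>M\<close>, so this passes to
    \<open>\<rho>'\<close>.\<close>
  have "\<rho> (c n) \<le> \<rho> (c j)" for j
    unfolding cn unfolding c_def using lt' by (intro linear_factors_coeff_val[OF \<rho>(1)]) (simp add: less_imp_le)
  then have le': "\<rho>' (c n) \<le> \<rho>' (c j)" for j
    using order_equivD(1)[OF oe] xs(3) by (simp add: c_def)
  have "fst x \<noteq> 0" if "x \<in> set xs" for x 
    using lt'[OF that] trivial_support_zero[OF \<rho>(2)] by auto
  then have "0 \<notin> fst ` set xs" by force
  then have cn0: "c n \<noteq> 0" unfolding cn by (simp add: prod_list_zero_iff)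
  have "hom_eval n (linear_factors xs) Q P = prod_list (map (\<lambda>x. fst x * Q - snd x * P) xs)"
    unfolding n_def by (rule linear_factors(3))
  also have "\<dots> = 0" using xs(1) by (auto simp: prod_list_zero_iff image_iff intro!: bexI[of _ "(P, Q)"])
  finally have sum0: "(\<Sum>j\<le>n. c j * Q ^ j * P ^ (n - j)) = 0" by (simp add: hom_eval_def c_def)
  note v = val_onD(3)[OF \<rho>'(1) UNIV_I UNIV_I] val_power[OF is_subring_UNIV \<rho>'(1) UNIV_I]
  note t = \<rho>'(2)[unfolded trivial_support_def, rule_format]
  have Qn: "Q \<noteq> 0" using PQ(3) trivial_support_zero[OF \<rho>'(2)] by auto
  have "\<rho>' (c n * Q ^ n) < \<rho>' (\<Sum>j<n. c j * Q ^ j * P ^ (n - j))"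
  proof (rule val_sum_gt[OF is_subring_UNIV \<rho>'(1)])
    fix j assume "j \<in> {..<n}"
    then have j: "j < n" by simp
    have "nmul n (\<rho>' Q) = nmul j (\<rho>' Q) + nmul (n - j) (\<rho>' Q)"
      using j by (simp flip: nmul_plus)
    also have "\<dots> < nmul j (\<rho>' Q) + nmul (n - j) (\<rho>' P)"
      using j PQ(3) t Qn nmul_strict_mono[OF PQ(3), of "n - j"] by (simp add: with_infty_add_cancel nmul_Infty)
    finally have "nmul n (\<rho>' Q) + \<rho>' (c n) < (nmul j (\<rho>' Q) + nmul (n - j) (\<rho>' P)) + \<rho>' (c j)"
      by (rule with_infty_add_less_le(1)) (use le' cn0 t in auto)
    then show "\<rho>' (c n * Q ^ n) < \<rho>' (c j * Q ^ j * P ^ (n - j))"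
      unfolding v by (simp add: ac_simps)
  qed (use cn0 Qn t in auto)
  then have "\<rho>' (c n * Q ^ n + (\<Sum>j<n. c j * Q ^ j * P ^ (n - j))) = \<rho>' (c n * Q ^ n)"
    by (rule val_add_eq(1)[OF is_subring_UNIV \<rho>'(1) UNIV_I UNIV_I])
  moreover have "c n * Q ^ n + (\<Sum>j<n. c j * Q ^ j * P ^ (n - j)) = 0"
    using sum0 by (simp add: lessThan_Suc_atMost[symmetric] add.commute)
  ultimately show False using cn0 Qn t val_onD(1)[OF \<rho>'(1)] by (metis mult_eq_0_iff power_not_zero)
qed

text \<open>Zorn's lemma runs over partial embeddings under which \<rho> on images and
  \<open>\<rho>'\<close> on arguments order polynomials alike. To reach a new element
  \<open>a\<close>, the embedding is extended to some automorphism \<tau>, the case of one adjoined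
  element is applied to \<rho> composed with \<tau>, and the resulting \<sigma> corrects \<tau>
  without moving the old domain.\<close>

theorem conjugate_trivial_support:
  fixes K :: "'a::alg_closed_field set" and \<rho> \<rho>' :: "'a poly \<Rightarrow> 'g::linordered_ab_group_add with_infty"
  assumes K: "is_algebraic_closure_of TYPE('a) K" 
    and \<rho>: "val_on UNIV \<rho>" "trivial_support \<rho>" and \<rho>': "val_on UNIV \<rho>'" "trivial_support \<rho>'"
    and oe: "order_equiv (polys_over K) \<rho> \<rho>'"
  shows "\<exists>\<sigma>\<in>auts K. order_equiv UNIV (\<lambda>f. \<rho> (map_poly \<sigma> f)) \<rho>'"
proof -
  define C where "C f f' h h' \<longleftrightarrow> (\<rho> f' \<le> \<rho> h' \<longleftrightarrow> \<rho>' f \<le> \<rho>' h)" for f f' h h'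
  have Kf: "is_subfield K" using K by (simp add: is_algebraic_closure_of_def)
  have g0: "ring_graph K (Id_on K)" 
    using is_subringD[OF is_subfield_subring[OF Kf]] by (auto simp: ring_graph_def single_valued_def)
  have pr: "poly_rel (Id_on K) f f' \<longleftrightarrow> f \<in> polys_over K \<and> f' = f" for f f'
    by (auto simp: poly_rel_def polys_over_def intro: poly_eqI)
  have C0: "\<forall>f f' h h'. poly_rel (Id_on K) f f' \<longrightarrow> poly_rel (Id_on K) h h' \<longrightarrow> C f f' h h'"
    using order_equivD(1)[OF oe] by (auto simp: pr C_def)
  have step: "\<exists>h. ring_graph K h \<and> (\<forall>f f' k k'. poly_rel h f f' \<longrightarrow> poly_rel h k k' \<longrightarrow> C f f' k k') \<and> g \<subseteq> h \<and> a \<in> Domain h"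
    if g: "ring_graph K g" "\<forall>f f' k k'. poly_rel g f f' \<longrightarrow> poly_rel g k k' \<longrightarrow> C f f' k k'" for g a
  proof -
    define M where "M = Domain g"
    note D = ring_graph_Domain[OF Kf g(1)]
    have M: "is_algebraic_closure_of TYPE('a) M" unfolding M_def by (rule algebraic_closure_mono[OF K D])
    obtain \<tau> where \<tau>: "\<tau> \<in> auts K" "\<And>x y. (x, y) \<in> g \<Longrightarrow> \<tau> x = y"
      using ring_graph_extends_to_aut[OF K g(1)] by blast
    have "poly_rel g f (map_poly \<tau> f)" if "f \<in> polys_over M" for f
      using that \<tau> by (auto simp: poly_rel_def polys_over_def M_def coeff_map_poly auts_simps(4)[OF \<tau>(1)]) 
    then have "order_equiv (polys_over M) (\<lambda>f. \<rho> (map_poly \<tau> f)) \<rho>'"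
      using g(2) by (auto simp: order_equiv_def C_def)
    from conjugate_on_adjoin[OF M val_comp_aut[OF \<rho>(1) \<tau>(1)] trivial_support_comp_aut[OF \<rho>(2) \<tau>(1)] \<rho>' this, of a]
    obtain \<sigma> where \<sigma>: "\<sigma> \<in> auts M" 
       "order_equiv (polys_over (adjoin M a)) (\<lambda>f. \<rho> (map_poly \<tau> (map_poly \<sigma> f))) \<rho>'" by auto
    have \<sigma>K: "\<sigma> \<in> auts K" using \<sigma>(1) auts_mono[OF D(2)] by (auto simp: M_def)
    define \<theta> where "\<theta> = \<tau> \<circ> \<sigma>"
    have \<theta>: "\<theta> \<in> auts K" unfolding \<theta>_def by (rule auts_comp[OF \<tau>(1) \<sigma>K])
    define h where "h = {(y, \<theta> y) | y. y \<in> adjoin M a}"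
    note A = adjoin_subring[OF D(1), of a, folded M_def]
    have "ring_graph K h"
      using is_subringD[OF A(1)] A(2) D(2) 
      by (auto simp: ring_graph_def single_valued_def h_def M_def subset_iff auts_simps[OF \<theta>])
    moreover have "C f f' k k'" if r: "poly_rel h f f'" "poly_rel h k k'" for f f' k k'
    proof -
      have "f \<in> polys_over (adjoin M a) \<and> f' = map_poly \<tau> (map_poly \<sigma> f)" if "poly_rel h f f'" for f f'
        using that unfolding map_poly_aut_comp[OF \<sigma>K \<tau>(1), symmetric] \<theta>_def[symmetric]
        by (auto simp: poly_rel_def h_def polys_over_def coeff_map_poly auts_simps(4)[OF \<theta>] intro!: poly_eqI)
      then show ?thesis using order_equivD(1)[OF \<sigma>(2)] r unfolding C_def by blast
    qed
    moreover have "g \<subseteq> h"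
    proof
      fix z assume z: "z \<in> g"
      obtain x y where xy: "z = (x, y)" by (cases z)
      then have "x \<in> M" using z by (auto simp: M_def)
      then have "\<theta> x = y" using \<tau>(2)[of x y] auts_simps(3)[OF \<sigma>(1)] z xy by (simp add: \<theta>_def)
      then show "z \<in> h" using \<open>x \<in> M\<close> A(2) xy by (auto simp: h_def)
    qed
    moreover have "a \<in> Domain h" using A(3) by (auto simp: h_def)
    ultimately show ?thesis by blast
  qed
  from ring_graph_extend_aut[OF K g0 C0 step]
  obtain \<sigma> where "\<sigma> \<in> auts K" "\<forall>f h. C f (map_poly \<sigma> f) h (map_poly \<sigma> h)" by blast
  then show ?thesis by (auto simp: order_equiv_def C_def)
qed


section \<open>Gauss valuations and conjugacy in general\<close>

text \<open>The Gauss valuation giving x the value \<delta>.\<close>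

definition gauss :: "('a::field \<Rightarrow> 'g::linordered_ab_group_add with_infty) \<Rightarrow> 'g with_infty \<Rightarrow> 'a poly \<Rightarrow> 'g with_infty" where
  "gauss w \<delta> f = Min ((\<lambda>i. w (coeff f i) + nmul i \<delta>) ` {..degree f})"

lemma is_subfield_UNIV: "is_subfield UNIV"
  by (simp add: is_subfield_def)

lemma with_infty_add_surj:
  fixes c t :: "'g::linordered_ab_group_add with_infty"
  assumes "c \<noteq> Infty"
  shows "\<exists>t'. t = t' + c"
proof (cases t)
  case (Fin x)
  obtain y where "c = Fin y" using assms by (cases c) auto
  then show ?thesis using Fin by (intro exI[of _ "Fin (x - y)"]) simp
qed (auto intro: exI[of _ Infty])

context
  fixes w :: "'a::field \<Rightarrow> 'g::linordered_ab_group_add with_infty" and \<delta> :: "'g with_infty"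
  assumes w: "val_on UNIV w" and \<delta>: "\<delta> \<noteq> Infty"
begin

lemma gauss_term_nonzero: "c \<noteq> 0 \<Longrightarrow> w c \<noteq> Infty"
  by (rule val_field_nonzero(1)[OF is_subfield_UNIV w UNIV_I])

lemma nmul_finite: "nmul i \<delta> \<noteq> Infty"
  using \<delta> by (simp add: nmul_Infty)

text \<open>Terms beyond the degree are infinite, so the degree drops out of the condition and
  polynomials of different degrees can be compared.\<close>

lemma gauss_ge: "t \<le> gauss w \<delta> f \<longleftrightarrow> (\<forall>i. t \<le> w (coeff f i) + nmul i \<delta>)"
proof -
  have "w (coeff f i) + nmul i \<delta> = Infty" if "i > degree f" for i
    using that by (simp add: coeff_eq_0 val_onD(1)[OF w])
  then have "(\<forall>i. t \<le> w (coeff f i) + nmul i \<delta>) \<longleftrightarrow> (\<forall>i\<le>degree f. t \<le> w (coeff f i) + nmul i \<delta>)"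
    by (metis not_le with_infty_le(1))
  then show ?thesis by (auto simp: gauss_def Min_ge_iff)
qed

lemma gauss_le: "gauss w \<delta> f \<le> w (coeff f i) + nmul i \<delta>"
  using gauss_ge[of "gauss w \<delta> f" f] by blast

lemma gauss_attained: "\<exists>i. gauss w \<delta> f = w (coeff f i) + nmul i \<delta>"
proof -
  have "gauss w \<delta> f \<in> (\<lambda>i. w (coeff f i) + nmul i \<delta>) ` {..degree f}"
    unfolding gauss_def by (rule Min_in) auto
  then show ?thesis by auto
qed

lemma gauss_trivial_support: "gauss w \<delta> f = Infty \<longleftrightarrow> f = 0"
proof
  assume "gauss w \<delta> f = Infty"
  then have "w (coeff f (degree f)) + nmul (degree f) \<delta> = Infty" 
    using gauss_le[of f "degree f"] by simp
  then show "f = 0" using gauss_term_nonzero[of "lead_coeff f"] nmul_finite by auto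
next
  assume "f = 0"
  then show "gauss w \<delta> f = Infty" by (simp add: gauss_def val_onD(1)[OF w])
qed

lemma gauss_const: "gauss w \<delta> [:c:] = w c"
  by (simp add: gauss_def)

lemma gauss_linear: "gauss w \<delta> [:b, 1:] = min (w b) \<delta>"
proof -
  have "{..Suc 0} = {0, Suc 0}" by auto
  then show ?thesis by (simp add: gauss_def val_onD(2)[OF w] min.commute)
qed

lemma gauss_least: "\<exists>i. gauss w \<delta> f = w (coeff f i) + nmul i \<delta> \<and> (\<forall>j<i. gauss w \<delta> f < w (coeff f j) + nmul j \<delta>)"
proof -
  let ?P = "\<lambda>i. gauss w \<delta> f = w (coeff f i) + nmul i \<delta>"
  define i where "i = (LEAST i. ?P i)"
  have "?P i" unfolding i_def using gauss_attained[of f] by (rule LeastI_ex)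
  moreover have "\<not> ?P j" if "j < i" for j using that not_less_Least unfolding i_def by blast
  ultimately show ?thesis using gauss_le[of f] by (metis le_neq_trans)
qed

text \<open>Gauss's lemma. At the sum of the smallest indices where the two minima are attained,
  exactly one product of coefficients has minimal value, so nothing cancels there.\<close>

lemma gauss_mult: "gauss w \<delta> (f * g) = gauss w \<delta> f + gauss w \<delta> g"
proof (cases "f = 0 \<or> g = 0")
  case True
  then show ?thesis using gauss_trivial_support[of 0] by auto
next
  case False
  note v = val_onD(3)[OF w UNIV_I UNIV_I]
  let ?F = "\<lambda>i. w (coeff f i) + nmul i \<delta>" and ?G = "\<lambda>i. w (coeff g i) + nmul i \<delta>"
  have tm: "w (coeff f i * coeff g (n - i)) + nmul n \<delta> = ?F i + ?G (n - i)" if "i \<le> n" for i n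
  proof -
    have "nmul n \<delta> = nmul i \<delta> + nmul (n - i) \<delta>" using that by (simp flip: nmul_plus)
    then show ?thesis by (simp add: v ac_simps)
  qed
  have "gauss w \<delta> f + gauss w \<delta> g \<le> gauss w \<delta> (f * g)"
    unfolding gauss_ge
  proof
    fix n
    obtain t where t: "gauss w \<delta> f + gauss w \<delta> g = t + nmul n \<delta>" 
      using with_infty_add_surj[OF nmul_finite] by blast
    have "t \<le> w (coeff f i * coeff g (n - i))" if "i \<le> n" for i
      using add_mono[OF gauss_le[of f i] gauss_le[of g "n - i"]] with_infty_add_cancel(1)[OF nmul_finite[of n]]
      unfolding t tm[OF that, symmetric] by blast
    then have "t \<le> w (coeff (f * g) n)"
      unfolding coeff_mult by (intro val_sum_ge[OF is_subring_UNIV w]) auto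
    then show "gauss w \<delta> f + gauss w \<delta> g \<le> w (coeff (f * g) n) + nmul n \<delta>"
      unfolding t by (rule add_right_mono)
  qed
  moreover have "gauss w \<delta> (f * g) \<le> gauss w \<delta> f + gauss w \<delta> g"
  proof -
    obtain i j where i: "gauss w \<delta> f = ?F i" "\<And>k. k < i \<Longrightarrow> gauss w \<delta> f < ?F k"
      and j: "gauss w \<delta> g = ?G j" "\<And>k. k < j \<Longrightarrow> gauss w \<delta> g < ?G k"
      using gauss_least[of f] gauss_least[of g] by blast
    define n where "n = i + j"
    have fin: "gauss w \<delta> f \<noteq> Infty" "gauss w \<delta> g \<noteq> Infty" using False gauss_trivial_support by auto
    let ?T = "w (coeff f i * coeff g (n - i))"
    have T: "?T + nmul n \<delta> = gauss w \<delta> f + gauss w \<delta> g"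
      using tm[of i n] i(1) j(1) by (simp add: n_def)
    then have Tfin: "?T \<noteq> Infty" using fin by (metis with_infty_plus_eq_Infty)
    have "?T < w (coeff f k * coeff g (n - k))" if k: "k \<le> n" "k \<noteq> i" for k
    proof -
      have "gauss w \<delta> f + gauss w \<delta> g < ?F k + ?G (n - k)"
      proof (cases "k < i")
        case True
        then show ?thesis using with_infty_add_less_le(1)[OF i(2) gauss_le fin(2)] by blast
      next
        case False
        then have "n - k < j" using k by (simp add: n_def)
        then show ?thesis using with_infty_add_less_le(2)[OF j(2) gauss_le fin(1)] by blast
      qed
      then show ?thesis
        unfolding T[symmetric] tm[OF k(1), symmetric] with_infty_add_cancel(3)[OF nmul_finite] .
    qed
    then have "?T < w (\<Sum>k\<in>{..n} - {i}. coeff f k * coeff g (n - k))"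
      using Tfin by (intro val_sum_gt[OF is_subring_UNIV w]) auto
    then have "w (coeff f i * coeff g (n - i) + (\<Sum>k\<in>{..n} - {i}. coeff f k * coeff g (n - k))) = ?T"
      by (rule val_add_eq(1)[OF is_subring_UNIV w UNIV_I UNIV_I])
    moreover have "coeff (f * g) n = coeff f i * coeff g (n - i) + (\<Sum>k\<in>{..n} - {i}. coeff f k * coeff g (n - k))"
      unfolding coeff_mult by (rule sum.remove) (auto simp: n_def)
    ultimately show ?thesis using gauss_le[of "f * g" n] T by simp
  qed
  ultimately show ?thesis by simp
qed

lemma gauss_val_on: "val_on UNIV (gauss w \<delta>)"
proof -
  have "min (gauss w \<delta> f) (gauss w \<delta> g) \<le> gauss w \<delta> (f + g)" for f g
    unfolding gauss_ge
  proof
    fix i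
    have "min (gauss w \<delta> f) (gauss w \<delta> g) \<le> min (w (coeff f i)) (w (coeff g i)) + nmul i \<delta>"
      using gauss_le[of f i] gauss_le[of g i] by (auto simp: min_def intro: order_trans)
    also have "\<dots> \<le> w (coeff (f + g) i) + nmul i \<delta>"
      using val_onD(4)[OF w] by (intro add_right_mono) simp
    finally show "min (gauss w \<delta> f) (gauss w \<delta> g) \<le> w (coeff (f + g) i) + nmul i \<delta>" .
  qed
  moreover have "gauss w \<delta> 0 = Infty" using gauss_trivial_support by simp
  moreover have "gauss w \<delta> 1 = 0" using gauss_const[of 1] val_onD(2)[OF w] by (simp add: one_pCons)
  ultimately show ?thesis by (auto simp: val_on_def gauss_mult)
qed

text \<open>The Gauss valuation in the variable x - a, that is, the valuation of the disc around
  \<open>a\<close> of radius \<delta>.\<close>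

definition disc_val :: "'a \<Rightarrow> 'a poly \<Rightarrow> 'g with_infty" where
  "disc_val a f = gauss w \<delta> (pcompose f [:a, 1:])"

lemma disc_val_on: "val_on UNIV (disc_val a)"
  using gauss_val_on by (auto simp: val_on_def disc_val_def pcompose_add pcompose_mult pcompose_1)

lemma disc_val_const: "disc_val a [:c:] = w c"
  by (simp add: disc_val_def gauss_const)

lemma disc_val_linear: "disc_val a [:- b, 1:] = min (w (a - b)) \<delta>"
  by (simp add: disc_val_def gauss_linear pcompose_pCons)

text \<open>In the expansion of \<open>f\<close> in powers of x - a, each term has for \<rho> at
  least the value used by \<open>disc_val\<close>. So the disc valuation is the least one with these
  constants and with x - a at \<delta> or above.\<close>

lemma disc_val_le:
  assumes \<rho>: "val_on UNIV \<rho>" "\<And>c. \<rho> [:c:] = w c" "\<delta> \<le> \<rho> [:- a, 1:]"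
  shows "disc_val a f \<le> \<rho> f"
proof -
  define h where "h = pcompose f [:a, 1:]"
  have "f = pcompose h [:- a, 1:]"
    unfolding h_def by (simp add: pcompose_assoc[symmetric] pcompose_pCons)
  also have "\<dots> = (\<Sum>i\<le>degree h. [:coeff h i:] * [:- a, 1:] ^ i)"
    unfolding pcompose_altdef poly_altdef
    by (simp add: coeff_map_poly degree_map_poly)
  finally have f: "f = (\<Sum>i\<le>degree h. [:coeff h i:] * [:- a, 1:] ^ i)" .
  have ge: "gauss w \<delta> h \<le> \<rho> ([:coeff h i:] * [:- a, 1:] ^ i)" for i
  proof -
    have "gauss w \<delta> h \<le> w (coeff h i) + nmul i \<delta>" by (rule gauss_le)
    also have "\<dots> \<le> w (coeff h i) + nmul i (\<rho> [:- a, 1:])"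
      by (intro add_left_mono nmul_mono \<rho>(3))
    also have "\<dots> = \<rho> ([:coeff h i:] * [:- a, 1:] ^ i)"
      by (simp only: val_onD(3)[OF \<rho>(1) UNIV_I UNIV_I] val_power[OF is_subring_UNIV \<rho>(1) UNIV_I] \<rho>(2))
    finally show ?thesis .
  qed
  have "gauss w \<delta> h \<le> \<rho> (\<Sum>i\<le>degree h. [:coeff h i:] * [:- a, 1:] ^ i)"
    by (rule val_sum_ge[OF is_subring_UNIV \<rho>(1) UNIV_I ge])
  then show ?thesis by (simp only: f[symmetric]) (simp only: disc_val_def h_def)
qed

end

text \<open>Gauss valuations have zero support, so the polynomial case applies to them, and
  constants recover \<open>w\<close>. With \<delta> = 0, comparing two Gauss values only compares
  coefficients; hence order equivalence on \<open>K\<close> passes to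
  \<open>polys_over K\<close>.\<close>

theorem conjugate_field:
  fixes K :: "'a::alg_closed_field set" and w w' :: "'a \<Rightarrow> 'g::linordered_ab_group_add with_infty"
  assumes K: "is_algebraic_closure_of TYPE('a) K" and w: "val_on UNIV w" "val_on UNIV w'"
    and oe: "order_equiv K w w'"
  shows "\<exists>\<sigma>\<in>auts K. order_equiv UNIV (\<lambda>a. w (\<sigma> a)) w'"
proof -
  have Kr: "is_subring K" using K is_subfield_subring by (auto simp: is_algebraic_closure_of_def)
  let ?g = "gauss w 0" and ?g' = "gauss w' 0"
  have le: "gauss u 0 f \<le> gauss u 0 h \<longleftrightarrow> (\<forall>j. \<exists>i. u (coeff f i) \<le> u (coeff h j))"
    if u: "val_on UNIV u" for u :: "'a \<Rightarrow> 'g with_infty" and f h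
  proof -
    have "gauss u 0 f \<le> t \<longleftrightarrow> (\<exists>i. u (coeff f i) \<le> t)" for t
      using gauss_attained[OF u, of 0 f] gauss_le[OF u, of 0 f] by (auto intro: order_trans)
    then show ?thesis using gauss_ge[OF u, of 0 "gauss u 0 f" h] by simp
  qed
  have "order_equiv (polys_over K) ?g ?g'"
    unfolding order_equiv_def le[OF w(1)] le[OF w(2)]
    using order_equivD(1)[OF oe] by (simp add: polys_over_def)
  moreover have "trivial_support ?g" "trivial_support ?g'"
    using gauss_trivial_support[OF w(1), of 0] gauss_trivial_support[OF w(2), of 0] 
    by (auto simp: trivial_support_def)
  ultimately obtain \<sigma> where \<sigma>: "\<sigma> \<in> auts K" "order_equiv UNIV (\<lambda>f. ?g (map_poly \<sigma> f)) ?g'"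
    using conjugate_trivial_support[OF K gauss_val_on[OF w(1), of 0] _ gauss_val_on[OF w(2), of 0]] by auto
  have "w (\<sigma> a) \<le> w (\<sigma> b) \<longleftrightarrow> w' a \<le> w' b" for a b
    using order_equivD(1)[OF \<sigma>(2), of "[:a:]" "[:b:]"]
    by (simp add: map_poly_aut(8)[OF \<sigma>(1)] gauss_const[OF w(1)] gauss_const[OF w(2)])
  then show ?thesis using \<sigma>(1) by (auto simp: order_equiv_def)
qed

text \<open>Some power of \<open>c\<close> has the value of an element of \<open>K\<close>, and by
  order equivalence it does so for both valuations; without torsion this determines the value of
  \<open>c\<close>.\<close>

lemma order_equiv_field_eq:
  fixes K :: "'a::alg_closed_field set" and w w' :: "'a \<Rightarrow> 'g::linordered_ab_group_add with_infty"
  assumes K: "is_algebraic_closure_of TYPE('a) K" and w: "val_on UNIV w" "val_on UNIV w'"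
    and oe: "order_equiv UNIV w w'" and eq: "\<And>k. k \<in> K \<Longrightarrow> w k = w' k"
  shows "w c = w' c"
proof (cases "c = 0")
  case True
  then show ?thesis using val_onD(1)[OF w(1)] val_onD(1)[OF w(2)] by simp
next
  case False
  have Kf: "is_subfield K" using K by (simp add: is_algebraic_closure_of_def)
  obtain p where p: "p \<in> polys_over K" "p \<noteq> 0" "poly p c = 0" 
    using K by (auto simp: is_algebraic_closure_of_def)
  have "w c \<noteq> Infty" using val_field_nonzero(1)[OF is_subfield_UNIV w(1) UNIV_I False] .
  from val_algebraic[OF Kf is_subring_UNIV subset_UNIV w(1) UNIV_I this p]
  obtain n k where n: "n > 0" "k \<in> K" "w (c ^ n) = w k" by auto
  then have "w' (c ^ n) = w' k" using order_equivD(3)[OF oe] by simp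
  then have "w' (c ^ n) = w (c ^ n)" using n eq by simp
  then have "nmul n (w' c) = nmul n (w c)" 
    using val_power[OF is_subring_UNIV w(1) UNIV_I] val_power[OF is_subring_UNIV w(2) UNIV_I] by simp
  then show ?thesis using nmul_cancel(2)[OF n(1)] by metis
qed

lemma val_constants:
  "val_on UNIV \<rho> \<Longrightarrow> val_on UNIV (\<lambda>c. \<rho> [:c:])"
proof -
  assume \<rho>: "val_on UNIV \<rho>"
  note v = val_onD[OF \<rho>]
  have "\<rho> [:a * b:] = \<rho> [:a:] + \<rho> [:b:]" "min (\<rho> [:a:]) (\<rho> [:b:]) \<le> \<rho> [:a + b:]" for a b
    using v(3)[of "[:a:]" "[:b:]"] v(4)[of "[:a:]" "[:b:]"] by (simp_all add: mult.commute)
  then show "val_on UNIV (\<lambda>c. \<rho> [:c:])"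
    using v(1,2) by (simp add: val_on_def one_pCons)
qed

text \<open>The support is prime and \<open>f\<close> splits, so the support contains some x -
  \<theta>. Modulo x - \<theta> a polynomial is its value at \<theta>, and adding an element of the
  support changes no value.\<close>

lemma nontrivial_support:
  fixes \<rho> :: "'a::alg_closed_field poly \<Rightarrow> 'g::linordered_ab_group_add with_infty"
  assumes \<rho>: "val_on UNIV \<rho>" and nt: "f \<noteq> 0" "\<rho> f = Infty"
  obtains \<theta> where "\<And>h. \<rho> h = \<rho> [:poly h \<theta>:]"
proof -
  note v = val_onD[OF \<rho>]
  have const: "\<rho> [:c:] \<noteq> Infty" if "c \<noteq> 0" for c
    using val_field_nonzero(1)[OF is_subfield_UNIV val_constants[OF \<rho>] UNIV_I that] .
  obtain A where A: "f = smult (lead_coeff f) (\<Prod>x\<in>#A. [:-x, 1:])"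
    using alg_closed_imp_factorization[OF nt(1)] by auto
  have "\<exists>x\<in>#A. \<rho> [:-x, 1:] = Infty" if "\<rho> (\<Prod>x\<in>#A. [:-x, 1:]) = Infty"
    using that by (induction A) (auto simp: v simp del: mult_pCons_left)
  moreover have "\<rho> f = \<rho> [:lead_coeff f:] + \<rho> (\<Prod>x\<in>#A. [:-x, 1:])"
    by (subst A) (simp flip: v(3))
  then have "\<rho> (\<Prod>x\<in>#A. [:-x, 1:]) = Infty" using nt const[of "lead_coeff f"] by (metis with_infty_plus_eq_Infty leading_coeff_0_iff)
  ultimately obtain \<theta> where \<theta>: "\<rho> [:- \<theta>, 1:] = Infty" by auto
  have "\<rho> h = \<rho> [:poly h \<theta>:]" for h
  proof -
    have "[:- \<theta>, 1:] dvd h - [:poly h \<theta>:]" by (simp add: poly_eq_0_iff_dvd[symmetric])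
    then obtain s where s: "h - [:poly h \<theta>:] = [:- \<theta>, 1:] * s" by auto
    then have i: "\<rho> (h - [:poly h \<theta>:]) = Infty" using v(3)[of "[:- \<theta>, 1:]" s] \<theta> by simp
    have "\<rho> h = \<rho> ((h - [:poly h \<theta>:]) + [:poly h \<theta>:])" by simp
    also have "\<dots> = \<rho> [:poly h \<theta>:]"
    proof (cases "\<rho> [:poly h \<theta>:] = Infty")
      case True
      then show ?thesis using v(4)[of "h - [:poly h \<theta>:]" "[:poly h \<theta>:]"] i by (simp add: min_def)
    next
      case False
      then have "\<rho> [:poly h \<theta>:] < \<rho> (h - [:poly h \<theta>:])" by (simp add: i)
      then show ?thesis by (rule val_add_eq(2)[OF is_subring_UNIV \<rho> UNIV_I UNIV_I])
    qed
    finally show ?thesis .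
  qed
  then show ?thesis using that by blast
qed

text \<open>The minimal polynomial of \<theta> lies in the support of both valuations, so the point
  \<open>\<theta>'\<close> of the second is one of its roots, hence conjugate to \<theta>.\<close>

lemma order_equiv_nontrivial_support:
  fixes K :: "'a::alg_closed_field set" and \<rho> \<rho>' :: "'a poly \<Rightarrow> 'g::linordered_ab_group_add with_infty"
  assumes K: "is_algebraic_closure_of TYPE('a) K" and \<rho>: "val_on UNIV \<rho>" "val_on UNIV \<rho>'"
    and oe: "order_equiv (polys_over K) \<rho> \<rho>'" and nt: "\<not> trivial_support \<rho>"
  obtains \<theta> \<theta>' \<tau> where "\<And>h. \<rho> h = \<rho> [:poly h \<theta>:]" "\<And>h. \<rho>' h = \<rho>' [:poly h \<theta>':]" "\<tau> \<in> auts K" "\<tau> \<theta>' = \<theta>"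
    "\<not> trivial_support \<rho>'"
proof -
  have Kf: "is_subfield K" using K by (simp add: is_algebraic_closure_of_def)
  obtain \<theta> where \<theta>: "\<And>h. \<rho> h = \<rho> [:poly h \<theta>:]"
    using nt nontrivial_support[OF \<rho>(1)] val_onD(1)[OF \<rho>(1)] unfolding trivial_support_def by metis
  obtain m where m: "is_minimal_poly K \<theta> m"
    using minimal_poly_exists[OF Kf] K unfolding is_algebraic_closure_of_def by metis
  have mK: "m \<in> polys_over K" "0 \<in> polys_over K" "m \<noteq> 0" "poly m \<theta> = 0"
    using m is_subringD(1)[OF is_subring_polys_over[OF is_subfield_subring[OF Kf]]]
    by (auto simp: is_minimal_poly_def)
  have "\<rho> m = \<rho> 0" using \<theta>[of m] mK(4) by simp
  then have "\<rho>' m = \<rho>' 0" using order_equivD(3)[OF oe mK(1,2)] by simp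
  then have m': "\<rho>' m = Infty" using val_onD(1)[OF \<rho>(2)] by simp
  obtain \<theta>' where \<theta>': "\<And>h. \<rho>' h = \<rho>' [:poly h \<theta>':]"
    by (rule nontrivial_support[OF \<rho>(2) mK(3) m']) (rule that)
  have "poly m \<theta>' = 0" 
    using val_field_nonzero(1)[OF is_subfield_UNIV val_constants[OF \<rho>(2)] UNIV_I, of "poly m \<theta>'"] \<theta>'[of m] m' by auto
  then obtain \<sigma> where \<sigma>: "\<sigma> \<in> auts K" "\<sigma> \<theta> = \<theta>'" using aut_to_conjugate[OF K m] by blast
  have "inv_into UNIV \<sigma> \<theta>' = \<theta>" using \<sigma> auts_simps(10)[OF \<sigma>(1)] by (metis bij_inv_eq_iff)
  moreover have "\<not> trivial_support \<rho>'" using m' mK(3) by (auto simp: trivial_support_def)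
  ultimately show ?thesis using that[OF \<theta> \<theta>' auts_inv[OF \<sigma>(1)]] by blast
qed

theorem conjugate_polynomial_valuations:
  fixes K :: "'a::alg_closed_field set" and \<rho> \<rho>' :: "'a poly \<Rightarrow> 'g::linordered_ab_group_add with_infty"
  assumes K: "is_algebraic_closure_of TYPE('a) K" and \<rho>: "val_on UNIV \<rho>" "val_on UNIV \<rho>'"
    and oe: "order_equiv (polys_over K) \<rho> \<rho>'"
  shows "\<exists>\<sigma>\<in>auts K. order_equiv UNIV (\<lambda>f. \<rho> (map_poly \<sigma> f)) \<rho>'"
proof (cases "trivial_support \<rho>")
  case True
  have "trivial_support \<rho>'"
  proof (rule ccontr)
    assume "\<not> ?thesis"
    then show False
      by (rule order_equiv_nontrivial_support[OF K \<rho>(2,1) order_equiv_sym[OF oe]]) (use True in blast)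
  qed
  then show ?thesis by (rule conjugate_trivial_support[OF K \<rho>(1) True \<rho>(2) _ oe])
next
  case False
  have Kr: "is_subring K" using K is_subfield_subring by (auto simp: is_algebraic_closure_of_def)
  obtain \<theta> \<theta>' \<tau> where \<theta>: "\<And>h. \<rho> h = \<rho> [:poly h \<theta>:]" and \<theta>': "\<And>h. \<rho>' h = \<rho>' [:poly h \<theta>':]" 
    and \<tau>: "\<tau> \<in> auts K" "\<tau> \<theta>' = \<theta>"
    by (rule order_equiv_nontrivial_support[OF K \<rho> oe False]) (rule that)
  \<comment> \<open>Field conjugacy is applied over \<open>K\<close> with \<open>\<theta>'\<close>
    adjoined, so that the correction \<open>\<sigma>1\<close> keeps \<open>\<theta>'\<close> in
    place and \<tau> still sends it to \<theta>.\<close>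
  define M where "M = adjoin K \<theta>'"
  note A = adjoin_subring[OF Kr, of \<theta>', folded M_def]
  have M: "is_algebraic_closure_of TYPE('a) M" by (rule algebraic_closure_mono[OF K A(1,2)])
  define w where "w c = \<rho> [:\<tau> c:]" for c
  define w' where "w' c = \<rho>' [:c:]" for c
  have w: "val_on UNIV w" "val_on UNIV w'"
    using val_constants[OF \<rho>(1)] val_constants[OF \<rho>(2)] 
    unfolding w_def w'_def val_on_def auts_simps(1,2,4,5)[OF \<tau>(1)] by blast+
  have "w (poly h \<theta>') = \<rho> h \<and> w' (poly h \<theta>') = \<rho>' h" if "h \<in> polys_over K" for h
    using \<theta>[of h] \<theta>'[of h] poly_map_poly_aut[OF \<tau>(1), of h \<theta>'] map_poly_aut_fixed[OF \<tau>(1) that] \<tau>(2)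
    by (simp add: w_def w'_def)
  then have "order_equiv M w w'"
    using order_equivD(1)[OF oe] by (auto simp: order_equiv_def M_def adjoin_def)
  then obtain \<sigma>1 where \<sigma>1: "\<sigma>1 \<in> auts M" "order_equiv UNIV (\<lambda>a. w (\<sigma>1 a)) w'"
    using conjugate_field[OF M w] by blast
  have \<sigma>1K: "\<sigma>1 \<in> auts K" using \<sigma>1(1) auts_mono[OF A(2)] by blast
  define \<sigma> where "\<sigma> = \<tau> \<circ> \<sigma>1"
  have \<sigma>: "\<sigma> \<in> auts K" unfolding \<sigma>_def by (rule auts_comp[OF \<tau>(1) \<sigma>1K])
  have "\<sigma> \<theta>' = \<theta>" using auts_simps(3)[OF \<sigma>1(1) A(3)] \<tau>(2) by (simp add: \<sigma>_def)
  then have "\<rho> (map_poly \<sigma> f) = w (\<sigma>1 (poly f \<theta>'))" for f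
    using \<theta>[of "map_poly \<sigma> f"] poly_map_poly_aut[OF \<sigma>, of f \<theta>'] by (simp add: w_def \<sigma>_def)
  moreover have "\<rho>' f = w' (poly f \<theta>')" for f using \<theta>'[of f] by (simp add: w'_def)
  ultimately have "order_equiv UNIV (\<lambda>f. \<rho> (map_poly \<sigma> f)) \<rho>'"
    using order_equivD(1)[OF \<sigma>1(2)] by (simp add: order_equiv_def)
  then show ?thesis using \<sigma> by blast
qed


section \<open>Chevalley's extension theorem for fields\<close>

definition algebraic_over :: "'f::field set \<Rightarrow> 'f \<Rightarrow> bool" where
  "algebraic_over E b \<longleftrightarrow> (\<exists>p\<in>polys_over E. p \<noteq> 0 \<and> poly p b = 0)"

definition valuation_ring :: "'f::field set \<Rightarrow> bool" where
  "valuation_ring V \<longleftrightarrow> is_subring V \<and> (\<forall>b. b \<noteq> 0 \<longrightarrow> b \<in> V \<or> inverse b \<in> V)"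

text \<open>The degree reduction in Chevalley's extension argument.\<close>

lemma chevalley_degree_reduction:
  fixes b m :: "'f::field"
  assumes V: "is_subring V" and m: "m \<in> V" "inverse m \<notin> V"
  shows "s \<in> polys_over V \<Longrightarrow> t \<in> polys_over V \<Longrightarrow> b \<noteq> 0 \<Longrightarrow> m * poly s b = 1 \<Longrightarrow> m * poly t (inverse b) = 1 \<Longrightarrow> False"
proof (induction "degree s + degree t" arbitrary: s t b rule: less_induct)
  case less
  note S = is_subringD[OF V] subring_power[OF V]
  note P = is_subringD[OF is_subring_polys_over[OF V]]
  have pos: "degree p > 0" if "p \<in> polys_over V" "m * poly p x = 1" for p x
  proof (rule ccontr)
    assume "\<not> degree p > 0"
    then obtain c where "p = [:c:]" by (auto elim: degree_eq_zeroE)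
    then have "inverse m = c" "c \<in> V" using that polys_over_coeff[of p V 0] by (auto intro: inverse_unique)
    then show False using m(2) by simp
  qed
  have main: False if d: "degree t \<le> degree s" and st: "s \<in> polys_over V" "t \<in> polys_over V" "b \<noteq> 0" 
      "m * poly s b = 1" "m * poly t (inverse b) = 1" 
      and IH: "\<And>s'. s' \<in> polys_over V \<Longrightarrow> degree s' < degree s \<Longrightarrow> m * poly s' b = 1 \<Longrightarrow> False" for s t and b :: 'f
  proof -
    define n where "n = degree s"
    define k where "k = degree t"
    define t0 where "t0 = coeff t 0"
    \<comment> \<open>Multiplying \<open>m * poly t (inverse b) = 1\<close> by b^k gives b^k = m
      (r(b) + t0 b^k), where \<open>r\<close> is the reversed \<open>t\<close> without its top
      term.\<close>
    define r where "r = reflect_poly t - monom t0 k"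
    define sl where "sl = s - monom (coeff s n) n"
    have k0: "k > 0" and n0: "n > 0" using pos st by (auto simp: k_def n_def)
    have mem: "t0 \<in> V" "coeff s n \<in> V" using st by (auto simp: t0_def polys_over_def)
    have rV: "r \<in> polys_over V"
      unfolding r_def using st S mem
      by (intro P polys_over_monom[OF V]) (auto simp: polys_over_def coeff_reflect_poly)
    have slV: "sl \<in> polys_over V"
      unfolding sl_def by (intro P polys_over_monom[OF V] st mem)
    have dr: "degree r < k"
    proof -
      have "degree r \<le> k - 1"
        by (rule degree_le) (auto simp: r_def coeff_reflect_poly k_def t0_def)
      then show ?thesis using k0 by simp
    qed
    have dsl: "degree sl < n"
    proof -
      have "degree sl \<le> n - 1"
        by (rule degree_le) (auto simp: sl_def n_def coeff_eq_0)
      then show ?thesis using n0 by simp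
    qed
    have bk: "b ^ k = m * (poly r b + t0 * b ^ k)"
    proof -
      have "poly (reflect_poly t) b = b ^ k * poly t (inverse b)"
        using poly_reflect_poly_nz[OF st(3), of t] by (simp add: k_def)
      then have "m * poly (reflect_poly t) b = b ^ k" using st(5) by (simp add: mult.left_commute)
      then show ?thesis by (simp add: r_def poly_monom)
    qed
    define e where "e = 1 - m * t0"
    have e: "b ^ k * e = m * poly r b" using bk by (simp add: e_def algebra_simps)
    have s: "m * (poly sl b + coeff s n * b ^ n) = 1"
      using st(4) by (simp add: sl_def poly_monom)
    have bn: "b ^ n = b ^ (n - k) * b ^ k" using d by (simp add: n_def k_def flip: power_add)
    \<comment> \<open>Multiply \<open>m * poly s b = 1\<close> by \<open>e\<close>, replace e b^k by
      m r(b), and add m t0. As e + m t0 = 1, the right side is 1 again, and the term of degree n is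
      gone.\<close>
    define s' where "s' = [:t0:] + [:e:] * sl + monom (coeff s n * m) (n - k) * r"
    have eV: "e \<in> V" unfolding e_def by (intro S m mem)
    have "s' \<in> polys_over V"
      unfolding s'_def by (intro P polys_over_const[OF V] polys_over_monom[OF V] S mem m rV slV eV)
    moreover have "degree s' < n"
    proof -
      have "degree (monom (coeff s n * m) (n - k) * r) \<le> (n - k) + degree r"
        using degree_mult_le[of "monom (coeff s n * m) (n - k)" r] degree_monom_le[of "coeff s n * m" "n - k"] by linarith
      also have "\<dots> < n" using dr d k0 by (simp add: n_def k_def)
      finally have 1: "degree (monom (coeff s n * m) (n - k) * r) < n" .
      have "degree ([:e:] * sl) \<le> degree sl" using degree_mult_le[of "[:e:]" sl] by simp
      then have 2: "degree ([:e:] * sl) < n" using dsl by linarith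
      show ?thesis unfolding s'_def using 1 2 n0 by (intro degree_add_less) auto
    qed
    moreover have "m * poly s' b = 1"
    proof -
      have "m * poly s' b = m * t0 + m * (e * poly sl b) + m * coeff s n * b ^ (n - k) * (m * poly r b)"
        by (simp add: s'_def poly_monom algebra_simps)
      also have "\<dots> = m * t0 + e * (m * (poly sl b + coeff s n * b ^ n))"
        unfolding e[symmetric] bn by (simp add: algebra_simps)
      also have "\<dots> = 1" unfolding s by (simp add: e_def)
      finally show ?thesis .
    qed
    ultimately show False using IH by (auto simp: n_def)
  qed
  \<comment> \<open>The situation is symmetric under exchanging \<open>s\<close> with
    \<open>t\<close> and \<open>b\<close> with its inverse.\<close>
  show False
  proof (cases "degree t \<le> degree s")
    case True
    show False
      by (rule main[OF True less.prems]) (use less.hyps less.prems in \<open>meson add_less_mono1\<close>)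
  next
    case False
    have "inverse b \<noteq> 0" "m * poly s (inverse (inverse b)) = 1" using less.prems by auto
    then show False
      using main[of s t "inverse b"] less.prems False less.hyps[of _ _ b] less.hyps
      by (smt (verit, best) add.commute add_less_mono1 inverse_inverse_eq le_cases)
  qed
qed

text \<open>Take a subring maximal among those that meet \<open>E\<close> exactly in the valuation
  ring of \<open>u\<close>. If it contains neither \<open>b\<close> nor its inverse, adjoining
  either one creates an element of \<open>E\<close> of negative value. The inverse \<open>m\<close>
  of that element satisfies a relation \<open>m * poly s b = 1\<close>, and the two relations
  together contradict \<open>chevalley_degree_reduction\<close>.\<close>

lemma chevalley_valuation_ring:
  fixes E :: "'f::field set" and u :: "'f \<Rightarrow> 'g::linordered_ab_group_add with_infty"
  assumes E: "is_subfield E" and u: "val_on E u"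
  shows "\<exists>V. valuation_ring V \<and> V \<inter> E = {e \<in> E. 0 \<le> u e}"
proof -
  define U where "U = {e \<in> E. 0 \<le> u e}"
  note Er = is_subfield_subring[OF E]
  have inv: "u (inverse e) + u e = 0" "u e \<noteq> Infty" if "e \<in> E" "e \<noteq> 0" for e
    using val_field_nonzero[OF E u that] by auto
  have UR: "is_subring U"
    unfolding is_subring_def
  proof (intro conjI ballI)
    show "0 \<in> U" "1 \<in> U" using is_subringD(1,2)[OF Er] val_onD(1,2)[OF u] by (auto simp: U_def)
  next
    fix a b assume "a \<in> U" "b \<in> U"
    then have a: "a \<in> E" "0 \<le> u a" and b: "b \<in> E" "0 \<le> u b" by (auto simp: U_def)
    show "a + b \<in> U" using val_onD(4)[OF u a(1) b(1)] a b is_subringD(3)[OF Er]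
      by (auto simp: U_def min_def split: if_splits)
    show "a * b \<in> U" using val_onD(3)[OF u a(1) b(1)] a b is_subringD(4)[OF Er]
      by (auto simp: U_def intro: add_nonneg_nonneg)
  next
    fix a assume "a \<in> U"
    then show "- a \<in> U" using val_minus[OF Er u] is_subringD(5)[OF Er] by (auto simp: U_def)
  qed
  define G where "G = {S. is_subring S \<and> S \<inter> E = U}"
  have "\<Union>c \<in> G" if c: "c \<noteq> {}" "subset.chain G c" for c
  proof -
    have cG: "\<And>S. S \<in> c \<Longrightarrow> is_subring S \<and> S \<inter> E = U" and ch: "\<And>S T. S \<in> c \<Longrightarrow> T \<in> c \<Longrightarrow> S \<subseteq> T \<or> T \<subseteq> S"
      using c(2) by (auto simp: subset_chain_def G_def)
    have two: "\<exists>S\<in>c. a \<in> S \<and> b \<in> S" if "a \<in> \<Union>c" "b \<in> \<Union>c" for a b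
      using that ch by blast
    have "is_subring (\<Union>c)"
      unfolding is_subring_def
    proof (intro conjI ballI)
      obtain S where "S \<in> c" using c(1) by blast
      then show "0 \<in> \<Union>c" "1 \<in> \<Union>c" using cG[of S] is_subringD(1,2)[of S] by auto
    next
      fix a b assume "a \<in> \<Union>c" "b \<in> \<Union>c"
      from two[OF this] obtain S where "S \<in> c" "a \<in> S" "b \<in> S" by blast
      then show "a + b \<in> \<Union>c" "a * b \<in> \<Union>c" using cG[of S] is_subringD(3,4)[of S a b] by auto
    next
      fix a assume "a \<in> \<Union>c"
      then obtain S where "S \<in> c" "a \<in> S" by blast
      then show "- a \<in> \<Union>c" using cG[of S] is_subringD(5)[of S a] by auto
    qed
    moreover have "\<Union>c \<inter> E = U" using c(1) cG by auto
    ultimately show ?thesis by (simp add: G_def)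
  qed
  moreover have "U \<in> G" using UR by (auto simp: G_def U_def)
  then have "G \<noteq> {}" by blast
  ultimately obtain V where VG: "V \<in> G" and max: "\<And>S. S \<in> G \<Longrightarrow> V \<subseteq> S \<Longrightarrow> S = V"
    using subset_Zorn_nonempty[of G] by blast
  have V: "is_subring V" "V \<inter> E = U" using VG by (auto simp: G_def)
  have bad: "\<exists>m\<in>E. m \<noteq> 0 \<and> 0 < u m \<and> (\<exists>s\<in>polys_over V. m * poly s b = 1)" if b: "b \<notin> V" for b
  proof -
    note A = adjoin_subring[OF V(1), of b]
    have "adjoin V b \<notin> G" using max[of "adjoin V b"] A b by blast
    then have "adjoin V b \<inter> E \<noteq> U" using A(1) by (simp add: G_def)
    moreover have "U \<subseteq> adjoin V b \<inter> E" using A(2) V(2) by blast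
    ultimately obtain e where e: "e \<in> adjoin V b" "e \<in> E" "e \<notin> U" by blast
    then have neg: "\<not> 0 \<le> u e" by (simp add: U_def)
    then have e0: "e \<noteq> 0" using val_onD(1)[OF u] by auto
    obtain s where s: "s \<in> polys_over V" "e = poly s b" using e(1) by (auto simp: adjoin_def)
    have "0 < u (inverse e)"
    proof (rule ccontr)
      assume "\<not> 0 < u (inverse e)"
      then have "u (inverse e) + u e \<le> 0 + u e" by (intro add_right_mono) simp
      then show False using inv(1)[OF e(2) e0] neg by simp
    qed
    moreover have "inverse e * poly s b = 1" "inverse e \<noteq> 0" using e0 s(2) by simp_all
    ultimately show ?thesis using s(1) is_subfield_inverse[OF E e(2)] by blast
  qed
  have "b \<in> V \<or> inverse b \<in> V" if b: "b \<noteq> 0" for b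
  proof (rule ccontr)
    assume "\<not> ?thesis"
    then have nb: "b \<notin> V" "inverse b \<notin> V" by auto
    obtain m s where m: "m \<in> E" "m \<noteq> 0" "0 < u m" "s \<in> polys_over V" "m * poly s b = 1"
      using bad[OF nb(1)] by (elim bexE conjE) (rule that)
    obtain m' t where m': "m' \<in> E" "m' \<noteq> 0" "0 < u m'" "t \<in> polys_over V" "m' * poly t (inverse b) = 1"
      using bad[OF nb(2)] by (elim bexE conjE) (rule that)
    have U1: "x \<in> V" "inverse x \<notin> V" if "x \<in> E" "0 < u x" "x \<noteq> 0" for x
    proof -
      have "x \<in> U" using that by (simp add: U_def)
      then show "x \<in> V" using V(2) by blast
      have "u (inverse x) < 0"
      proof (rule ccontr)
        assume "\<not> u (inverse x) < 0"
        then have "0 + u x \<le> u (inverse x) + u x" by (intro add_right_mono) simp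
        then show False using inv(1)[OF that(1,3)] that(2) by simp
      qed
      then have "inverse x \<notin> U" by (auto simp: U_def)
      then show "inverse x \<notin> V" using V(2) is_subfield_inverse[OF E that(1)] by blast
    qed
    have scale: "y * inverse x \<in> V" if "x \<in> E" "y \<in> E" "x \<noteq> 0" "u x \<le> u y" for x y
    proof -
      have "u (inverse x) + u x \<le> u (inverse x) + u y" using that by (intro add_left_mono)
      also have "\<dots> = u (y * inverse x)" 
        using val_onD(3)[OF u that(2) is_subfield_inverse[OF E that(1)]] by (simp add: add.commute)
      finally have "y * inverse x \<in> U"
        using inv(1)[OF that(1,3)] that is_subfield_inverse[OF E] is_subringD(4)[OF Er] by (simp add: U_def)
      then show ?thesis using V(2) by blast
    qed
    note P = is_subringD(4)[OF is_subring_polys_over[OF V(1)] polys_over_const[OF V(1)]]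
    show False
    \<comment> \<open>Both relations must use the same multiplier. The one of smaller value is kept,
      and the other polynomial absorbs the quotient, which has nonnegative value and so lies in
      \<open>V\<close>.\<close>
    proof (cases "u m \<le> u m'")
      case True
      have "m * poly ([:m' * inverse m:] * t) (inverse b) = 1" using m(2) m'(5) by (simp add: field_simps)
      then show False
        using chevalley_degree_reduction[OF V(1) U1[OF m(1,3,2)] m(4) _ b m(5)] 
          P[OF scale[OF m(1) m'(1) m(2) True] m'(4)] by blast
    next
      case False
      then have le: "u m' \<le> u m" by simp
      have "m' * poly ([:m * inverse m':] * s) b = 1" using m'(2) m(5) by (simp add: field_simps)
      then show False
        using chevalley_degree_reduction[OF V(1) U1[OF m'(1,3,2)] _ m'(4) b _ m'(5)] 
          P[OF scale[OF m'(1) m(1) m'(2) le] m(4)] by blast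
    qed
  qed
  then show ?thesis using V by (auto simp: valuation_ring_def U_def)
qed

section \<open>The valuation attached to a valuation ring\<close>

context
  fixes E V :: "'f::field set" and u :: "'f \<Rightarrow> 'g::linordered_ab_group_add with_infty"
  assumes E: "is_subfield E" and u: "val_on E u"
    and V: "valuation_ring V" "V \<inter> E = {e \<in> E. 0 \<le> u e}"
begin

lemma V_subring: "is_subring V" and V_total: "b \<noteq> 0 \<Longrightarrow> b \<in> V \<or> inverse b \<in> V"
  using V by (auto simp: valuation_ring_def)

definition vunit :: "'f \<Rightarrow> bool" where
  "vunit x \<longleftrightarrow> x \<noteq> 0 \<and> x \<in> V \<and> inverse x \<in> V"

lemma vunit_mult: "vunit x \<Longrightarrow> vunit y \<Longrightarrow> vunit (x * y)"
  using is_subringD(4)[OF V_subring] by (auto simp: vunit_def)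

lemma vunit_inverse: "vunit x \<Longrightarrow> vunit (inverse x)"
  by (auto simp: vunit_def)

lemma vunit_power: "vunit x \<Longrightarrow> vunit (x ^ n)"
  using subring_power[OF V_subring] by (auto simp: vunit_def simp flip: power_inverse)

text \<open>Instead of forming the value group of \<open>V\<close> as a quotient, the value is read
  off from \<open>E\<close>: a power of \<open>b\<close> that agrees with some \<open>e\<close> up
  to a unit of \<open>V\<close> determines it after division by \<open>n\<close>. The lemma
  \<open>has_value_unique\<close> makes this sound.\<close>

definition has_value :: "'f \<Rightarrow> 'g \<Rightarrow> bool" where
  "has_value b \<gamma> \<longleftrightarrow> (\<exists>n>0. \<exists>e\<in>E. e \<noteq> 0 \<and> u e = Fin (nmul n \<gamma>) \<and> vunit (b ^ n * inverse e))"

text \<open>A suitable power of b/c differs by a unit from a quotient of elements of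
  \<open>E\<close>, and for these membership in \<open>V\<close> is the sign of
  \<open>u\<close>.\<close>

lemma has_value_mono:
  assumes "has_value b \<gamma>" "has_value c \<gamma>'" "b * inverse c \<in> V"
  shows "\<gamma>' \<le> \<gamma>"
proof -
  obtain n e where 1: "n > 0" "e \<in> E" "e \<noteq> 0" "u e = Fin (nmul n \<gamma>)" "vunit (b ^ n * inverse e)"
    using assms(1) by (auto simp: has_value_def)
  obtain m d where 2: "m > 0" "d \<in> E" "d \<noteq> 0" "u d = Fin (nmul m \<gamma>')" "vunit (c ^ m * inverse d)"
    using assms(2) by (auto simp: has_value_def)
  have nz: "b \<noteq> 0" "c \<noteq> 0" using 1 2 by (auto simp: vunit_def)
  note Er = is_subfield_subring[OF E]
  have "e ^ m * inverse (d ^ n) = 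
     (b * inverse c) ^ (n * m) * (inverse (b ^ n * inverse e) ^ m * (c ^ m * inverse d) ^ n)"
  proof -
    have gen: "X * Y = B * inverse C * (inverse B * X * (C * Y))" if "B \<noteq> 0" "C \<noteq> 0" for B C X Y :: 'f
      using that by (simp add: field_simps)
    have "(b * inverse c) ^ (n * m) = b ^ (n * m) * inverse (c ^ (n * m))"
      by (simp add: power_mult_distrib power_inverse)
    moreover have "inverse (b ^ n * inverse e) ^ m = inverse (b ^ (n * m)) * e ^ m"
      by (simp add: power_mult_distrib power_inverse power_mult)
    moreover have "(c ^ m * inverse d) ^ n = c ^ (n * m) * inverse (d ^ n)"
      unfolding mult.commute[of n m] by (simp add: power_mult_distrib power_inverse power_mult)
    moreover have "e ^ m * inverse (d ^ n) = b ^ (n * m) * inverse (c ^ (n * m)) * 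
        (inverse (b ^ (n * m)) * e ^ m * (c ^ (n * m) * inverse (d ^ n)))"
      by (rule gen) (use nz in simp_all)
    ultimately show ?thesis by (simp only:)
  qed
  also have "\<dots> \<in> V"
  proof -
    have "inverse (b ^ n * inverse e) ^ m \<in> V" "(c ^ m * inverse d) ^ n \<in> V"
      using vunit_power[OF vunit_inverse[OF 1(5)], of m] vunit_power[OF 2(5), of n] by (simp_all only: vunit_def)
    then show ?thesis
      by (rule is_subringD(4)[OF V_subring subring_power[OF V_subring assms(3)] is_subringD(4)[OF V_subring]])
  qed
  finally have "e ^ m * inverse (d ^ n) \<in> V" .
  moreover have E1: "e ^ m \<in> E" "d ^ n \<in> E" using 1 2 subring_power[OF Er] by auto
  moreover have E2: "inverse (d ^ n) \<in> E" using is_subfield_inverse[OF E E1(2)] .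
  ultimately have "0 \<le> u (e ^ m * inverse (d ^ n))" using V(2) is_subringD(4)[OF Er] by blast
  then have "0 + u (d ^ n) \<le> u (e ^ m * inverse (d ^ n)) + u (d ^ n)" by (rule add_right_mono)
  also have "\<dots> = u (e ^ m)"
    using val_onD(3)[OF u E1(1) E2] val_field_nonzero(2)[OF E u E1(2)] 2(3) by (simp add: add.assoc)
  finally have "nmul n (u d) \<le> nmul m (u e)" using val_power[OF Er u] 1 2 by simp
  then have "nmul (n * m) \<gamma>' \<le> nmul (n * m) \<gamma>"
    using 1(4) 2(4) by (simp add: nmul_Fin nmul_mult[symmetric] mult.commute)
  then show ?thesis using nmul_cancel_group(1)[of "n * m" \<gamma>' \<gamma>] 1 2 by simp
qed

lemma has_value_nonzero: "has_value b \<gamma> \<Longrightarrow> b \<noteq> 0"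
  by (auto simp: has_value_def vunit_def)

lemma has_value_unique: "has_value b \<gamma> \<Longrightarrow> has_value b \<gamma>' \<Longrightarrow> \<gamma> = \<gamma>'"
  using has_value_mono[of b \<gamma> b \<gamma>'] has_value_mono[of b \<gamma>' b \<gamma>] has_value_nonzero[of b \<gamma>] 
    is_subringD(2)[OF V_subring] by auto

lemma has_value_mult:
  assumes "has_value b \<gamma>" "has_value c \<gamma>'"
  shows "has_value (b * c) (\<gamma> + \<gamma>')"
proof -
  obtain n e where 1: "n > 0" "e \<in> E" "e \<noteq> 0" "u e = Fin (nmul n \<gamma>)" "vunit (b ^ n * inverse e)"
    using assms(1) by (auto simp: has_value_def)
  obtain m d where 2: "m > 0" "d \<in> E" "d \<noteq> 0" "u d = Fin (nmul m \<gamma>')" "vunit (c ^ m * inverse d)"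
    using assms(2) by (auto simp: has_value_def)
  note Er = is_subfield_subring[OF E]
  have "u (e ^ m * d ^ n) = nmul m (u e) + nmul n (u d)"
    using val_onD(3)[OF u] val_power[OF Er u] subring_power[OF Er] 1 2 by simp
  also have "\<dots> = Fin (nmul (n * m) (\<gamma> + \<gamma>'))"
    using 1(4) 2(4) by (simp add: nmul_Fin nmul_add nmul_mult[symmetric] mult.commute)
  finally have 3: "u (e ^ m * d ^ n) = Fin (nmul (n * m) (\<gamma> + \<gamma>'))" .
  have "(b * c) ^ (n * m) * inverse (e ^ m * d ^ n) = (b ^ n * inverse e) ^ m * (c ^ m * inverse d) ^ n"
  proof -
    have "(b ^ n * inverse e) ^ m = b ^ (n * m) * inverse (e ^ m)"
      by (simp add: power_mult_distrib power_inverse power_mult)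
    moreover have "(c ^ m * inverse d) ^ n = c ^ (n * m) * inverse (d ^ n)"
      unfolding mult.commute[of n m] by (simp add: power_mult_distrib power_inverse power_mult)
    ultimately show ?thesis by (simp only: power_mult_distrib inverse_mult_distrib mult_ac)
  qed
  then have "vunit ((b * c) ^ (n * m) * inverse (e ^ m * d ^ n))"
    using vunit_mult[OF vunit_power[OF 1(5)] vunit_power[OF 2(5)]] by simp
  then show ?thesis
    unfolding has_value_def using 1 2 3 is_subringD(4)[OF Er] subring_power[OF Er]
    by (intro exI[of _ "n * m"] conjI bexI[of _ "e ^ m * d ^ n"]) auto
qed

lemma has_value_inverse:
  assumes "has_value b \<gamma>"
  shows "has_value (inverse b) (- \<gamma>)"
proof -
  obtain n e where 1: "n > 0" "e \<in> E" "e \<noteq> 0" "u e = Fin (nmul n \<gamma>)" "vunit (b ^ n * inverse e)"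
    using assms(1) by (auto simp: has_value_def)
  have "u (inverse e) + u e = 0" by (rule val_field_nonzero(2)[OF E u 1(2,3)])
  moreover have "nmul n (- \<gamma>) = - nmul n \<gamma>" using nmul_diff[of n 0 \<gamma>] by simp
  ultimately have "u (inverse e) = Fin (nmul n (- \<gamma>))"
    using 1(4) by (cases "u (inverse e)") (auto simp: with_infty_zero eq_neg_iff_add_eq_0 intro: add_right_imp_eq[of _ "nmul n \<gamma>"])
  moreover have "vunit (inverse b ^ n * inverse (inverse e))"
    using vunit_inverse[OF 1(5)] by (simp add: power_inverse mult.commute)
  ultimately show ?thesis
    unfolding has_value_def using 1 is_subfield_inverse[OF E]
    by (intro exI[of _ n] conjI bexI[of _ "inverse e"]) auto
qed

text \<open>A valuation ring is local: if x/y and the inverse of x + y lie in \<open>V\<close>, then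
  so does the inverse of y, which is (x/y + 1)/(x + y).\<close>

lemma nonunits_add:
  assumes "x \<in> V" "\<not> vunit x" "y \<in> V" "\<not> vunit y"
  shows "\<not> vunit (x + y)"
proof
  assume xy: "vunit (x + y)"
  have key: False if "x \<noteq> 0" "y \<noteq> 0" "x * inverse y \<in> V" "vunit (x + y)" "y \<in> V" "\<not> vunit y" for x y
  proof -
    have "inverse y = (x * inverse y + 1) * inverse (x + y)"
      using that by (simp add: vunit_def field_simps)
    also have "\<dots> \<in> V"
      using that is_subringD[OF V_subring] by (auto simp: vunit_def)
    finally show False using that by (simp add: vunit_def)
  qed
  have n: "x \<noteq> 0" "y \<noteq> 0" using assms xy by auto
  then have "x * inverse y \<in> V \<or> y * inverse x \<in> V" using V_total[of "x * inverse y"] by (simp add: mult.commute)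
  then show False using key[OF n _ xy assms(3,4)] key[OF n(2,1) _ _ assms(1,2)] xy by (auto simp: add.commute)
qed

lemma nonunits_sum:
  assumes "finite I" "\<And>i. i \<in> I \<Longrightarrow> f i \<in> V" "\<And>i. i \<in> I \<Longrightarrow> \<not> vunit (f i)"
  shows "\<not> vunit (sum f I)"
  using assms
proof (induction I)
  case empty then show ?case by (simp add: vunit_def)
next
  case (insert x F)
  then show ?case using nonunits_add[of "f x" "sum f F"] subring_sum[OF V_subring, of F f] by auto
qed

lemma dominant_element:
  assumes "finite X" "X \<noteq> {}" "0 \<notin> X"
  shows "\<exists>x\<in>X. \<forall>y\<in>X. y * inverse x \<in> V"
  using assms
proof (induction X rule: finite_ne_induct)
  case (singleton x) then show ?case using is_subringD(2)[OF V_subring] by auto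
next
  case (insert z F)
  then obtain x where x: "x \<in> F" "\<And>y. y \<in> F \<Longrightarrow> y * inverse x \<in> V" by auto
  have nz: "x \<noteq> 0" "z \<noteq> 0" using insert x by auto
  have 1: "1 \<in> V" using is_subringD(2)[OF V_subring] .
  show ?case
  proof (cases "z * inverse x \<in> V")
    case True then show ?thesis using x by blast
  next
    case False
    then have xz: "x * inverse z \<in> V" using V_total[of "z * inverse x"] nz by (simp add: mult.commute)
    have "y * inverse z \<in> V" if "y \<in> F" for y
    proof -
      have "y * inverse z = (y * inverse x) * (x * inverse z)" using nz by (simp add: field_simps)
      then show ?thesis using is_subringD(4)[OF V_subring x(2)[OF that] xz] by argo
    qed
    then show ?thesis using 1 nz by auto
  qed
qed

lemma has_value_of_power:
  assumes div: "divisible_group (class_group :: 'g ordered_group)"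
    and "n > 0" "e \<in> E" "e \<noteq> 0" "vunit (b ^ n * inverse e)"
  shows "\<exists>\<gamma>. has_value b \<gamma>"
proof -
  obtain x where "u e = Fin x" using val_field_nonzero(1)[OF E u assms(3,4)] by (cases "u e") auto
  moreover obtain \<gamma> where "nmul n \<gamma> = x" using divisible_class_group[OF div assms(2)] by blast
  ultimately show ?thesis using assms unfolding has_value_def by blast
qed

text \<open>No valuation is available yet, so the tie between two terms is found by locality.
  Divided by a dominant term, the other terms of the equation sum to -1, a unit, hence one of the
  quotients is a unit. Up to inversion it is a power of \<open>b\<close> divided by an element of
  \<open>E\<close>.\<close>

lemma has_value_algebraic:
  assumes div: "divisible_group (class_group :: 'g ordered_group)"
    and b: "algebraic_over E b" "b \<noteq> 0"
  shows "\<exists>\<gamma>. has_value b \<gamma>"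
proof -
  obtain p where p: "p \<in> polys_over E" "p \<noteq> 0" "poly p b = 0" using b(1) by (auto simp: algebraic_over_def)
  define I where "I = {i. i \<le> degree p \<and> coeff p i \<noteq> 0}"
  define f where "f i = coeff p i * b ^ i" for i
  have I: "finite I" "I \<noteq> {}" using p(2) by (auto simp: I_def intro!: exI[of _ "degree p"])
  have fnz: "f i \<noteq> 0" if "i \<in> I" for i using that b(2) by (simp add: f_def I_def)
  obtain m where m: "m \<in> I" "\<And>i. i \<in> I \<Longrightarrow> f i * inverse (f m) \<in> V"
    using dominant_element[of "f ` I"] I fnz by (auto simp: image_iff)
  have "(\<Sum>i\<in>I. f i) = poly p b"
    unfolding poly_altdef f_def by (rule sum.mono_neutral_left) (auto simp: I_def)
  then have "(\<Sum>i\<in>I - {m}. f i) = - f m" using p(3) I(1) m(1) by (simp add: sum_diff1)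
  then have "(\<Sum>i\<in>I - {m}. f i * inverse (f m)) = - 1"
    using fnz[OF m(1)] by (simp flip: sum_distrib_right)
  moreover have "vunit (- 1)" using is_subringD(2,5)[OF V_subring] by (simp add: vunit_def)
  ultimately obtain i where i: "i \<in> I" "i \<noteq> m" "vunit (f i * inverse (f m))"
    using nonunits_sum[of "I - {m}" "\<lambda>i. f i * inverse (f m)"] I(1) m(2) by auto
  have cE: "coeff p j \<in> E" for j using p(1) by (simp add: polys_over_def)
  have gen: "\<exists>\<gamma>. has_value b \<gamma>" if ij: "i < j" "i \<in> I" "j \<in> I" "vunit (f j * inverse (f i))" for i j
  proof -
    have nz: "coeff p i \<noteq> 0" "coeff p j \<noteq> 0" using ij by (auto simp: I_def)
    have "b ^ j = b ^ (j - i) * b ^ i" using ij(1) by (simp flip: power_add)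
    then have "f j * inverse (f i) = b ^ (j - i) * inverse (coeff p i * inverse (coeff p j))"
      using b(2) nz by (simp add: f_def field_simps)
    moreover have "coeff p i * inverse (coeff p j) \<in> E"
      by (intro is_subringD(4)[OF is_subfield_subring[OF E]] is_subfield_inverse[OF E] cE)
    ultimately show ?thesis
      using has_value_of_power[OF div, of "j - i" "coeff p i * inverse (coeff p j)"] ij nz by simp
  qed
  show ?thesis
  proof (cases "i < m")
    case True
    then show ?thesis using gen[OF True i(1) m(1)] vunit_inverse[OF i(3)] by (simp add: mult.commute)
  next
    case False
    then show ?thesis using gen[of m i] i m(1) by simp
  qed
qed

lemma valuation_of_valuation_ring:
  assumes all: "\<And>b. b \<noteq> 0 \<Longrightarrow> \<exists>\<gamma>. has_value b \<gamma>"
  shows "\<exists>w. val_on UNIV w \<and> (\<forall>e\<in>E. w e = u e)"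
proof -
  define w where "w b = (if b = 0 then Infty else Fin (SOME \<gamma>. has_value b \<gamma>))" for b
  have wI: "w b = Fin \<gamma>" if "has_value b \<gamma>" for b \<gamma>
    using someI[of "has_value b" \<gamma>] that has_value_unique has_value_nonzero[OF that] by (auto simp: w_def)
  have mult: "w (b * c) = w b + w c" for b c
  proof (cases "b = 0 \<or> c = 0")
    case False
    obtain \<gamma> \<gamma>' where g: "has_value b \<gamma>" "has_value c \<gamma>'" using all[of b] all[of c] False by auto
    then show ?thesis using wI[OF g(1)] wI[OF g(2)] wI[OF has_value_mult[OF g]] by simp
  qed (auto simp: w_def)
  have mono: "w c \<le> w b" if bc: "b * inverse c \<in> V" and c: "c \<noteq> 0" for b c
  proof (cases "b = 0")
    case False
    obtain \<gamma> \<gamma>' where g: "has_value b \<gamma>" "has_value c \<gamma>'" using all[OF False] all[OF c] by auto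
    then show ?thesis using wI[OF g(1)] wI[OF g(2)] has_value_mono[OF g bc] by simp
  qed (simp add: w_def)
  have add: "w c \<le> w (b + c)" if "b * inverse c \<in> V" "c \<noteq> 0" for b c
  proof (rule mono)
    have "(b + c) * inverse c = b * inverse c + 1" using that by (simp add: algebra_simps)
    then show "(b + c) * inverse c \<in> V" using is_subringD(2,3)[OF V_subring] that by auto
  qed (rule that)
  have "min (w b) (w c) \<le> w (b + c)" for b c
  proof (cases "b = 0 \<or> c = 0")
    case False
    then have "b * inverse c \<in> V \<or> c * inverse b \<in> V" using V_total[of "b * inverse c"] by (auto simp: mult.commute)
    then show ?thesis using add[of b c] add[of c b] False by (auto simp: add.commute min_le_iff_disj)
  qed (auto simp: w_def)
  moreover have Ew: "w e = u e" if e: "e \<in> E" for e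
  proof (cases "e = 0")
    case True then show ?thesis using val_onD(1)[OF u] by (simp add: w_def)
  next
    case False
    then obtain x where x: "u e = Fin x" using val_field_nonzero(1)[OF E u e] by (cases "u e") auto
    have "vunit 1" using is_subringD(2)[OF V_subring] by (simp add: vunit_def)
    then have "has_value e x" unfolding has_value_def using e False x 
      by (intro exI[of _ 1] conjI bexI[of _ e]) auto
    then show ?thesis using wI x by simp
  qed
  moreover have "w 1 = 0" using Ew[of 1] val_onD(2)[OF u] is_subringD(2)[OF is_subfield_subring[OF E]] by simp
  moreover have "w 0 = Infty" by (simp add: w_def)
  ultimately show ?thesis using mult by (intro exI[of _ w]) (auto simp: val_on_def)
qed

end

text \<open>Algebraicity is asked of numerators and denominators because elements of a fraction
  field come in this form; \<open>has_value_mult\<close> and \<open>has_value_inverse\<close>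
  combine the two values.\<close>

theorem valuation_extension_field:
  fixes E :: "'f::field set" and u :: "'f \<Rightarrow> 'g::linordered_ab_group_add with_infty"
  assumes E: "is_subfield E" and u: "val_on E u"
    and div: "divisible_group (class_group :: 'g ordered_group)"
    and alg: "\<And>b. b \<noteq> 0 \<Longrightarrow> \<exists>x y. x \<noteq> 0 \<and> y \<noteq> 0 \<and> b = x / y \<and> algebraic_over E x \<and> algebraic_over E y"
  shows "\<exists>w. val_on UNIV w \<and> (\<forall>e\<in>E. w e = u e)"
proof -
  obtain V where V: "valuation_ring V" "V \<inter> E = {e \<in> E. 0 \<le> u e}"
    using chevalley_valuation_ring[OF E u] by blast
  show ?thesis
  proof (rule valuation_of_valuation_ring[OF E u V])
    fix b :: 'f assume "b \<noteq> 0"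
    then obtain x y where xy: "x \<noteq> 0" "y \<noteq> 0" "b = x * inverse y" "algebraic_over E x" "algebraic_over E y"
      using alg by (metis divide_inverse)
    obtain \<gamma> where x: "has_value E V u x \<gamma>" using has_value_algebraic[OF E u V div xy(4,1)] by auto
    obtain \<gamma>' where y: "has_value E V u y \<gamma>'" using has_value_algebraic[OF E u V div xy(5,2)] by auto
    show "\<exists>\<gamma>. has_value E V u b \<gamma>"
      unfolding xy(3) using has_value_mult[OF E u V x has_value_inverse[OF E u V y]] ..
  qed
qed


section \<open>Extension of valuations to polynomials over the closure\<close>

lemma valuation_on_fractions:
  fixes R :: "'r::idom set" and \<mu> :: "'r \<Rightarrow> 'g::linordered_ab_group_add with_infty"
  assumes R: "is_subring R" and \<mu>: "val_on R \<mu>" and ts: "\<And>f. f \<in> R \<Longrightarrow> \<mu> f = Infty \<Longrightarrow> f = 0"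
  defines "E \<equiv> {to_fract f / to_fract g | f g. f \<in> R \<and> g \<in> R \<and> g \<noteq> 0}"
  shows "is_subfield E" "\<exists>u. val_on E u \<and> (\<forall>f\<in>R. u (to_fract f) = \<mu> f)"
proof -
  note S = is_subringD[OF R]
  have EI: "to_fract f / to_fract g \<in> E" if "f \<in> R" "g \<in> R" "g \<noteq> 0" for f g
    using that by (auto simp: E_def)
  have EE: "\<exists>f g. f \<in> R \<and> g \<in> R \<and> g \<noteq> 0 \<and> x = to_fract f / to_fract g" if "x \<in> E" for x
    using that by (auto simp: E_def)
  show "is_subfield E"
    unfolding is_subfield_def
  proof (intro conjI ballI)
    show "0 \<in> E" "1 \<in> E" using EI[of 0 1] EI[of 1 1] S by auto
  next
    fix x y assume "x \<in> E" "y \<in> E"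
    then obtain f g h k where x: "f \<in> R" "g \<in> R" "g \<noteq> 0" "x = to_fract f / to_fract g"
      and y: "h \<in> R" "k \<in> R" "k \<noteq> 0" "y = to_fract h / to_fract k"
      using EE[of x] EE[of y] by auto
    have "x + y = to_fract (f * k + h * g) / to_fract (g * k)" using x y by (simp add: field_simps)
    then show "x + y \<in> E" using EI[of "f * k + h * g" "g * k"] x y S by auto
    have "x * y = to_fract (f * h) / to_fract (g * k)" using x y by simp
    then show "x * y \<in> E" using EI[of "f * h" "g * k"] x y S by auto
  next
    fix x assume "x \<in> E"
    then obtain f g where x: "f \<in> R" "g \<in> R" "g \<noteq> 0" "x = to_fract f / to_fract g"
      using EE[of x] by auto
    have "- x = to_fract (- f) / to_fract g" using x by simp
    then show "- x \<in> E" using EI[of "- f" g] x S by auto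
    show "inverse x \<in> E" using EI[of g f] EI[of 0 1] x S by (cases "f = 0") auto
  qed
  \<comment> \<open>Without subtraction in \<open>with_infty\<close>, the value of f/g is described
    by an equation; it has a unique solution because \<open>\<mu> g\<close> is finite.\<close>
  define P where "P x z \<longleftrightarrow> (\<exists>f\<in>R. \<exists>g\<in>R. g \<noteq> 0 \<and> x = to_fract f / to_fract g \<and> z + \<mu> g = \<mu> f)" for x z
  define u where "u x = (SOME z. P x z)" for x
  have uniq: "u x = z" if f: "f \<in> R" "g \<in> R" "g \<noteq> 0" "x = to_fract f / to_fract g" "z + \<mu> g = \<mu> f" for x z f g
  proof -
    have "P x z" using f by (auto simp: P_def)
    then have "P x (u x)" unfolding u_def by (rule someI)
    then obtain h k where h: "h \<in> R" "k \<in> R" "k \<noteq> 0" "x = to_fract h / to_fract k" "u x + \<mu> k = \<mu> h"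
      by (auto simp: P_def)
    have fin: "\<mu> g \<noteq> Infty" "\<mu> k \<noteq> Infty" using ts f h by auto
    have "to_fract (f * k) = to_fract (h * g)" using f h by (simp add: field_simps)
    then have "f * k = h * g" by (simp only: to_fract_eq_iff)
    then have "\<mu> f + \<mu> k = \<mu> h + \<mu> g" using val_onD(3)[OF \<mu>] f h by metis
    then have "z + (\<mu> g + \<mu> k) = u x + (\<mu> g + \<mu> k)"
      using f(5)[symmetric] h(5)[symmetric] by (simp add: ac_simps)
    then show ?thesis using with_infty_add_cancel(5)[of "\<mu> g + \<mu> k"] fin by simp
  qed
  have ex: "\<exists>f g. f \<in> R \<and> g \<in> R \<and> g \<noteq> 0 \<and> x = to_fract f / to_fract g \<and> u x + \<mu> g = \<mu> f \<and> \<mu> g \<noteq> Infty" if x: "x \<in> E" for x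
  proof -
    obtain f g where f: "f \<in> R" "g \<in> R" "g \<noteq> 0" "x = to_fract f / to_fract g" using EE[OF x] by auto
    then have fin: "\<mu> g \<noteq> Infty" using ts by auto
    obtain z where "\<mu> f = z + \<mu> g" using with_infty_add_surj[OF fin] by blast
    then have "u x + \<mu> g = \<mu> f" using uniq[OF f, of z] by simp
    then show ?thesis using f fin by blast
  qed
  have u\<mu>: "u (to_fract f) = \<mu> f" if "f \<in> R" for f
    using uniq[of f 1 "to_fract f" "\<mu> f"] that S val_onD(2)[OF \<mu>] by simp
  have "u (x * y) = u x + u y \<and> min (u x) (u y) \<le> u (x + y)" if xy: "x \<in> E" "y \<in> E" for x y
  proof -
    obtain f g where x: "f \<in> R" "g \<in> R" "g \<noteq> 0" "x = to_fract f / to_fract g" "u x + \<mu> g = \<mu> f" "\<mu> g \<noteq> Infty"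
      using ex[OF xy(1)] by auto
    obtain h k where y: "h \<in> R" "k \<in> R" "k \<noteq> 0" "y = to_fract h / to_fract k" "u y + \<mu> k = \<mu> h" "\<mu> k \<noteq> Infty"
      using ex[OF xy(2)] by auto
    have gk: "\<mu> (g * k) = \<mu> g + \<mu> k" "g * k \<in> R" "g * k \<noteq> 0" using val_onD(3)[OF \<mu>] x y S by auto
    have "u (x * y) = u x + u y"
    proof (rule uniq[of "f * h" "g * k"])
      show "u x + u y + \<mu> (g * k) = \<mu> (f * h)"
        unfolding gk(1) val_onD(3)[OF \<mu> x(1) y(1)] x(5)[symmetric] y(5)[symmetric] by (simp add: ac_simps)
    qed (use x y S in auto)
    moreover have "min (u x) (u y) \<le> u (x + y)"
    proof -
      let ?n = "f * k + h * g"
      have nR: "f * k \<in> R" "h * g \<in> R" "?n \<in> R" using x y S by auto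
      obtain z where z: "\<mu> ?n = z + \<mu> (g * k)" 
        using with_infty_add_surj[of "\<mu> (g * k)" "\<mu> ?n"] gk x y by auto
      have "x + y = to_fract ?n / to_fract (g * k)" using x y by (simp add: field_simps)
      then have uz: "u (x + y) = z" using uniq[OF nR(3) gk(2,3)] z by auto
      have 1: "\<mu> (f * k) = u x + \<mu> (g * k)" 
        unfolding gk(1) val_onD(3)[OF \<mu> x(1) y(2)] x(5)[symmetric] by (simp add: ac_simps)
      have 2: "\<mu> (h * g) = u y + \<mu> (g * k)" 
        unfolding gk(1) val_onD(3)[OF \<mu> y(1) x(2)] y(5)[symmetric] by (simp add: ac_simps)
      have fin: "\<mu> (g * k) \<noteq> Infty" using gk(1) x(6) y(6) by simp
      show ?thesis
        using val_onD(4)[OF \<mu> nR(1,2)] unfolding z 1 2 uz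
        by (simp add: min_def with_infty_add_cancel(1)[OF fin] split: if_splits)
    qed
    ultimately show ?thesis ..
  qed
  then have "val_on E u"
    using u\<mu>[of 0] u\<mu>[of 1] S val_onD(1,2)[OF \<mu>] by (simp add: val_on_def)
  then show "\<exists>u. val_on E u \<and> (\<forall>f\<in>R. u (to_fract f) = \<mu> f)" using u\<mu> by blast
qed

text \<open>\<mu> extends to the fractions of \<open>polys_over K\<close>. All polynomials are
  integral over \<open>polys_over K\<close>, so the fraction field of the full polynomial ring falls
  under \<open>valuation_extension_field\<close>.\<close>

lemma extend_trivial_support:
  fixes K :: "'a::alg_closed_field set" and \<mu> :: "'a poly \<Rightarrow> 'g::linordered_ab_group_add with_infty"
  assumes K: "is_algebraic_closure_of TYPE('a) K" and div: "divisible_group (class_group :: 'g ordered_group)"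
    and \<mu>: "val_on (polys_over K) \<mu>" and ts: "\<And>f. f \<in> polys_over K \<Longrightarrow> \<mu> f = Infty \<Longrightarrow> f = 0"
  shows "\<exists>\<rho>. val_on UNIV \<rho> \<and> (\<forall>f\<in>polys_over K. \<rho> f = \<mu> f)"
proof -
  have KR: "is_subring (polys_over K)"
    using K is_subfield_subring is_subring_polys_over by (auto simp: is_algebraic_closure_of_def)
  define E where "E = {to_fract f / to_fract g | f g. f \<in> polys_over K \<and> g \<in> polys_over K \<and> g \<noteq> 0}"
  have E: "is_subfield E" unfolding E_def by (rule valuation_on_fractions(1)[OF KR \<mu> ts])
  obtain u where u: "val_on E u" "\<And>f. f \<in> polys_over K \<Longrightarrow> u (to_fract f) = \<mu> f"
    using valuation_on_fractions(2)[OF KR \<mu> ts] unfolding E_def by blast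
  have KE: "to_fract f \<in> E" if "f \<in> polys_over K" for f
    unfolding E_def using that is_subringD(2)[OF KR] by (intro CollectI exI[of _ f] exI[of _ 1]) auto
  have alg: "algebraic_over E (to_fract f)" for f
  proof -
    obtain Z where Z: "lead_coeff Z = 1" "\<And>j. coeff Z j \<in> polys_over K" "poly Z f = 0"
      using poly_integral[OF K, of f] by blast
    have "poly (fract_poly Z) (to_fract f) = to_fract (poly Z f)"
      by (induction Z) (auto simp: map_poly_pCons)
    then have "poly (fract_poly Z) (to_fract f) = 0" using Z(3) by simp
    moreover have "fract_poly Z \<in> polys_over E" using KE Z(2) by (auto simp: polys_over_def coeff_map_poly)
    moreover have "coeff (fract_poly Z) (degree Z) = 1" using Z(1) by (simp add: coeff_map_poly)
    then have "fract_poly Z \<noteq> 0" by auto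
    ultimately show ?thesis unfolding algebraic_over_def by blast
  qed
  have "\<exists>x y. x \<noteq> 0 \<and> y \<noteq> 0 \<and> b = x / y \<and> algebraic_over E x \<and> algebraic_over E y" if "b \<noteq> 0" for b :: "'a poly fract"
  proof -
    obtain f g where "b = Fract f g" "g \<noteq> 0" by (cases b) auto
    then have "b = to_fract f / to_fract g" "to_fract g \<noteq> 0" "to_fract f \<noteq> 0" 
      using that by (auto simp: Fract_conv_to_fract)
    then show ?thesis using alg by blast
  qed
  then obtain w where w: "val_on UNIV w" "\<And>e. e \<in> E \<Longrightarrow> w e = u e"
    using valuation_extension_field[OF E u(1) div] by blast
  have "val_on UNIV (\<lambda>f. w (to_fract f))"
    using val_onD[OF w(1)] by (simp add: val_on_def)
  then show ?thesis using w(2) u(2) KE by (intro exI[of _ "\<lambda>f. w (to_fract f)"]) auto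
qed

text \<open>Here \<mu> factors through evaluation at a root \<theta> of an element of its support,
  and so induces a valuation of K(\<theta>). Extending that to the whole closure and composing with
  evaluation at \<theta> extends \<mu>.\<close>

lemma extend_nontrivial_support:
  fixes K :: "'a::alg_closed_field set" and \<mu> :: "'a poly \<Rightarrow> 'g::linordered_ab_group_add with_infty"
  assumes K: "is_algebraic_closure_of TYPE('a) K" and div: "divisible_group (class_group :: 'g ordered_group)"
    and \<mu>: "val_on (polys_over K) \<mu>" and nt: "f0 \<in> polys_over K" "f0 \<noteq> 0" "\<mu> f0 = Infty"
  shows "\<exists>\<rho>. val_on UNIV \<rho> \<and> (\<forall>f\<in>polys_over K. \<rho> f = \<mu> f)"
proof -
  have Kf: "is_subfield K" using K by (simp add: is_algebraic_closure_of_def)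
  note Kr = is_subfield_subring[OF Kf]
  note KR = is_subring_polys_over[OF Kr]
  note P = is_subringD[OF KR]
  note v = val_onD[OF \<mu>]
  let ?S = "\<lambda>f. f \<in> polys_over K \<and> f \<noteq> 0 \<and> \<mu> f = Infty"
  define p where "p = (ARG_MIN degree f. ?S f)"
  have p: "?S p" and pmin: "\<And>f. ?S f \<Longrightarrow> degree p \<le> degree f"
    using arg_min_nat_lemma[of ?S f0 degree] nt by (auto simp: p_def)
  have "degree p > 0"
  proof (rule ccontr)
    assume "\<not> degree p > 0"
    then obtain c where c: "p = [:c:]" by (auto elim: degree_eq_zeroE)
    then have "c \<in> K" "c \<noteq> 0" using p polys_over_coeff[of p K 0] by auto
    then have "[:inverse c:] \<in> polys_over K" using polys_over_const[OF Kr is_subfield_inverse[OF Kf]] by blast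
    then have "\<mu> ([:inverse c:] * p) = \<mu> [:inverse c:] + \<mu> p" using p by (intro v(3)) auto
    then have "\<mu> ([:inverse c:] * p) = Infty" using p by (simp only: with_infty_plus)
    moreover have "[:inverse c:] * p = 1" using c \<open>c \<noteq> 0\<close> by (simp add: one_pCons)
    ultimately show False using v(2) by simp
  qed
  then obtain \<theta> where \<theta>: "poly p \<theta> = 0" using alg_closed_imp_poly_has_root by blast
  obtain m where m: "is_minimal_poly K \<theta> m" using minimal_poly_exists[OF Kf _ _ \<theta>] p by auto
  have mK: "m \<in> polys_over K" "m \<noteq> 0" using m by (auto simp: is_minimal_poly_def)
  obtain s where s: "s \<in> polys_over K" "p = s * m" using minimal_poly_dvd[OF Kf m _ \<theta>] p by auto
  have s0: "s \<noteq> 0" using s p by auto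
  \<comment> \<open>\<open>p\<close> has least degree in the support and \<open>s\<close> has
    smaller degree, so the infinite value of p = s m must come from \<open>m\<close>.\<close>
  have "\<mu> s \<noteq> Infty"
  proof
    assume "\<mu> s = Infty"
    then have "degree p \<le> degree s" using pmin s s0 by auto
    then show False using s(2) s0 mK minimal_poly_degree_pos[OF m] by (simp add: degree_mult_eq)
  qed
  then have \<mu>m: "\<mu> m = Infty" using v(3)[OF s(1) mK(1)] p s(2) by simp
  have van: "\<mu> f = Infty" if f: "f \<in> polys_over K" "poly f \<theta> = 0" for f
  proof -
    obtain t where "t \<in> polys_over K" "f = t * m" using minimal_poly_dvd[OF Kf m f] by auto
    then show ?thesis using v(3)[of t m] mK(1) \<mu>m by simp
  qed
  have wd: "\<mu> f = \<mu> g" if fg: "f \<in> polys_over K" "g \<in> polys_over K" "poly f \<theta> = poly g \<theta>" for f g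
  proof -
    have le: "\<mu> f \<le> \<mu> g" if "f \<in> polys_over K" "g \<in> polys_over K" "poly f \<theta> = poly g \<theta>" for f g
    proof -
      have "\<mu> (g - f) = Infty" using van[of "g - f"] that P(6) by simp
      moreover have "min (\<mu> (g - f)) (\<mu> f) \<le> \<mu> ((g - f) + f)" by (intro v(4) P that)
      ultimately show ?thesis by simp
    qed
    show ?thesis using le[OF fg] le[of g f] fg by simp
  qed
  define E where "E = adjoin K \<theta>"
  note A = adjoin_subring[OF Kr, of \<theta>, folded E_def]
  have E: "is_subfield E" by (rule subring_over_is_subfield[OF K A(1,2)])
  define u where "u x = \<mu> (SOME f. f \<in> polys_over K \<and> x = poly f \<theta>)" for x
  have u: "u (poly f \<theta>) = \<mu> f" if f: "f \<in> polys_over K" for f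
  proof -
    define h where "h = (SOME h. h \<in> polys_over K \<and> poly f \<theta> = poly h \<theta>)"
    have "h \<in> polys_over K \<and> poly f \<theta> = poly h \<theta>"
      unfolding h_def by (rule someI[of _ f]) (simp add: f)
    then have "\<mu> h = \<mu> f" by (intro wd f) simp_all
    then show ?thesis by (simp add: u_def h_def)
  qed
  have "val_on E u"
    unfolding val_on_def
  proof (intro conjI ballI)
    show "u 0 = Infty" "u 1 = 0" using u[OF P(1)] u[OF P(2)] v(1,2) by simp_all
  next
    fix x y assume "x \<in> E" "y \<in> E"
    then obtain f g where f: "f \<in> polys_over K" "x = poly f \<theta>" and g: "g \<in> polys_over K" "y = poly g \<theta>"
      by (auto simp: E_def adjoin_def)
    show "u (x * y) = u x + u y" "min (u x) (u y) \<le> u (x + y)"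
      using u[OF f(1)] u[OF g(1)] u[OF P(4)[OF f(1) g(1)]] u[OF P(3)[OF f(1) g(1)]] v(3,4)[OF f(1) g(1)] f g
      by simp_all
  qed
  moreover have "algebraic_over E b" for b
    using algebraic_closure_mono[OF K A(1,2)] unfolding is_algebraic_closure_of_def algebraic_over_def by blast
  then have "\<exists>x y. x \<noteq> 0 \<and> y \<noteq> 0 \<and> b = x / y \<and> algebraic_over E x \<and> algebraic_over E y" if "b \<noteq> 0" for b
    using that by (intro exI[of _ b] exI[of _ 1]) auto
  ultimately obtain w where w: "val_on UNIV w" "\<And>e. e \<in> E \<Longrightarrow> w e = u e"
    using valuation_extension_field[OF E _ div] by blast
  have "val_on UNIV (\<lambda>f. w (poly f \<theta>))"
    using val_onD[OF w(1)] by (simp add: val_on_def)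
  moreover have "w (poly f \<theta>) = \<mu> f" if "f \<in> polys_over K" for f
    using w(2)[of "poly f \<theta>"] u[OF that] that by (simp add: E_def adjoin_def)
  ultimately show ?thesis by (intro exI[of _ "\<lambda>f. w (poly f \<theta>)"]) auto
qed

text \<open>An arbitrary extension may induce on constants another extension of the valuation of
  \<open>K\<close>. That one is conjugate to \<open>w\<close> over \<open>K\<close>, even with equal
  values, and twisting by the automorphism leaves \<open>polys_over K\<close> alone.\<close>

theorem valuation_extension_poly:
  fixes K :: "'a::alg_closed_field set" and \<mu> :: "'a poly \<Rightarrow> 'g::linordered_ab_group_add with_infty"
  assumes K: "is_algebraic_closure_of TYPE('a) K" and div: "divisible_group (class_group :: 'g ordered_group)"
    and \<mu>: "val_on (polys_over K) \<mu>" and w: "val_on UNIV w" "\<And>a. a \<in> K \<Longrightarrow> \<mu> [:a:] = w a"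
  shows "\<exists>\<rho>. val_on UNIV \<rho> \<and> (\<forall>f\<in>polys_over K. \<rho> f = \<mu> f) \<and> (\<forall>c. \<rho> [:c:] = w c)"
proof -
  have Kr: "is_subring K" using K is_subfield_subring by (auto simp: is_algebraic_closure_of_def)
  obtain \<rho> where \<rho>: "val_on UNIV \<rho>" "\<And>f. f \<in> polys_over K \<Longrightarrow> \<rho> f = \<mu> f"
    using extend_trivial_support[OF K div \<mu>] extend_nontrivial_support[OF K div \<mu>] by metis
  define w0 where "w0 c = \<rho> [:c:]" for c
  have w0: "val_on UNIV w0" unfolding w0_def by (rule val_constants[OF \<rho>(1)])
  have eq: "w0 a = w a" if "a \<in> K" for a
    using \<rho>(2)[OF polys_over_const[OF Kr that]] w(2)[OF that] by (simp add: w0_def)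
  then have "order_equiv K w0 w" by (simp add: order_equiv_def)
  then obtain \<sigma> where \<sigma>: "\<sigma> \<in> auts K" "order_equiv UNIV (\<lambda>a. w0 (\<sigma> a)) w"
    using conjugate_field[OF K w0 w(1)] by blast
  have v0: "val_on UNIV (\<lambda>a. w0 (\<sigma> a))" using w0 by (simp add: val_on_def auts_simps[OF \<sigma>(1)])
  have "w0 (\<sigma> c) = w c" for c
    using order_equiv_field_eq[OF K v0 w(1) \<sigma>(2)] eq auts_simps(3)[OF \<sigma>(1)] by simp
  then have "\<rho> (map_poly \<sigma> [:c:]) = w c" for c by (simp add: map_poly_aut(8)[OF \<sigma>(1)] w0_def)
  moreover have "\<rho> (map_poly \<sigma> f) = \<mu> f" if "f \<in> polys_over K" for f
    using map_poly_aut_fixed[OF \<sigma>(1) that] \<rho>(2)[OF that] by simp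
  ultimately show ?thesis using val_comp_aut[OF \<rho>(1) \<sigma>(1)]
    by (intro exI[of _ "\<lambda>f. \<rho> (map_poly \<sigma> f)"]) blast
qed

text \<open>As a function of \<delta> the left side is strictly increasing and piecewise linear with
  positive integral slopes, so in a divisible group it takes every value. The induction guesses that
  the breakpoint \<open>e\<close> lies above the solution, which raises the slope to
  \<open>Suc k\<close>; if the guess fails, the term of \<open>e\<close> is constant.\<close>

lemma solve_min_sum:
  assumes div: "divisible_group (class_group :: 'g::linordered_ab_group_add ordered_group)"
  shows "k > 0 \<Longrightarrow> \<exists>\<delta>::'g. nmul k (Fin \<delta>) + sum_list (map (\<lambda>e. min (Fin \<delta>) e) es) = Fin t"
proof (induction es arbitrary: k t)
  case Nil
  obtain \<delta> where "nmul k \<delta> = t" using divisible_class_group[OF div Nil] by blast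
  then show ?case by (intro exI[of _ \<delta>]) (simp add: nmul_Fin)
next
  case (Cons e es)
  let ?S = "\<lambda>k \<delta>. nmul k (Fin \<delta>) + sum_list (map (\<lambda>e. min (Fin \<delta>) e) es)"
  obtain \<delta>2 where d2: "?S (Suc k) \<delta>2 = Fin t" using Cons.IH[of "Suc k" t] by blast
  show ?case
  proof (cases "Fin \<delta>2 \<le> e")
    case True
    then show ?thesis using d2 by (intro exI[of _ \<delta>2]) (simp add: min_def ac_simps)
  next
    case False
    then obtain x where x: "e = Fin x" "x < \<delta>2" by (cases e) auto
    obtain \<delta>1 where d1: "?S k \<delta>1 = Fin (t - x)" using Cons.IH[OF Cons.prems, of "t - x"] by blast
    \<comment> \<open>A solution \<open>\<delta>1\<close> below \<open>x\<close> would contradict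
      monotonicity against \<open>\<delta>2\<close>.\<close>
    have "x \<le> \<delta>1"
    proof (rule ccontr)
      assume "\<not> x \<le> \<delta>1"
      then have "\<delta>1 \<le> \<delta>2" using x(2) by simp
      then have "sum_list (map (\<lambda>e. min (Fin \<delta>1) e) es) \<le> sum_list (map (\<lambda>e. min (Fin \<delta>2) e) es)"
        by (intro sum_list_mono min.mono) simp_all
      then have "?S k \<delta>1 \<le> ?S k \<delta>2" using \<open>\<delta>1 \<le> \<delta>2\<close> by (intro add_mono nmul_mono) simp_all
      then have "Fin \<delta>2 + Fin (t - x) \<le> Fin \<delta>2 + ?S k \<delta>2" unfolding d1 by (rule add_left_mono)
      also have "\<dots> = Fin t" using d2 by (simp add: ac_simps)
      finally show False using x(2) by (simp add: algebra_simps)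
    qed
    then have "?S k \<delta>1 + e = Fin t" "min (Fin \<delta>1) e = e" using d1 x(1) by simp_all
    then show ?thesis by (intro exI[of _ \<delta>1]) (simp add: ac_simps)
  qed
qed


section \<open>Lifting inequalities of valuations\<close>

text \<open>In the next context \<open>g\<close> is a key polynomial for \<open>\<nu>\<close>: \<open>\<nu>\<close> can be read off from \<open>g\<close>-expansions.\<close>

context
  fixes K :: "'a::field set" and g :: "'a poly"
    and \<nu> \<xi> :: "'a poly \<Rightarrow> 'g::linordered_ab_group_add with_infty"
  assumes K: "is_subfield K" and \<nu>: "val_on (polys_over K) \<nu>" and \<xi>: "val_on (polys_over K) \<xi>"
    and le: "\<And>f. f \<in> polys_over K \<Longrightarrow> \<nu> f \<le> \<xi> f"
    and const: "\<And>a. a \<in> K \<Longrightarrow> \<nu> [:a:] = \<xi> [:a:]"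
    and g: "g \<in> polys_over K" "\<nu> g < \<xi> g"
    and low: "\<And>f. f \<in> polys_over K \<Longrightarrow> degree f < degree g \<Longrightarrow> \<nu> f = \<xi> f"
begin

lemma key_subring: "is_subring (polys_over K)"
  by (rule is_subring_polys_over[OF is_subfield_subring[OF K]])

lemma key_degree_pos: "degree g > 0"
proof (rule ccontr)
  assume "\<not> degree g > 0"
  then obtain c where c: "g = [:c:]" by (auto elim: degree_eq_zeroE)
  then show False using const[of c] polys_over_coeff[OF g(1), of 0] g(2) by simp
qed

lemma key_low: "r \<in> polys_over K \<Longrightarrow> r = 0 \<or> degree r < degree g \<Longrightarrow> \<nu> r = \<xi> r"
  using low val_onD(1)[OF \<nu>] val_onD(1)[OF \<xi>] by auto

text \<open>\<open>g\<close> gains strictly from \<nu> to \<xi>, and so does each multiple of finite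
  value. The bound \<open>t\<close> also covers multiples of infinite value.\<close>

lemma key_mult_less:
  assumes "q \<in> polys_over K" "t \<le> \<nu> (q * g)" "t \<noteq> Infty"
  shows "t < \<xi> (q * g)"
proof (cases "\<nu> q = Infty")
  case True
  then have "\<xi> q = Infty" using le[OF assms(1)] by simp
  then show ?thesis using val_onD(3)[OF \<xi> assms(1) g(1)] assms(3) by simp
next
  case False
  have "\<nu> (q * g) < \<xi> (q * g)"
    unfolding val_onD(3)[OF \<xi> assms(1) g(1)] val_onD(3)[OF \<nu> assms(1) g(1)]
    using with_infty_add_less_le(2)[OF g(2) le[OF assms(1)] False] .
  then show ?thesis using assms(2) by simp
qed

text \<open>If cancellation lifted the sum above a tie, then q g + r and q g would both exceed
  \<nu>(r) under \<xi>, hence so would their difference r; but \<nu> and \<xi> agree on r.\<close>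

lemma key_expansion:
  assumes q: "q \<in> polys_over K" and r: "r \<in> polys_over K" "r = 0 \<or> degree r < degree g"
  shows "\<nu> (q * g + r) = min (\<nu> (q * g)) (\<nu> r)"
proof -
  have qg: "q * g \<in> polys_over K" using is_subringD(4)[OF key_subring] q g by blast
  show ?thesis
  proof (cases "\<nu> (q * g) = \<nu> r")
    case False
    then show ?thesis
      using val_add_eq[OF key_subring \<nu> qg r(1)] val_add_eq[OF key_subring \<nu> r(1) qg] by (auto simp: min_def not_le)
  next
    case True
    have "\<nu> (q * g + r) \<le> \<nu> r"
    proof (rule ccontr)
      assume "\<not> ?thesis"
      then have lt: "\<nu> r < \<nu> (q * g + r)" by simp
      then have fin: "\<nu> r \<noteq> Infty" by auto
      have s: "q * g + r \<in> polys_over K" using is_subringD(3)[OF key_subring] qg r by blast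
      have "\<nu> r < \<xi> (q * g + r)" using lt le[OF s] by simp
      moreover have "\<nu> r < \<xi> (q * g)" by (rule key_mult_less[OF q _ fin]) (simp add: True)
      ultimately have "\<nu> r < min (\<xi> (q * g + r)) (\<xi> (q * g))" by simp
      also have "\<dots> \<le> \<xi> ((q * g + r) - q * g)" by (rule val_diff[OF key_subring \<xi> s qg])
      finally show False using key_low[OF r] by simp
    qed
    then show ?thesis using val_onD(4)[OF \<nu> qg r(1)] True by simp
  qed
qed

lemma key_quotient:
  assumes "f \<in> polys_over K"
  obtains q r where "q \<in> polys_over K" "r \<in> polys_over K" "f = q * g + r" "r = 0 \<or> degree r < degree g"
    "q = 0 \<or> degree q < degree f"
proof -
  have g0: "g \<noteq> 0" using key_degree_pos by auto
  obtain q r where qr: "q \<in> polys_over K" "r \<in> polys_over K" "f = q * g + r" "r = 0 \<or> degree r < degree g"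
    using polys_over_division[OF K g(1) g0 assms] by blast
  have "degree q < degree f" if "q \<noteq> 0"
  proof -
    have d: "degree (q * g) = degree q + degree g" using that g0 by (simp add: degree_mult_eq)
    then have "degree r < degree (q * g)" using qr(4) key_degree_pos by auto
    then have "degree f = degree (q * g)" unfolding qr(3) by (rule degree_add_eq_left)
    then show ?thesis using d key_degree_pos by simp
  qed
  then show ?thesis using that qr by blast
qed

context
  fixes \<mu> :: "'a poly \<Rightarrow> 'g with_infty"
  assumes \<mu>: "val_on (polys_over K) \<mu>" 
    and low': "\<And>f. f \<in> polys_over K \<Longrightarrow> degree f < degree g \<Longrightarrow> \<mu> f = \<xi> f"
begin

lemma key_low': "r \<in> polys_over K \<Longrightarrow> r = 0 \<or> degree r < degree g \<Longrightarrow> \<mu> r = \<nu> r"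
  using low low' val_onD(1)[OF \<nu>] val_onD(1)[OF \<mu>] by auto

text \<open>By \<open>key_expansion\<close> nothing cancels for \<nu> in a g-expansion, so \<nu> is
  least among valuations with the same values in low degree and at least its value at
  \<open>g\<close>.\<close>

lemma key_le:
  assumes "\<nu> g \<le> \<mu> g"
  shows "f \<in> polys_over K \<Longrightarrow> \<nu> f \<le> \<mu> f"
proof (induction "degree f" arbitrary: f rule: less_induct)
  case less
  from key_quotient[OF less.prems] obtain q r where qr: "q \<in> polys_over K" "r \<in> polys_over K" "f = q * g + r" 
     "r = 0 \<or> degree r < degree g" "q = 0 \<or> degree q < degree f" by blast
  have q: "\<nu> q \<le> \<mu> q" using qr(5) less.hyps[OF _ qr(1)] val_onD(1)[OF \<nu>] val_onD(1)[OF \<mu>] by auto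
  have qg: "q * g \<in> polys_over K" using is_subringD(4)[OF key_subring] qr g by blast
  have "\<nu> (q * g) \<le> \<mu> (q * g)"
    unfolding val_onD(3)[OF \<nu> qr(1) g(1)] val_onD(3)[OF \<mu> qr(1) g(1)] by (rule add_mono[OF q assms])
  then have "min (\<nu> (q * g)) (\<nu> r) \<le> min (\<mu> (q * g)) (\<mu> r)"
    using key_low'[OF qr(2,4)] by (simp add: min.coboundedI1)
  also have "\<dots> \<le> \<mu> f" unfolding qr(3) by (rule val_onD(4)[OF \<mu> qg qr(2)])
  finally show ?case using key_expansion[OF qr(1,2,4)] qr(3) by simp
qed

text \<open>When \<nu>(f) < \<xi>(f), the remainder lies strictly above \<nu>(f), since otherwise
  \<xi>(f) = \<xi>(r) = \<nu>(f). So \<nu>(f) is attained only at the multiple of \<open>g\<close>,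
  where \<mu> gains strictly.\<close>

lemma key_strict:
  assumes "\<nu> g < \<mu> g" and f: "f \<in> polys_over K" "\<nu> f < \<xi> f"
  shows "\<nu> f < \<mu> f"
proof -
  from key_quotient[OF f(1)] obtain q r where qr: "q \<in> polys_over K" "r \<in> polys_over K" "f = q * g + r" 
     "r = 0 \<or> degree r < degree g" by blast
  have fin: "\<nu> f \<noteq> Infty" using f(2) by auto
  have ex: "\<nu> f = min (\<nu> (q * g)) (\<nu> r)" using key_expansion[OF qr(1,2,4)] qr(3) by simp
  then have ge: "\<nu> f \<le> \<nu> (q * g)" "\<nu> f \<le> \<nu> r" by simp_all
  have qg: "q * g \<in> polys_over K" using is_subringD(4)[OF key_subring] qr g by blast
  have 1: "\<nu> f < \<xi> (q * g)" by (rule key_mult_less[OF qr(1) ge(1) fin])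
  have "\<nu> f \<noteq> \<nu> r"
  proof
    assume eq: "\<nu> f = \<nu> r"
    then have "\<xi> r < \<xi> (q * g)" using 1 key_low[OF qr(2,4)] by simp
    then have "\<xi> f = \<xi> r" unfolding qr(3) by (rule val_add_eq(2)[OF key_subring \<xi> qr(2) qg])
    then show False using f(2) eq key_low[OF qr(2,4)] by simp
  qed
  then have "\<nu> f < \<mu> r" using ge key_low'[OF qr(2,4)] by simp
  moreover have "\<nu> f < \<mu> (q * g)"
  proof (cases "\<nu> q = Infty")
    case True
    then have "\<mu> q = Infty" using key_le[OF less_imp_le[OF assms(1)] qr(1)] by simp
    then show ?thesis using val_onD(3)[OF \<mu> qr(1) g(1)] fin by simp
  next
    case False
    have "\<nu> (q * g) < \<mu> (q * g)"
      unfolding val_onD(3)[OF \<mu> qr(1) g(1)] val_onD(3)[OF \<nu> qr(1) g(1)]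
      by (rule with_infty_add_less_le(2)[OF assms(1) key_le[OF less_imp_le[OF assms(1)] qr(1)] False])
    then show ?thesis using ge(1) by simp
  qed
  ultimately have "\<nu> f < min (\<mu> (q * g)) (\<mu> r)" by simp
  also have "\<dots> \<le> \<mu> f" unfolding qr(3) by (rule val_onD(4)[OF \<mu> qg qr(2)])
  finally show ?thesis .
qed

end

end

text \<open>The valuations below a fixed \<open>\<xi>\<close> form a chain, on which a polynomial below its \<open>\<xi>\<close>-value separates points.\<close>

lemma below_determined_by_one_value:
  fixes K :: "'a::field set" and \<nu> \<mu> \<xi> :: "'a poly \<Rightarrow> 'g::linordered_ab_group_add with_infty"
  assumes K: "is_subfield K" and \<nu>: "val_on (polys_over K) \<nu>" and \<mu>: "val_on (polys_over K) \<mu>" 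
    and \<xi>: "val_on (polys_over K) \<xi>"
    and le: "\<And>f. f \<in> polys_over K \<Longrightarrow> \<nu> f \<le> \<xi> f" "\<And>f. f \<in> polys_over K \<Longrightarrow> \<mu> f \<le> \<xi> f"
    and const: "\<And>a. a \<in> K \<Longrightarrow> \<nu> [:a:] = \<xi> [:a:]" "\<And>a. a \<in> K \<Longrightarrow> \<mu> [:a:] = \<xi> [:a:]"
    and g0: "g0 \<in> polys_over K" "\<nu> g0 = \<mu> g0" "\<nu> g0 < \<xi> g0"
    and f: "f \<in> polys_over K"
  shows "\<nu> f = \<mu> f"
proof -
  let ?S = "\<lambda>f. f \<in> polys_over K \<and> (\<nu> f < \<xi> f \<or> \<mu> f < \<xi> f)"
  \<comment> \<open>In degree below that of \<open>g\<close> the three valuations agree, so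
    \<open>g\<close> is a key polynomial for whichever of \<nu> and \<mu> falls short of \<xi> at
    \<open>g\<close>.\<close>
  define g where "g = (ARG_MIN degree f. ?S f)"
  have g: "?S g" and gmin: "\<And>f. ?S f \<Longrightarrow> degree g \<le> degree f"
    using arg_min_nat_lemma[of ?S g0 degree] g0 by (auto simp: g_def)
  then have gK: "g \<in> polys_over K" by simp
  have low: "\<nu> f = \<xi> f" "\<mu> f = \<xi> f" if "f \<in> polys_over K" "degree f < degree g" for f
  proof -
    have "\<not> (\<nu> f < \<xi> f \<or> \<mu> f < \<xi> f)" using gmin[of f] that by (meson not_le)
    then show "\<nu> f = \<xi> f" "\<mu> f = \<xi> f" using le[OF that(1)] by (simp_all add: order.order_iff_strict)
  qed
  \<comment> \<open>A strict inequality at \<open>g\<close> would propagate to \<open>g0\<close>,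
    where the two values are equal.\<close>
  have n1: "\<not> \<nu> g < \<mu> g"
  proof
    assume lt: "\<nu> g < \<mu> g"
    then have "\<nu> g < \<xi> g" using le(2)[OF gK] by simp
    then have "\<nu> g0 < \<mu> g0"
      using key_strict[OF K \<nu> \<xi> le(1) const(1) gK _ low(1) \<mu> low(2) lt g0(1,3)] by blast
    then show False using g0(2) by simp
  qed
  have n2: "\<not> \<mu> g < \<nu> g"
  proof
    assume lt: "\<mu> g < \<nu> g"
    then have "\<mu> g < \<xi> g" using le(1)[OF gK] by simp
    moreover have "\<mu> g0 < \<xi> g0" using g0(2,3) by simp
    ultimately have "\<mu> g0 < \<nu> g0"
      using key_strict[OF K \<mu> \<xi> le(2) const(2) gK _ low(2) \<nu> low(1) lt g0(1)] by blast
    then show False using g0(2) by simp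
  qed
  have eq: "\<nu> g = \<mu> g" using n1 n2 by simp
  then have lt: "\<nu> g < \<xi> g" "\<mu> g < \<xi> g" using g by auto
  have 1: "\<nu> f \<le> \<mu> f" by (rule key_le[OF K \<nu> \<xi> le(1) const(1) gK lt(1) low(1) \<mu> low(2) _ f]) (simp_all add: eq)
  have 2: "\<mu> f \<le> \<nu> f" by (rule key_le[OF K \<mu> \<xi> le(2) const(2) gK lt(2) low(2) \<nu> low(1) _ f]) (simp_all add: eq)
  show ?thesis using 1 2 by simp
qed

section \<open>Disc valuations below a given valuation\<close>

lemma linear_product_val:
  fixes \<rho> :: "'a::field poly \<Rightarrow> 'g::linordered_ab_group_add with_infty"
  assumes "val_on UNIV \<rho>"
  shows "\<rho> ([:c:] * prod_list (map (\<lambda>x. [:- x, 1:]) xs)) = \<rho> [:c:] + sum_list (map (\<lambda>x. \<rho> [:- x, 1:]) xs)"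
proof -
  note v = val_onD[OF assms]
  have "\<rho> (prod_list (map (\<lambda>x. [:- x, 1:]) xs)) = sum_list (map (\<lambda>x. \<rho> [:- x, 1:]) xs)"
    by (induction xs) (simp_all only: list.map prod_list.Cons prod_list.Nil sum_list.Cons sum_list.Nil v(2,3) UNIV_I)
  then show ?thesis by (simp only: v(3) UNIV_I)
qed

lemma linear_factorization:
  fixes f :: "'a::alg_closed_field poly"
  assumes "f \<noteq> 0"
  obtains c xs where "c \<noteq> 0" "f = [:c:] * prod_list (map (\<lambda>x. [:- x, 1:]) xs)"
proof -
  obtain A where A: "f = smult (lead_coeff f) (\<Prod>x\<in>#A. [:- x, 1:])"
    using alg_closed_imp_factorization[OF assms] by auto
  obtain xs where "mset xs = A" using ex_mset by blast
  then have "(\<Prod>x\<in>#A. [:- x, 1:]) = prod_list (map (\<lambda>x. [:- x, 1:]) xs)"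
    by (metis mset_map prod_mset_prod_list)
  then have "f = [:lead_coeff f:] * prod_list (map (\<lambda>x. [:- x, 1:]) xs)" using A by simp
  then show ?thesis using that[of "lead_coeff f"] assms by auto
qed

theorem order_lift:
  fixes K :: "'a::alg_closed_field set" and \<rho> \<mu> :: "'a poly \<Rightarrow> 'g::linordered_ab_group_add with_infty"
  assumes K: "is_subfield K" and div: "divisible_group (class_group :: 'g ordered_group)"
    and \<rho>: "val_on UNIV \<rho>" "\<And>c. \<rho> [:c:] = w c" and w: "val_on UNIV w"
    and \<mu>: "val_on (polys_over K) \<mu>" "\<And>a. a \<in> K \<Longrightarrow> \<mu> [:a:] = w a"
    and le: "\<And>f. f \<in> polys_over K \<Longrightarrow> \<mu> f \<le> \<rho> f"
  shows "\<exists>\<omega>. val_on UNIV \<omega> \<and> (\<forall>c. \<omega> [:c:] = w c) \<and> (\<forall>f\<in>polys_over K. \<omega> f = \<mu> f) \<and> (\<forall>f. \<omega> f \<le> \<rho> f)"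
proof (cases "\<forall>f\<in>polys_over K. \<rho> f = \<mu> f")
  case True
  then show ?thesis using \<rho> by (intro exI[of _ \<rho>]) auto
next
  case False
  then obtain g where g: "g \<in> polys_over K" "\<mu> g < \<rho> g" using le by (metis le_neq_trans)
  have "g \<noteq> 0" using g(2) val_onD(1)[OF \<mu>(1)] by auto
  then obtain c xs where c: "c \<noteq> 0" "g = [:c:] * prod_list (map (\<lambda>x. [:- x, 1:]) xs)"
    by (rule linear_factorization)
  have ev: "\<omega> g = w c + sum_list (map (\<lambda>x. \<omega> [:- x, 1:]) xs)" 
    if "val_on UNIV \<omega>" "\<And>c. \<omega> [:c:] = w c" for \<omega> :: "'a poly \<Rightarrow> 'g with_infty"
    unfolding c(2) linear_product_val[OF that(1)] that(2) ..
  have wc: "w c \<noteq> Infty" by (rule val_field_nonzero(1)[OF is_subfield_UNIV w UNIV_I c(1)])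
  have "xs \<noteq> []"
  proof
    assume "xs = []"
    then have gc: "g = [:c:]" using c(2) by simp
    then show False using g \<mu>(2)[of c] \<rho>(2)[of c] polys_over_coeff[OF g(1), of 0] by simp
  qed
  then obtain a where a: "a \<in> set xs" "\<And>x. x \<in> set xs \<Longrightarrow> \<rho> [:- x, 1:] \<le> \<rho> [:- a, 1:]"
  proof -
    let ?X = "(\<lambda>x. \<rho> [:- x, 1:]) ` set xs"
    have "Max ?X \<in> ?X" using \<open>xs \<noteq> []\<close> by (intro Max_in) auto
    then obtain a where "a \<in> set xs" "Max ?X = \<rho> [:- a, 1:]" by auto
    then show ?thesis using that[of a] Max_ge[of ?X] by auto
  qed
  obtain ys zs where xs: "xs = ys @ a # zs" using split_list[OF a(1)] by auto
  obtain t where t: "\<mu> g = Fin t + w c"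
  proof -
    obtain t' where t': "\<mu> g = t' + w c" using with_infty_add_surj[OF wc] by blast
    moreover have "t' \<noteq> Infty" using g(2) t' by auto
    ultimately show ?thesis using that by (cases t') auto
  qed
  \<comment> \<open>This is the equation \<omega>(g) = \<mu>(g) with the constant factor of
    \<open>g\<close> removed. The chosen factor x - a contributes \<delta>, since w(0) is infinite,
    and every other root b contributes the minimum of \<delta> and w(a - b).\<close>
  obtain \<delta> where \<delta>: "nmul 1 (Fin \<delta>) + sum_list (map (\<lambda>e. min (Fin \<delta>) e) (map (\<lambda>x. w (a - x)) (ys @ zs))) = Fin t"
    using solve_min_sum[OF div, of 1 "map (\<lambda>x. w (a - x)) (ys @ zs)" t] by auto
  have \<delta>fin: "Fin \<delta> \<noteq> Infty" by simp
  define \<omega> where "\<omega> = disc_val w (Fin \<delta>) a"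
  have \<omega>: "val_on UNIV \<omega>" "\<And>c. \<omega> [:c:] = w c" "\<And>b. \<omega> [:- b, 1:] = min (w (a - b)) (Fin \<delta>)"
    unfolding \<omega>_def by (rule disc_val_on[OF w \<delta>fin], rule disc_val_const[OF w \<delta>fin], rule disc_val_linear[OF w \<delta>fin])
  define F where "F x = min (Fin \<delta>) (w (a - x))" for x
  have "sum_list (map F xs) = F a + sum_list (map F (ys @ zs))"
    unfolding xs by (simp add: add.left_commute)
  also have "F a = nmul 1 (Fin \<delta>)" using val_onD(1)[OF w] by (simp add: F_def)
  also have "map F (ys @ zs) = map (\<lambda>e. min (Fin \<delta>) e) (map (\<lambda>x. w (a - x)) (ys @ zs))"
    by (simp add: F_def)
  also note \<delta>
  finally have "sum_list (map F xs) = Fin t" .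
  moreover have "(\<lambda>x. \<omega> [:- x, 1:]) = F" unfolding \<omega>(3) F_def by (simp add: min.commute)
  ultimately have "\<omega> g = w c + Fin t" using ev[OF \<omega>(1,2)] by simp
  then have \<omega>g: "\<omega> g = \<mu> g" unfolding t by (simp only: add.commute)
  \<comment> \<open>If \<delta> exceeded \<rho>(x - a), the choice of \<open>a\<close> would make
    \<omega> at least \<rho> on every linear factor of \<open>g\<close>, and then \<omega>(g) would
    be at least \<rho>(g), which is larger than \<mu>(g).\<close>
  have "Fin \<delta> \<le> \<rho> [:- a, 1:]"
  proof (rule ccontr)
    assume "\<not> ?thesis"
    then have lt: "\<rho> [:- a, 1:] < Fin \<delta>" by simp
    have "\<rho> [:- x, 1:] \<le> \<omega> [:- x, 1:]" if x: "x \<in> set xs" for x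
    proof -
      have "min (\<rho> [:- x, 1:]) (\<rho> [:- a, 1:]) \<le> \<rho> ([:- x, 1:] - [:- a, 1:])"
        by (rule val_diff[OF is_subring_UNIV \<rho>(1) UNIV_I UNIV_I])
      also have "[:- x, 1:] - [:- a, 1:] = [:a - x:]" by simp
      finally have "\<rho> [:- x, 1:] \<le> w (a - x)" using a(2)[OF x] \<rho>(2) by simp
      then show ?thesis using a(2)[OF x] lt by (simp add: \<omega>(3))
    qed
    then have "sum_list (map (\<lambda>x. \<rho> [:- x, 1:]) xs) \<le> sum_list (map (\<lambda>x. \<omega> [:- x, 1:]) xs)"
      by (rule sum_list_mono)
    then have "\<rho> g \<le> \<omega> g" unfolding ev[OF \<rho>] ev[OF \<omega>(1,2)] by (rule add_left_mono)
    then show False using g(2) \<omega>g by simp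
  qed
  then have le': "\<omega> f \<le> \<rho> f" for f unfolding \<omega>_def by (rule disc_val_le[OF w \<delta>fin \<rho>])
  have "\<omega> f = \<mu> f" if f: "f \<in> polys_over K" for f
    by (rule below_determined_by_one_value[OF K val_on_subset[OF \<omega>(1) subset_UNIV] \<mu>(1) 
          val_on_subset[OF \<rho>(1) subset_UNIV] le' le _ _ g(1) \<omega>g _ f])
      (simp_all add: \<omega>(2) \<rho>(2) \<mu>(2) \<omega>g g(2))
  then show ?thesis using \<omega> le' by blast
qed


section \<open>The trees of valuations\<close>

lemma class_group_simps:
  "carrier class_group = UNIV" "x \<otimes>\<^bsub>class_group\<^esub> y = x + y" "\<one>\<^bsub>class_group\<^esub> = 0"
  "x \<preceq>\<^bsub>class_group\<^esub> y \<longleftrightarrow> x \<le> y"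
  for x y :: "'g::linordered_ab_group_add"
  by (simp_all add: class_group_def)

lemma class_group_inv: "inv\<^bsub>class_group\<^esub> x = - (x :: 'g::linordered_ab_group_add)"
proof -
  interpret comm_group "class_group :: 'g ordered_group"
    by (rule ordered_abelian_group.axioms(1)[OF ordered_abelian_group_class_group])
  show ?thesis by (rule inv_equality) (simp_all add: class_group_simps)
qed

lemma value_group_mult: "x \<otimes>\<^bsub>value_group class_group R \<mu>\<^esub> y = x + (y :: 'g::linordered_ab_group_add)"
  by (simp add: value_group_def subgroup_generated_def class_group_simps)

text \<open>Values add under multiplication, so the finite ones form a monoid, and the group
  generated by a commutative monoid consists of differences.\<close>

lemma value_group_carrier:
  fixes \<mu> :: "'r::comm_ring_1 \<Rightarrow> 'g::linordered_ab_group_add with_infty"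
  assumes R: "is_subring R" and \<mu>: "val_on R \<mu>"
  shows "carrier (value_group class_group R \<mu>) = {a - b | a b f g. f \<in> R \<and> g \<in> R \<and> \<mu> f = Fin a \<and> \<mu> g = Fin b}" (is "_ = ?D")
proof -
  let ?S = "{g. \<exists>f\<in>R. \<mu> f = Fin g}"
  have one: "1 \<in> R" "\<mu> 1 = Fin 0" using is_subringD(2)[OF R] val_onD(2)[OF \<mu>] by (auto simp: with_infty_zero)
  have "generate class_group ?S \<subseteq> ?D"
  proof
    fix x assume "x \<in> generate class_group ?S"
    then show "x \<in> ?D"
    proof (induction rule: generate.induct)
      case one
      then show ?case using \<open>1 \<in> R\<close> \<open>\<mu> 1 = Fin 0\<close> 
        by (intro CollectI exI[of _ 0] exI[of _ 1]) (auto simp: class_group_simps)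
    next
      case (incl h)
      then obtain f where "f \<in> R" "\<mu> f = Fin h" by auto
      then show ?case using one by (intro CollectI exI[of _ h] exI[of _ 0] exI[of _ f] exI[of _ 1]) auto
    next
      case (inv h)
      then obtain f where "f \<in> R" "\<mu> f = Fin h" by auto
      then show ?case using one 
        by (intro CollectI exI[of _ 0] exI[of _ h] exI[of _ 1] exI[of _ f]) (auto simp: class_group_inv)
    next
      case (eng x y)
      obtain a b f g where x: "f \<in> R" "g \<in> R" "\<mu> f = Fin a" "\<mu> g = Fin b" "x = a - b" using eng.IH(1) by auto
      obtain c d h k where y: "h \<in> R" "k \<in> R" "\<mu> h = Fin c" "\<mu> k = Fin d" "y = c - d" using eng.IH(2) by auto
      have "\<mu> (f * h) = Fin (a + c)" "\<mu> (g * k) = Fin (b + d)" "f * h \<in> R" "g * k \<in> R"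
        using val_onD(3)[OF \<mu>] x y is_subringD(4)[OF R] by auto
      then show ?case
        by (intro CollectI exI[of _ "a + c"] exI[of _ "b + d"] exI[of _ "f * h"] exI[of _ "g * k"])
          (simp add: class_group_simps x(5) y(5))
    qed
  qed
  moreover have "?D \<subseteq> generate class_group ?S"
  proof
    fix x assume "x \<in> ?D"
    then obtain a b f g where x: "f \<in> R" "g \<in> R" "\<mu> f = Fin a" "\<mu> g = Fin b" "x = a - b" by auto
    have "a \<otimes>\<^bsub>class_group\<^esub> inv\<^bsub>class_group\<^esub> b \<in> generate class_group ?S"
      using x by (intro generate.eng generate.incl generate.inv) auto
    then show "x \<in> generate class_group ?S" by (simp add: class_group_simps class_group_inv x(5))
  qed
  ultimately show ?thesis
    by (simp add: value_group_def carrier_subgroup_generated class_group_simps)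
qed

lemma order_equiv_Infty:
  assumes "is_subring R" "val_on R \<mu>" "val_on R \<nu>" "order_equiv R \<mu> \<nu>" "f \<in> R"
  shows "\<mu> f = Infty \<longleftrightarrow> \<nu> f = Infty"
  using order_equivD(3)[OF assms(4,5) is_subringD(1)[OF assms(1)]] val_onD(1)[OF assms(2)] val_onD(1)[OF assms(3)] by simp

text \<open>The isomorphism is forced: a difference of \<mu>-values goes to the difference of the
  corresponding \<nu>-values. Comparing two differences amounts to comparing two products in the
  ring, which is where order equivalence enters.\<close>

lemma valuation_equiv_iff_order_equiv:
  fixes \<mu> \<nu> :: "'r::comm_ring_1 \<Rightarrow> 'g::linordered_ab_group_add with_infty"
  assumes R: "is_subring R" and \<mu>: "val_on R \<mu>" and \<nu>: "val_on R \<nu>"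
  shows "valuation_equiv R class_group \<mu> class_group \<nu> \<longleftrightarrow> order_equiv R \<mu> \<nu>"
proof
  assume "valuation_equiv R class_group \<mu> class_group \<nu>"
  then obtain \<iota> where \<iota>: "\<iota> \<in> iso (value_group class_group R \<mu>) (value_group class_group R \<nu>)"
    and mono: "\<And>x y. x \<in> carrier (value_group class_group R \<mu>) \<Longrightarrow> y \<in> carrier (value_group class_group R \<mu>) \<Longrightarrow> x \<le> y \<Longrightarrow> \<iota> x \<le> \<iota> y"
    and eq: "\<And>f. f \<in> R \<Longrightarrow> \<nu> f = map_with_infty \<iota> (\<mu> f)"
    by (auto simp: valuation_equiv_def class_group_simps)
  have inj: "inj_on \<iota> (carrier (value_group class_group R \<mu>))" using \<iota> by (simp add: iso_def bij_betw_def)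
  have mem: "a \<in> carrier (value_group class_group R \<mu>)" if "f \<in> R" "\<mu> f = Fin a" for f a
    unfolding value_group_carrier[OF R \<mu>] using that is_subringD(2)[OF R] val_onD(2)[OF \<mu>]
    by (intro CollectI exI[of _ a] exI[of _ 0] exI[of _ f] exI[of _ 1]) (auto simp: with_infty_zero)
  show "order_equiv R \<mu> \<nu>"
    unfolding order_equiv_def
  proof (intro ballI)
    fix f g assume fg: "f \<in> R" "g \<in> R"
    show "\<mu> f \<le> \<mu> g \<longleftrightarrow> \<nu> f \<le> \<nu> g"
    proof (cases "\<mu> f")
      case Infty
      then show ?thesis using eq[OF fg(1)] eq[OF fg(2)] by (cases "\<mu> g") auto
    next
      case f: (Fin a)
      show ?thesis
      proof (cases "\<mu> g")
        case Infty
        then show ?thesis using eq[OF fg(2)] by simp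
      next
        case g: (Fin b)
        have "a \<le> b \<longleftrightarrow> \<iota> a \<le> \<iota> b"
          using mono[OF mem[OF fg(1) f] mem[OF fg(2) g]] mono[OF mem[OF fg(2) g] mem[OF fg(1) f]]
            inj_onD[OF inj _ mem[OF fg(1) f] mem[OF fg(2) g]] by (metis antisym linear)
        then show ?thesis using eq fg f g by simp
      qed
    qed
  qed
next
  assume oe: "order_equiv R \<mu> \<nu>"
  note inf = order_equiv_Infty[OF R \<mu> \<nu> oe]
  let ?G = "value_group class_group R \<mu>" and ?H = "value_group class_group R \<nu>"
  define Q where "Q x y \<longleftrightarrow> (\<exists>f\<in>R. \<exists>g\<in>R. \<exists>a b c d. \<mu> f = Fin a \<and> \<mu> g = Fin b \<and> \<nu> f = Fin c \<and> \<nu> g = Fin d \<and> x = a - b \<and> y = c - d)" for x y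
  \<comment> \<open>The equivalence in both directions makes \<open>Q\<close> single-valued,
    injective and monotone at once.\<close>
  have le: "x \<le> x' \<longleftrightarrow> y \<le> y'" if "Q x y" "Q x' y'" for x y x' y'
  proof -
    obtain f g a b c d where 1: "f \<in> R" "g \<in> R" "\<mu> f = Fin a" "\<mu> g = Fin b" "\<nu> f = Fin c" "\<nu> g = Fin d" "x = a - b" "y = c - d"
      using \<open>Q x y\<close> unfolding Q_def by blast
    obtain f' g' a' b' c' d' where 2: "f' \<in> R" "g' \<in> R" "\<mu> f' = Fin a'" "\<mu> g' = Fin b'" "\<nu> f' = Fin c'" "\<nu> g' = Fin d'" "x' = a' - b'" "y' = c' - d'"
      using \<open>Q x' y'\<close> unfolding Q_def by blast
    have "f * g' \<in> R" "f' * g \<in> R" using 1 2 is_subringD(4)[OF R] by auto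
    from order_equivD(1)[OF oe this] have "a + b' \<le> a' + b \<longleftrightarrow> c + d' \<le> c' + d"
      using val_onD(3)[OF \<mu>] val_onD(3)[OF \<nu>] 1 2 by simp
    then show ?thesis unfolding 1 2 by (simp add: algebra_simps)
  qed
  define \<iota> where "\<iota> x = (SOME y. Q x y)" for x
  have \<iota>: "\<iota> x = y" if "Q x y" for x y
  proof -
    have "Q x (\<iota> x)" unfolding \<iota>_def using that by (rule someI)
    then show ?thesis using le[OF that, of x "\<iota> x"] le[of x "\<iota> x" x y] that by simp
  qed
  have QG: "\<exists>y. Q x y" if "x \<in> carrier ?G" for x
  proof -
    obtain f g a b where 1: "f \<in> R" "g \<in> R" "\<mu> f = Fin a" "\<mu> g = Fin b" "x = a - b"
      using \<open>x \<in> carrier ?G\<close> unfolding value_group_carrier[OF R \<mu>] by auto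
    then obtain c d where "\<nu> f = Fin c" "\<nu> g = Fin d"
      using inf[of f] inf[of g] by (cases "\<nu> f"; cases "\<nu> g") auto
    then show ?thesis unfolding Q_def using 1 by blast
  qed
  have QH: "\<exists>x. Q x y" if "y \<in> carrier ?H" for y
  proof -
    obtain f g c d where 1: "f \<in> R" "g \<in> R" "\<nu> f = Fin c" "\<nu> g = Fin d" "y = c - d"
      using \<open>y \<in> carrier ?H\<close> unfolding value_group_carrier[OF R \<nu>] by auto
    then obtain a b where "\<mu> f = Fin a" "\<mu> g = Fin b"
      using inf[of f] inf[of g] by (cases "\<mu> f"; cases "\<mu> g") auto
    then show ?thesis unfolding Q_def using 1 by blast
  qed
  have Qmem: "x \<in> carrier ?G" "y \<in> carrier ?H" if "Q x y" for x y
    using that unfolding value_group_carrier[OF R \<mu>] value_group_carrier[OF R \<nu>] Q_def by blast+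
  have Qadd: "Q (x + x') (y + y')" if "Q x y" "Q x' y'" for x y x' y'
  proof -
    obtain f g a b c d where 1: "f \<in> R" "g \<in> R" "\<mu> f = Fin a" "\<mu> g = Fin b" "\<nu> f = Fin c" "\<nu> g = Fin d" "x = a - b" "y = c - d"
      using \<open>Q x y\<close> unfolding Q_def by blast
    obtain f' g' a' b' c' d' where 2: "f' \<in> R" "g' \<in> R" "\<mu> f' = Fin a'" "\<mu> g' = Fin b'" "\<nu> f' = Fin c'" "\<nu> g' = Fin d'" "x' = a' - b'" "y' = c' - d'"
      using \<open>Q x' y'\<close> unfolding Q_def by blast
    have "f * f' \<in> R" "g * g' \<in> R" "\<mu> (f * f') = Fin (a + a')" "\<mu> (g * g') = Fin (b + b')"
      "\<nu> (f * f') = Fin (c + c')" "\<nu> (g * g') = Fin (d + d')"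
      using 1 2 is_subringD(4)[OF R] val_onD(3)[OF \<mu>] val_onD(3)[OF \<nu>] by auto
    moreover have "x + x' = (a + a') - (b + b')" "y + y' = (c + c') - (d + d')" unfolding 1 2 by simp_all
    ultimately show ?thesis unfolding Q_def by blast
  qed
  have "\<iota> \<in> iso ?G ?H"
    unfolding iso_def hom_def
  proof (intro CollectI conjI ballI funcsetI)
    fix x assume "x \<in> carrier ?G"
    then show "\<iota> x \<in> carrier ?H" using QG \<iota> Qmem(2) by metis
  next
    fix x x' assume "x \<in> carrier ?G" "x' \<in> carrier ?G"
    then obtain y y' where "Q x y" "Q x' y'" using QG by blast
    then show "\<iota> (x \<otimes>\<^bsub>?G\<^esub> x') = \<iota> x \<otimes>\<^bsub>?H\<^esub> \<iota> x'"
      unfolding value_group_mult using \<iota> Qadd by metis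
  next
    show "bij_betw \<iota> (carrier ?G) (carrier ?H)"
      unfolding bij_betw_def
    proof (intro conjI inj_onI equalityI subsetI)
      fix x x' assume x: "x \<in> carrier ?G" "x' \<in> carrier ?G" "\<iota> x = \<iota> x'"
      then obtain y y' where y: "Q x y" "Q x' y'" using QG by blast
      then have "y = y'" using x(3) \<iota> by metis
      then show "x = x'" using le[OF y] le[OF y(2,1)] by simp
    next
      fix y assume "y \<in> \<iota> ` carrier ?G"
      then show "y \<in> carrier ?H" using QG \<iota> Qmem(2) by blast
    next
      fix y assume "y \<in> carrier ?H"
      then obtain x where "Q x y" using QH by blast
      then show "y \<in> \<iota> ` carrier ?G" using \<iota> Qmem(1) by blast
    qed
  qed
  moreover have "\<iota> x \<le> \<iota> x'" if x: "x \<in> carrier ?G" "x' \<in> carrier ?G" "x \<le> x'" for x x'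
  proof -
    obtain y where y: "Q x y" using QG[OF x(1)] by blast
    obtain y' where y': "Q x' y'" using QG[OF x(2)] by blast
    show ?thesis using le[OF y y'] x(3) \<iota>[OF y] \<iota>[OF y'] by simp
  qed
  moreover have "\<nu> f = map_with_infty \<iota> (\<mu> f)" if f: "f \<in> R" for f
  proof (cases "\<mu> f")
    case Infty
    then show ?thesis using inf[OF f] by simp
  next
    case (Fin a)
    then obtain c where c: "\<nu> f = Fin c" using inf[OF f] by (cases "\<nu> f") auto
    have "1 \<in> R" "\<mu> 1 = Fin 0" "\<nu> 1 = Fin 0"
      using is_subringD(2)[OF R] val_onD(2)[OF \<mu>] val_onD(2)[OF \<nu>] by (auto simp: with_infty_zero)
    then have "Q (a - 0) (c - 0)" unfolding Q_def using f Fin c by blast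
    then show ?thesis using \<iota> Fin c by simp
  qed
  ultimately show "valuation_equiv R class_group \<mu> class_group \<nu>"
    unfolding valuation_equiv_def by (intro bexI[of _ \<iota>]) (auto simp: class_group_simps)
qed

section \<open>Equivalence classes of valuations\<close>

lemma valuations_extending_iff:
  "\<mu> \<in> valuations_extending class_group L w \<longleftrightarrow>
     \<mu> \<in> extensional (polys_over L) \<and> val_on (polys_over L) \<mu> \<and> (\<forall>a\<in>L. \<mu> [:a:] = w a)"
  by (simp add: valuations_extending_def valuation_on_class_group)

lemma equiv_rel_iff:
  assumes "is_subring L"
  shows "(\<mu>, \<nu>) \<in> equiv_rel class_group L w \<longleftrightarrow>
    \<mu> \<in> valuations_extending class_group L w \<and> \<nu> \<in> valuations_extending class_group L w \<and> order_equiv (polys_over L) \<mu> \<nu>"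
  using valuation_equiv_iff_order_equiv[OF is_subring_polys_over[OF assms]]
  by (auto simp: equiv_rel_def valuations_extending_iff)

lemma equiv_equiv_rel:
  assumes "is_subring L"
  shows "equiv (valuations_extending class_group L w) (equiv_rel class_group L w)"
proof (rule equivI)
  show "refl_on (valuations_extending class_group L w) (equiv_rel class_group L w)"
    by (auto simp: refl_on_def equiv_rel_iff[OF assms] order_equiv_def)
  show "sym (equiv_rel class_group L w)"
    by (auto simp: sym_def equiv_rel_iff[OF assms] order_equiv_sym)
  show "trans (equiv_rel class_group L w)"
    unfolding trans_def equiv_rel_iff[OF assms] using order_equiv_trans by blast
qed (auto simp: equiv_rel_iff[OF assms])

lemma restrict_extending:
  assumes L: "is_subring L" and \<rho>: "val_on (polys_over L) \<rho>" "\<And>a. a \<in> L \<Longrightarrow> \<rho> [:a:] = w a"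
  shows "restrict \<rho> (polys_over L) \<in> valuations_extending class_group L w"
proof -
  have "val_on (polys_over L) (restrict \<rho> (polys_over L))"
    using \<rho>(1) val_on_cong[OF is_subring_polys_over[OF L], of \<rho> "restrict \<rho> (polys_over L)"] by simp
  then show ?thesis using \<rho>(2) polys_over_const[OF L] by (simp add: valuations_extending_iff)
qed

section \<open>The isomorphism of the trees\<close>

theorem theoremB:
  fixes K :: "'a::alg_closed_field set"
    and v vbar :: "'a \<Rightarrow> 'g::linordered_ab_group_add with_infty"
  assumes "is_algebraic_closure_of TYPE('a) K"
    and "valuation_on class_group K v"
    and "valuation_on class_group UNIV vbar"
    and "\<forall>a\<in>K. vbar a = v a"
    and "divisible_group (class_group :: 'g ordered_group)"
    and "universal_group class_group (henselization K vbar) (hens_valuation K vbar)"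
  shows "poset_isomorphism
           (val_tree class_group (henselization K vbar) (hens_valuation K vbar))
           (tree_le class_group (henselization K vbar))
           (val_tree class_group K v)
           (tree_le class_group K)
           (class_restriction class_group K v)"
proof -
  note K = assms(1) and div = assms(5)
  have vbar: "val_on UNIV vbar" using assms(3) by (simp add: valuation_on_class_group)
  define H where "H = henselization K vbar"
  define vh where "vh = hens_valuation K vbar"
  note Hr = henselization_subring[OF K, of vbar, folded H_def]
  have HA: "is_algebraic_closure_of TYPE('a) H" by (rule algebraic_closure_mono[OF K Hr])
  have Kr: "is_subring K" using K is_subfield_subring by (auto simp: is_algebraic_closure_of_def)
  have Kf: "is_subfield K" using K by (simp add: is_algebraic_closure_of_def)
  have vh: "vh a = vbar a" if "a \<in> H" for a using that by (simp add: vh_def hens_valuation_def H_def)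
  have vK: "v a = vbar a" if "a \<in> K" for a using assms(4) that by simp
  define TH where "TH = valuations_extending class_group H vh"
  define TK where "TK = valuations_extending class_group K v"
  define eH where "eH = equiv_rel class_group H vh"
  define eK where "eK = equiv_rel class_group K v"
  define res where "res \<eta> = restrict \<eta> (polys_over K)" for \<eta> :: "'a poly \<Rightarrow> 'g with_infty"
  have eqH: "equiv TH eH" and eqK: "equiv TK eK"
    unfolding TH_def TK_def eH_def eK_def by (rule equiv_equiv_rel[OF Hr(1)], rule equiv_equiv_rel[OF Kr])
  have eH: "(\<mu>, \<nu>) \<in> eH \<longleftrightarrow> \<mu> \<in> TH \<and> \<nu> \<in> TH \<and> order_equiv (polys_over H) \<mu> \<nu>" for \<mu> \<nu>
    unfolding eH_def TH_def by (rule equiv_rel_iff[OF Hr(1)])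
  have eK: "(\<mu>, \<nu>) \<in> eK \<longleftrightarrow> \<mu> \<in> TK \<and> \<nu> \<in> TK \<and> order_equiv (polys_over K) \<mu> \<nu>" for \<mu> \<nu>
    unfolding eK_def TK_def by (rule equiv_rel_iff[OF Kr])
  have PKH: "polys_over K \<subseteq> polys_over H" by (rule polys_over_mono[OF Hr(2)])
  have THD: "val_on (polys_over H) \<eta>" "\<And>a. a \<in> H \<Longrightarrow> \<eta> [:a:] = vbar a" if "\<eta> \<in> TH" for \<eta>
    using that vh by (auto simp: TH_def valuations_extending_iff)
  have TKD: "val_on (polys_over K) \<mu>" "\<And>a. a \<in> K \<Longrightarrow> \<mu> [:a:] = vbar a" "\<mu> \<in> extensional (polys_over K)" if "\<mu> \<in> TK" for \<mu>
    using that vK by (auto simp: TK_def valuations_extending_iff)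
  have resT: "res \<eta> \<in> TK" if "\<eta> \<in> TH" for \<eta>
    unfolding res_def TK_def
    using THD[OF that] vK Hr(2) by (intro restrict_extending[OF Kr] val_on_subset[OF _ PKH]) auto
  have TH_restrict: "restrict \<rho> (polys_over H) \<in> TH" if "val_on UNIV \<rho>" "\<And>c. \<rho> [:c:] = vbar c" for \<rho>
    unfolding TH_def using that vh by (intro restrict_extending[OF Hr(1)] val_on_subset[OF that(1) subset_UNIV]) auto
  have res_restrict: "res (restrict \<rho> (polys_over H)) = restrict \<rho> (polys_over K)" for \<rho>
    using PKH unfolding res_def by (auto simp: restrict_def fun_eq_iff)
  have ext: "\<exists>\<rho>. val_on UNIV \<rho> \<and> (\<forall>f\<in>polys_over H. \<rho> f = \<eta> f) \<and> (\<forall>c. \<rho> [:c:] = vbar c)" if "\<eta> \<in> TH" for \<eta>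
    by (rule valuation_extension_poly[OF HA div THD(1)[OF that] vbar THD(2)[OF that]])
  have unique: "order_equiv (polys_over H) \<eta> \<eta>'" 
    if \<eta>: "\<eta> \<in> TH" and \<eta>': "\<eta>' \<in> TH" and oe: "order_equiv (polys_over K) (res \<eta>) (res \<eta>')" for \<eta> \<eta>'
  proof -
    obtain \<rho> where \<rho>: "val_on UNIV \<rho>" "\<And>f. f \<in> polys_over H \<Longrightarrow> \<rho> f = \<eta> f" "\<And>c. \<rho> [:c:] = vbar c" using ext[OF \<eta>] by blast
    obtain \<rho>' where \<rho>': "val_on UNIV \<rho>'" "\<And>f. f \<in> polys_over H \<Longrightarrow> \<rho>' f = \<eta>' f" "\<And>c. \<rho>' [:c:] = vbar c" using ext[OF \<eta>'] by blast
    have "order_equiv (polys_over K) \<rho> \<rho>'"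
      using oe PKH \<rho>(2) \<rho>'(2) by (simp add: order_equiv_def res_def subset_iff)
    then obtain \<sigma> where \<sigma>: "\<sigma> \<in> auts K" "order_equiv UNIV (\<lambda>f. \<rho> (map_poly \<sigma> f)) \<rho>'"
      using conjugate_polynomial_valuations[OF K \<rho>(1) \<rho>'(1)] by blast
    \<comment> \<open>On constants both extensions are \<open>vbar\<close>, so \<sigma> respects the
      order given by \<open>vbar\<close>; as \<sigma> fixes \<open>K\<close>, this improves to
      preserving \<open>vbar\<close>.\<close>
    have oc: "order_equiv UNIV (\<lambda>a. vbar (\<sigma> a)) vbar"
      unfolding order_equiv_def
    proof (intro ballI)
      fix a b
      show "vbar (\<sigma> a) \<le> vbar (\<sigma> b) \<longleftrightarrow> vbar a \<le> vbar b"
        using order_equivD(1)[OF \<sigma>(2), of "[:a:]" "[:b:]"] by (simp add: map_poly_aut(8)[OF \<sigma>(1)] \<rho>(3) \<rho>'(3))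
    qed
    have vs: "val_on UNIV (\<lambda>a. vbar (\<sigma> a))" using vbar by (simp add: val_on_def auts_simps[OF \<sigma>(1)])
    have "vbar (\<sigma> c) = vbar c" for c
      by (rule order_equiv_field_eq[OF K vs vbar oc]) (simp add: auts_simps(3)[OF \<sigma>(1)])
    then have "\<sigma> a = a" if "a \<in> H" for a
      using henselization_fixed[OF K \<sigma>(1), of vbar a] that by (simp add: H_def)
    then have "map_poly \<sigma> f = f" if "f \<in> polys_over H" for f
      using that by (intro poly_eqI) (simp add: coeff_map_poly auts_simps(4)[OF \<sigma>(1)] polys_over_def)
    then have "\<eta> f = \<rho> (map_poly \<sigma> f)" "\<eta>' f = \<rho>' f" if "f \<in> polys_over H" for f
      using that \<rho>(2) \<rho>'(2) by simp_all
    then show ?thesis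
      using order_equivD(1)[OF \<sigma>(2) UNIV_I UNIV_I] by (simp add: order_equiv_def)
  qed
  have surj: "\<exists>\<eta>\<in>TH. res \<eta> = \<mu>" if \<mu>: "\<mu> \<in> TK" for \<mu>
  proof -
    obtain \<rho> where \<rho>: "val_on UNIV \<rho>" "\<And>f. f \<in> polys_over K \<Longrightarrow> \<rho> f = \<mu> f" "\<And>c. \<rho> [:c:] = vbar c"
      using valuation_extension_poly[OF K div TKD(1)[OF \<mu>] vbar TKD(2)[OF \<mu>]] by blast
    have "restrict \<rho> (polys_over K) = \<mu>"
      using \<rho>(2) TKD(3)[OF \<mu>] by (auto simp: restrict_def extensional_def fun_eq_iff)
    then show ?thesis using TH_restrict[OF \<rho>(1,3)] res_restrict by blast
  qed
  \<comment> \<open>The upper valuation on \<open>polys_over H\<close> is prescribed, not just its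
    restriction, so a comparison can be lifted below any chosen representative.\<close>
  have lift: "\<exists>\<eta>\<in>TH. res \<eta> = \<nu> \<and> valuation_le class_group H \<eta> \<eta>'" 
    if \<nu>: "\<nu> \<in> TK" and \<eta>': "\<eta>' \<in> TH" and le: "valuation_le class_group K \<nu> (res \<eta>')" for \<nu> \<eta>'
  proof -
    obtain \<rho> where \<rho>: "val_on UNIV \<rho>" "\<And>f. f \<in> polys_over H \<Longrightarrow> \<rho> f = \<eta>' f" "\<And>c. \<rho> [:c:] = vbar c" using ext[OF \<eta>'] by blast
    have "\<nu> f \<le> \<rho> f" if "f \<in> polys_over K" for f
      using le that \<rho>(2)[of f] PKH by (auto simp: valuation_le_def res_def less_eq_with_infty_def)
    then obtain \<omega> where \<omega>: "val_on UNIV \<omega>" "\<And>c. \<omega> [:c:] = vbar c" "\<And>f. f \<in> polys_over K \<Longrightarrow> \<omega> f = \<nu> f" "\<And>f. \<omega> f \<le> \<rho> f"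
      using order_lift[OF Kf div \<rho>(1,3) vbar TKD(1,2)[OF \<nu>]] by blast
    have "restrict \<omega> (polys_over K) = \<nu>"
      using \<omega>(3) TKD(3)[OF \<nu>] by (auto simp: restrict_def extensional_def fun_eq_iff)
    moreover have "valuation_le class_group H (restrict \<omega> (polys_over H)) \<eta>'"
      using \<omega>(4) \<rho>(2) by (auto simp: valuation_le_def less_eq_with_infty_def[symmetric]) metis
    ultimately show ?thesis using TH_restrict[OF \<omega>(1,2)] res_restrict by metis
  qed
  define \<Phi> where "\<Phi> = class_restriction class_group K v"
  \<comment> \<open>Restriction preserves equivalence because \<open>polys_over K\<close> is
    contained in \<open>polys_over H\<close>, and reflects it by \<open>unique\<close>.\<close>
  have res_equiv: "(res \<eta>, res \<eta>') \<in> eK \<longleftrightarrow> (\<eta>, \<eta>') \<in> eH" if "\<eta> \<in> TH" "\<eta>' \<in> TH" for \<eta> \<eta>'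
  proof
    assume "(\<eta>, \<eta>') \<in> eH"
    then have "order_equiv (polys_over H) \<eta> \<eta>'" by (simp add: eH)
    then have "order_equiv (polys_over K) \<eta> \<eta>'" by (rule order_equiv_subset[OF _ PKH])
    then show "(res \<eta>, res \<eta>') \<in> eK" using resT that by (simp add: eK order_equiv_def res_def)
  qed (use unique that in \<open>simp add: eH eK\<close>)
  have \<Phi>: "\<Phi> (eH `` {\<eta>}) = eK `` {res \<eta>}" if \<eta>: "\<eta> \<in> TH" for \<eta>
  proof -
    have "\<Phi> (eH `` {\<eta>}) = (\<Union>\<eta>'\<in>eH `` {\<eta>}. eK `` {res \<eta>'})"
      by (simp add: \<Phi>_def class_restriction_def eK_def res_def)
    \<comment> \<open>All classes in the union coincide.\<close>
    moreover have "eK `` {res \<eta>'} = eK `` {res \<eta>}" if "\<eta>' \<in> eH `` {\<eta>}" for \<eta>'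
    proof -
      have "(\<eta>, \<eta>') \<in> eH" using that by simp
      then have "(res \<eta>, res \<eta>') \<in> eK" using res_equiv[OF \<eta>, of \<eta>'] by (auto simp: eH)
      then show ?thesis using equiv_class_eq[OF eqK] by simp
    qed
    moreover have "\<eta> \<in> eH `` {\<eta>}" by (rule equiv_class_self[OF eqH \<eta>])
    ultimately show ?thesis by blast
  qed
  have THq: "\<exists>\<eta>\<in>TH. C = eH `` {\<eta>}" if "C \<in> TH // eH" for C using that by (auto elim: quotientE)
  have inj: "C = D" if C: "C \<in> TH // eH" and D: "D \<in> TH // eH" and eq: "\<Phi> C = \<Phi> D" for C D
  proof -
    obtain \<eta> where \<eta>: "\<eta> \<in> TH" "C = eH `` {\<eta>}" using THq[OF C] by blast
    obtain \<eta>' where \<eta>': "\<eta>' \<in> TH" "D = eH `` {\<eta>'}" using THq[OF D] by blast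
    have "eK `` {res \<eta>} = eK `` {res \<eta>'}" using eq \<Phi>[OF \<eta>(1)] \<Phi>[OF \<eta>'(1)] \<eta> \<eta>' by simp
    then have "(res \<eta>, res \<eta>') \<in> eK" using eq_equiv_class[OF _ eqK resT[OF \<eta>'(1)]] by blast
    then have "(\<eta>, \<eta>') \<in> eH" using res_equiv \<eta> \<eta>' by blast
    then show ?thesis using equiv_class_eq[OF eqH] \<eta> \<eta>' by blast
  qed
  have "\<Phi> ` (TH // eH) = TK // eK"
  proof (intro equalityI subsetI)
    fix D assume "D \<in> \<Phi> ` (TH // eH)"
    then obtain \<eta> where "\<eta> \<in> TH" "D = \<Phi> (eH `` {\<eta>})" using THq by blast
    then show "D \<in> TK // eK" using \<Phi> resT quotientI by metis
  next
    fix D assume "D \<in> TK // eK"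
    then obtain \<mu> where \<mu>: "\<mu> \<in> TK" "D = eK `` {\<mu>}" by (auto elim: quotientE)
    then obtain \<eta> where "\<eta> \<in> TH" "res \<eta> = \<mu>" using surj by blast
    then show "D \<in> \<Phi> ` (TH // eH)" using \<Phi> \<mu>(2) quotientI[of \<eta> TH eH] by blast
  qed
  then have bij: "bij_betw \<Phi> (TH // eH) (TK // eK)"
    using inj by (simp add: bij_betw_def inj_on_def)
  have order: "tree_le class_group H C D \<longleftrightarrow> tree_le class_group K (\<Phi> C) (\<Phi> D)" 
    if C: "C \<in> TH // eH" and D: "D \<in> TH // eH" for C D
  proof -
    obtain \<eta> where \<eta>: "\<eta> \<in> TH" "C = eH `` {\<eta>}" using THq[OF C] by blast
    obtain \<eta>' where \<eta>': "\<eta>' \<in> TH" "D = eH `` {\<eta>'}" using THq[OF D] by blast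
    have resC: "res \<xi> \<in> \<Phi> (eH `` {\<zeta>}) \<longleftrightarrow> \<xi> \<in> eH `` {\<zeta>}" if "\<xi> \<in> TH" "\<zeta> \<in> TH" for \<xi> \<zeta>
      using \<Phi>[OF that(2)] res_equiv[OF that(2,1)] by simp
    have "(\<exists>\<nu>\<in>C. \<exists>\<mu>\<in>D. valuation_le class_group H \<nu> \<mu>) \<longleftrightarrow> 
        (\<exists>\<nu>\<in>\<Phi> C. \<exists>\<mu>\<in>\<Phi> D. valuation_le class_group K \<nu> \<mu>)"
    proof
      assume "\<exists>\<nu>\<in>C. \<exists>\<mu>\<in>D. valuation_le class_group H \<nu> \<mu>"
      then obtain \<nu> \<mu> where n: "\<nu> \<in> C" "\<mu> \<in> D" "valuation_le class_group H \<nu> \<mu>" by blast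
      then have T: "\<nu> \<in> TH" "\<mu> \<in> TH" using \<eta>(2) \<eta>'(2) eH by auto
      have "valuation_le class_group K (res \<nu>) (res \<mu>)"
        using n(3) PKH by (auto simp: valuation_le_def res_def)
      moreover have "res \<nu> \<in> \<Phi> C" "res \<mu> \<in> \<Phi> D"
        using resC[OF T(1) \<eta>(1)] resC[OF T(2) \<eta>'(1)] n \<eta> \<eta>' by auto
      ultimately show "\<exists>\<nu>\<in>\<Phi> C. \<exists>\<mu>\<in>\<Phi> D. valuation_le class_group K \<nu> \<mu>" by blast
    next
      assume "\<exists>\<nu>\<in>\<Phi> C. \<exists>\<mu>\<in>\<Phi> D. valuation_le class_group K \<nu> \<mu>"
      then obtain \<nu> \<mu> where n: "\<nu> \<in> \<Phi> C" "\<mu> \<in> \<Phi> D" "valuation_le class_group K \<nu> \<mu>" by blast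
      then have T: "\<nu> \<in> TK" "\<mu> \<in> TK" using \<Phi>[OF \<eta>(1)] \<Phi>[OF \<eta>'(1)] \<eta>(2) \<eta>'(2) eK by auto
      \<comment> \<open>The upper representative is lifted first and the lower one then below that
        lift; they land in \<open>D\<close> and \<open>C\<close> because restriction reflects
        equivalence.\<close>
      obtain \<mu>1 where \<mu>1: "\<mu>1 \<in> TH" "res \<mu>1 = \<mu>" using surj[OF T(2)] by blast
      obtain \<nu>1 where \<nu>1: "\<nu>1 \<in> TH" "res \<nu>1 = \<nu>" "valuation_le class_group H \<nu>1 \<mu>1"
        using lift[OF T(1) \<mu>1(1)] n(3) \<mu>1(2) by blast
      have "\<nu>1 \<in> C" "\<mu>1 \<in> D"
        using resC[OF \<nu>1(1) \<eta>(1)] resC[OF \<mu>1(1) \<eta>'(1)] n \<eta> \<eta>' \<nu>1 \<mu>1 by auto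
      then show "\<exists>\<nu>\<in>C. \<exists>\<mu>\<in>D. valuation_le class_group H \<nu> \<mu>" using \<nu>1(3) by blast
    qed
    \<comment> \<open>Injectivity takes care of the equality of classes in \<open>tree_le\<close>
      and \<open>tree_less\<close>.\<close>
    then show ?thesis using inj[OF C D] by (auto simp: tree_le_def tree_less_def)
  qed
  show ?thesis
    unfolding poset_isomorphism_def val_tree_def
    using bij order unfolding \<Phi>_def H_def vh_def TH_def TK_def eH_def eK_def by blast
qed

end
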